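(* Assume $X_t \in \mathcal{L}^p$ for some $p>2$ and $\mathbb{E} X_t=0$. If $\Theta_p(m) = o(1/\log m)$ as $m\to\infty$ and $\min_{\theta} f(\theta)>0$, then $$\lim_{T\to\infty} P\left\{ \frac{\pi[\min_{\theta}f(\theta)]^2 \log T}{12\,\Theta_2^2} \leq \lambda(\hat\Sigma_{T}) \leq 10\,\Theta_2^2 \log T \right\} = 1.$$
   Context: Let $\varepsilon_t$, $t\in\mathbb{Z}$, be i.i.d. random variables and let $g$ be a measurable real-valued function such that $X_t = g(\varepsilon_t,\varepsilon_{t-1},\ldots)$ is well defined; $(X_t)_{t\in\mathbb{Z}}$ is then a stationary process. Write $\|X\|_p = (\mathbb{E}|X|^p)^{1/p}$ and $X\in\mathcal{L}^p$ if $\|X\|_p<\infty$. Let $(\varepsilon_t')_{t\in\mathbb{Z}}$ be an independent i.i.d. copy of $(\varepsilon_t)_{t\in\mathbb{Z}}$. For $t\ge 0$ let $X_t' = g(\varepsilon_t,\ldots,\varepsilon_1,\varepsilon_0',\varepsilon_{-1},\ldots)$, i.e. $\varepsilon_0$ is replaced by $\varepsilon_0'$. For $p>0$ define the physical dependence measures $\delta_p(t) = \|X_t-X_t'\|_p$ for $t\ge 0$, and $\Theta_p(m) = \sum_{t=m}^\infty \delta_p(t)$ for $m\ge 0$, $\Theta_p = \Theta_p(0)$. Standing assumption: $\Theta_p<\infty$ (short-range dependence). Autocovariances (mean zero): $\gamma_k = \mathbb{E}(X_0X_k)$, $k\in\mathbb{Z}$. Spectral density: $f(\theta) = \frac{1}{2\pi}\sum_{k\in\mathbb{Z}}\gamma_k\cos(k\theta)$.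 Sample autocovariances from observations $X_1,\ldots,X_T$: $\hat\gamma_k = \frac1T\sum_{t=|k|+1}^{T} X_{t-|k|}X_t$ for $|k|\le T-1$. Sample covariance matrix: $\hat\Sigma_T = (\hat\gamma_{s-t})_{1\le s,t\le T}$. For a symmetric real matrix $A$, $\lambda(A) = \max_{|\mathbf{x}|=1}|A\mathbf{x}|$ is the operator norm (spectral radius), $|\cdot|$ being the Euclidean norm. *)

theory Defs
  imports
    "HOL-Probability.Probability"
    "HOL-Library.Landau_Symbols"
    "Jordan_Normal_Form.Matrix"
begin

no_notation Finite_Cartesian_Product.vec_nth (infixl "$" 90)

definition iid :: "'a measure \<Rightarrow> (int \<Rightarrow> 'a \<Rightarrow> real) \<Rightarrow> bool" where
  "iid M e \<longleftrightarrow> prob_space.indep_vars M (\<lambda>_. borel) e UNIV \<and>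
     (\<forall>t. distr M borel (e t) = distr M borel (e 0))"

definition independent_copy ::
    "'a measure \<Rightarrow> (int \<Rightarrow> 'a \<Rightarrow> real) \<Rightarrow> (int \<Rightarrow> 'a \<Rightarrow> real) \<Rightarrow> bool" where
  "independent_copy M e e' \<longleftrightarrow> iid M e' \<and> distr M borel (e' 0) = distr M borel (e 0) \<and>
     prob_space.indep_var M
       (\<Pi>\<^sub>M t\<in>UNIV. borel) (\<lambda>\<omega> t. e t \<omega>) (\<Pi>\<^sub>M t\<in>UNIV. borel) (\<lambda>\<omega> t. e' t \<omega>)"

text \<open>The \<open>j\<close>-th argument of \<open>g\<close> is the innovation at time \<open>t - j\<close>.\<close>

definition causal_process ::
    "((nat \<Rightarrow> real) \<Rightarrow> real) \<Rightarrow> (int \<Rightarrow> 'a \<Rightarrow> real) \<Rightarrow> int \<Rightarrow> 'a \<Rightarrow> real" where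
  "causal_process g e t \<omega> = g (\<lambda>j. e (t - int j) \<omega>)"

text \<open>With the Bochner integral, the following is \<open>0\<close> rather than infinite for \<open>X\<close> outside
  \<open>L\<^sup>p\<close>; it is the \<open>L\<^sup>p\<close> norm only for \<open>X\<close> satisfying \<open>in_Lp\<close>.\<close>

definition Lp_norm :: "'a measure \<Rightarrow> real \<Rightarrow> ('a \<Rightarrow> real) \<Rightarrow> real" where
  "Lp_norm M p X = (LINT \<omega>|M. \<bar>X \<omega>\<bar> powr p) powr (1 / p)"

definition in_Lp :: "'a measure \<Rightarrow> real \<Rightarrow> ('a \<Rightarrow> real) \<Rightarrow> bool" where
  "in_Lp M p X \<longleftrightarrow> X \<in> borel_measurable M \<and> integrable M (\<lambda>\<omega>. \<bar>X \<omega>\<bar> powr p)"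

definition dep_measure ::
    "'a measure \<Rightarrow> ((nat \<Rightarrow> real) \<Rightarrow> real) \<Rightarrow> (int \<Rightarrow> 'a \<Rightarrow> real) \<Rightarrow> (int \<Rightarrow> 'a \<Rightarrow> real) \<Rightarrow>
     real \<Rightarrow> nat \<Rightarrow> real" where
  "dep_measure M g e e' p t =
     Lp_norm M p (\<lambda>\<omega>. causal_process g e (int t) \<omega> - causal_process g (e(0 := e' 0)) (int t) \<omega>)"

text \<open>A real series: it is the tail sum only if \<open>dep_measure M g e e' p\<close> is summable.\<close>

definition dep_tail ::
    "'a measure \<Rightarrow> ((nat \<Rightarrow> real) \<Rightarrow> real) \<Rightarrow> (int \<Rightarrow> 'a \<Rightarrow> real) \<Rightarrow> (int \<Rightarrow> 'a \<Rightarrow> real) \<Rightarrow>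
     real \<Rightarrow> nat \<Rightarrow> real" where
  "dep_tail M g e e' p m = (\<Sum>t. dep_measure M g e e' p (m + t))"

definition autocov :: "'a measure \<Rightarrow> (int \<Rightarrow> 'a \<Rightarrow> real) \<Rightarrow> int \<Rightarrow> real" where
  "autocov M X k = (LINT \<omega>|M. X 0 \<omega> * X k \<omega>)"

definition spectral_density :: "'a measure \<Rightarrow> (int \<Rightarrow> 'a \<Rightarrow> real) \<Rightarrow> real \<Rightarrow> real" where
  "spectral_density M X \<theta> = 1 / (2 * pi) * (\<Sum>\<^sub>\<infinity>k::int. autocov M X k * cos (of_int k * \<theta>))"

definition sample_autocov :: "(int \<Rightarrow> 'a \<Rightarrow> real) \<Rightarrow> nat \<Rightarrow> 'a \<Rightarrow> int \<Rightarrow> real" where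
  "sample_autocov X T \<omega> k = 1 / real T * (\<Sum>t\<in>{\<bar>k\<bar> + 1..int T}. X (t - \<bar>k\<bar>) \<omega> * X t \<omega>)"

text \<open>Indices run over \<open>0..<T\<close> instead of \<open>1..T\<close>; the entries depend only on their difference.\<close>

definition sample_cov_mat :: "(int \<Rightarrow> 'a \<Rightarrow> real) \<Rightarrow> nat \<Rightarrow> 'a \<Rightarrow> real mat" where
  "sample_cov_mat X T \<omega> = Matrix.mat T T (\<lambda>(s, t). sample_autocov X T \<omega> (int s - int t))"

definition eucl_norm :: "real Matrix.vec \<Rightarrow> real" where
  "eucl_norm x = L2_set (\<lambda>i. x $ i) {..<dim_vec x}"

text \<open>The supremum is a maximum when \<open>A\<close> has at least one column, by compactness of the unit
  sphere; for matrices without columns it is unspecified.\<close>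

definition op_norm :: "real mat \<Rightarrow> real" where
  "op_norm A = (SUP x\<in>{x \<in> carrier_vec (dim_col A). eucl_norm x = 1}. eucl_norm (A *\<^sub>v x))"

end

theory Submission
  imports Defs "HOL-Real_Asymp.Real_Asymp"
begin

text \<open>
  Read backwards from time \<open>T\<close>, the innovations form an i.i.d. sequence
  \<open>y\<close>, and the observation \<open>i\<close> steps before time \<open>T\<close>
  is \<open>g (shift i y)\<close>. The whole problem thus takes place on one product space \<open>S\<close>
  with its measure preserving shift, and conditioning on the past of the innovations is integration
  over the coordinate \<open>0\<close> (the operator \<open>avg\<close>).

  A Toeplitz matrix of size \<open>T\<close> embeds into a circulant matrix of size \<open>2T\<close>.
  For the sample covariance matrix the eigenvalues of the circulant are the values of the periodogram
  \<open>(C\<^sup>2 + S\<^sup>2) / T\<close> at the frequencies \<open>\<pi> k / T\<close>, where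
  \<open>C\<close> and \<open>S\<close> are the cosine and sine sums of the data. Their maximum is an
  upper bound for the operator norm (\<open>op_norm_toeplitz_le\<close>). Testing the quadratic form
  with the vectors \<open>cos (\<theta> i)\<close> and \<open>sin (\<theta> i)\<close> shows that, conversely, the
  operator norm is at least \<open>C\<^sup>2 / (2 T)\<close> at every frequency
  (\<open>op_norm_toeplitz_ge\<close>). It remains to determine, up to constants, the maximum of order
  \<open>T\<close> many trigonometric sums, which is of order \<open>sqrt (T ln T)\<close>.

  Upper bound. A centred function of finitely many innovations is a sum of martingale differences
  \<open>mpart q j\<close> whose \<open>L\<^sup>2\<close> norms are at most the dependence coefficients
  (\<open>l2norm_mpart_le\<close>). A martingale sum divided by the square root of its quadratic variation
  is sub-Gaussian, whatever the size of the differences (\<open>exponential_supermartingale\<close>); hence the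
  maximum of \<open>4 T\<close> such sums exceeds \<open>sqrt (5 T ln T)\<close> times the sum of the
  coefficients with vanishing probability. The same argument in expectation bounds the maximum for the
  difference between \<open>g\<close> and a bounded function of finitely many innovations by an arbitrarily
  small multiple of \<open>sqrt (T ln T)\<close> (\<open>exists_maximal_approximant\<close>), so that the
  bound carries over to \<open>g\<close> itself (\<open>maxform_concentration\<close>).

  Lower bound. After the same approximation, and up to negligible boundary terms, the process may be
  replaced by bounded finitely dependent martingale differences \<open>D\<close> with a variance close to the
  long-run variance \<open>V = 2 \<pi> f(0)\<close>. Cutting time into long blocks separated by short
  gaps makes the block sums independent. At about \<open>sqrt n\<close> Fourier frequencies of
  the \<open>n\<close> blocks the cosine vectors are orthogonal, so that the exponential moments of the
  trigonometric sums are asymptotically uncorrelated, and the second moment method shows that one of the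
  sums is large (\<open>block_max_lower\<close>). Since these are the lowest of the frequencies, the cosine
  is nearly constant on each block. The result is a cosine sum of
  size at least \<open>3/25 sqrt (V T ln T)\<close> (\<open>maxform_lower_bound\<close>).

  Wherever its series converges, the spectral density is a limit of expected periodograms and hence
  nonnegative. It is therefore bounded below, its infimum is at most \<open>f(0)\<close>, and
  \<open>V = 2 \<pi> f(0)\<close> is at most the square of \<open>\<Theta>\<^sub>2\<close>.
  The two constants then follow from
  \<open>10 = 2 \<cdot> 5\<close> and from \<open>(3/25)\<^sup>2 / 2 \<ge> 1 / (48 \<pi>)\<close>.
\<close>

section \<open>The shift on the space of innovation sequences\<close>

text \<open>A sequence lists the innovations backwards in time, so \<open>shift n\<close> goes
  \<open>n\<close> steps into the past.\<close>

definition shift :: "nat \<Rightarrow> (nat \<Rightarrow> 'b) \<Rightarrow> nat \<Rightarrow> 'b" where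
  "shift n y = (\<lambda>i. y (n + i))"

lemma shift_0 [simp]: "shift 0 y = y"
  by (simp add: shift_def)

lemma shift_shift [simp]: "shift m (shift n y) = shift (n + m) y"
  by (simp add: shift_def add.assoc)

lemma shift_Suc_case_nat [simp]: "shift (Suc n) (case_nat x y) = shift n y"
  by (simp add: shift_def)

definition finite_range :: "nat \<Rightarrow> ((nat \<Rightarrow> 'b) \<Rightarrow> real) \<Rightarrow> bool" where
  "finite_range K f \<longleftrightarrow> (\<forall>y z. (\<forall>i<K. y i = z i) \<longrightarrow> f y = f z)"

lemma finite_range_mono: "finite_range K f \<Longrightarrow> K \<le> L \<Longrightarrow> finite_range L f"
  by (auto simp: finite_range_def)

lemma finite_range_shift: "finite_range K f \<Longrightarrow> finite_range (n + K) (\<lambda>y. f (shift n y))"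
  by (auto simp: finite_range_def shift_def)

text \<open>With a full space for a single innovation, every sequence belongs to the product space, and no
  membership conditions arise below.\<close>

locale innovation_space = sequence_space \<mu> for \<mu> :: "'b measure" +
  assumes space_mu: "space \<mu> = UNIV"
begin

lemma space_S [simp]: "space S = UNIV"
  by (auto simp: space_PiM space_mu)

lemma prob_UNIV [simp]: "P.prob UNIV = 1"
  using P.prob_space by simp

lemma measurable_shift [measurable]: "shift n \<in> S \<rightarrow>\<^sub>M S"
  unfolding shift_def by (rule measurable_PiM_single') (auto simp: space_PiM space_mu)

text \<open>Filling the first \<open>n\<close> coordinates by those of an independent sequence does not
  change the product measure, and the shift removes them again.\<close>

lemma distr_shift: "distr S S (shift n) = S"
proof -
  have "distr (S \<Otimes>\<^sub>M S) S snd = S"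
  proof (rule measure_eqI)
    fix A assume "A \<in> sets (distr (S \<Otimes>\<^sub>M S) S snd)"
    then have A: "A \<in> sets S" by simp
    have "snd -` A \<inter> space (S \<Otimes>\<^sub>M S) = space S \<times> A"
      by (auto simp: space_pair_measure)
    moreover have "emeasure (S \<Otimes>\<^sub>M S) (space S \<times> A) = emeasure S A"
      by (subst P.emeasure_pair_measure_Times[OF _ A]) (simp_all only: sets.top P.emeasure_space_1 mult_1)
    ultimately show "emeasure (distr (S \<Otimes>\<^sub>M S) S snd) A = emeasure S A"
      using A by (simp add: emeasure_distr)
  qed simp
  then have "S = distr (S \<Otimes>\<^sub>M S) S (\<lambda>(y, z). shift n (comb_seq n y z))"
    by (simp add: shift_def comb_seq_def split_def)
  also have "\<dots> = distr (distr (S \<Otimes>\<^sub>M S) S (\<lambda>(y, z). comb_seq n y z)) S (shift n)"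
    by (subst distr_distr) (auto simp: comp_def split_def)
  also have "\<dots> = distr S S (shift n)"
    by (simp only: PiM_comb_seq)
  finally show ?thesis by simp
qed

lemma integral_shift:
  fixes f :: "(nat \<Rightarrow> 'b) \<Rightarrow> real"
  assumes [measurable]: "f \<in> borel_measurable S"
  shows "(\<integral>y. f (shift n y) \<partial>S) = (\<integral>y. f y \<partial>S)"
  using integral_distr[of "shift n" S S f] by (simp add: distr_shift)

lemma integrable_shift:
  fixes f :: "(nat \<Rightarrow> 'b) \<Rightarrow> real"
  assumes "integrable S f"
  shows "integrable S (\<lambda>y. f (shift n y))"
  using integrable_distr[of "shift n" S S f] assms by (simp add: distr_shift)

lemma prob_shift:
  assumes [measurable]: "A \<in> sets S"
  shows "measure S {y. shift n y \<in> A} = measure S A"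
  using measure_distr[of "shift n" S S A] by (simp add: distr_shift vimage_def)

text \<open>Bounded measurable functions are closed under all operations that occur in the martingale
  arguments; integrability never needs a separate proof.\<close>

definition bmeas :: "((nat \<Rightarrow> 'b) \<Rightarrow> real) \<Rightarrow> bool" where
  "bmeas f \<longleftrightarrow> f \<in> borel_measurable S \<and> (\<exists>B. \<forall>y. \<bar>f y\<bar> \<le> B)"

lemma bmeasD [measurable_dest, simp]: "bmeas f \<Longrightarrow> f \<in> borel_measurable S"
  by (simp add: bmeas_def)

lemma bmeas_bound: 
  assumes "bmeas f" 
  obtains B where "B > 0" "\<And>y. \<bar>f y\<bar> \<le> B"
proof -
  from assms obtain B where "\<And>y. \<bar>f y\<bar> \<le> B" by (auto simp: bmeas_def)
  then have "\<And>y. \<bar>f y\<bar> \<le> \<bar>B\<bar> + 1" by (meson abs_ge_self le_add_same_cancel1 order_trans zero_le_one)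
  then show ?thesis by (intro that[of "\<bar>B\<bar> + 1"]) auto
qed

lemma bmeasI: "f \<in> borel_measurable S \<Longrightarrow> (\<And>y. \<bar>f y\<bar> \<le> B) \<Longrightarrow> bmeas f"
  by (auto simp: bmeas_def)

lemma integrable_bmeas: 
  assumes "bmeas f" shows "integrable S f"
proof -
  obtain B where B: "\<And>y. \<bar>f y\<bar> \<le> B" using assms bmeas_bound by blast
  show ?thesis using assms B
    by (intro P.integrable_const_bound[of _ B]) (auto simp: bmeas_def)
qed

lemma bmeas_const [simp, intro]: "bmeas (\<lambda>_. c)"
  by (rule bmeasI[of _ "\<bar>c\<bar>"]) auto

lemma bmeas_add [intro]: 
  assumes "bmeas f" "bmeas g" shows "bmeas (\<lambda>y. f y + g y)"
proof -
  obtain B where B: "\<And>y. \<bar>f y\<bar> \<le> B" using assms bmeas_bound by blast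
  obtain C where C: "\<And>y. \<bar>g y\<bar> \<le> C" using assms bmeas_bound by blast
  have "\<bar>f y + g y\<bar> \<le> B + C" for y using B[of y] C[of y] by linarith
  then show ?thesis using assms by (intro bmeasI) (auto simp: bmeas_def)
qed

lemma bmeas_mult [intro]: 
  assumes "bmeas f" "bmeas g" shows "bmeas (\<lambda>y. f y * g y)"
proof -
  obtain B where B: "\<And>y. \<bar>f y\<bar> \<le> B" using assms bmeas_bound by blast
  obtain C where C: "\<And>y. \<bar>g y\<bar> \<le> C" using assms bmeas_bound by blast
  have "\<bar>f y * g y\<bar> \<le> B * C" for y 
    unfolding abs_mult using B[of y] C[of y] by (intro mult_mono) auto
  then show ?thesis using assms by (intro bmeasI) (auto simp: bmeas_def)
qed

lemma bmeas_cmult [intro]: "bmeas f \<Longrightarrow> bmeas (\<lambda>y. c * f y)"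
  using bmeas_mult[OF bmeas_const] by blast

lemma bmeas_uminus [intro]: "bmeas f \<Longrightarrow> bmeas (\<lambda>y. - f y)"
  using bmeas_cmult[of f "-1"] by simp

lemma bmeas_diff [intro]: "bmeas f \<Longrightarrow> bmeas g \<Longrightarrow> bmeas (\<lambda>y. f y - g y)"
  using bmeas_add[of f "\<lambda>y. - g y"] by (simp add: bmeas_uminus)

lemma bmeas_power [intro]: "bmeas f \<Longrightarrow> bmeas (\<lambda>y. f y ^ k)"
  by (induction k) auto

lemma bmeas_sum [intro]: "(\<And>i. i \<in> I \<Longrightarrow> bmeas (f i)) \<Longrightarrow> bmeas (\<lambda>y. \<Sum>i\<in>I. f i y)"
  by (induction I rule: infinite_finite_induct) auto

lemma bmeas_prod [intro]: "(\<And>i. i \<in> I \<Longrightarrow> bmeas (f i)) \<Longrightarrow> bmeas (\<lambda>y. \<Prod>i\<in>I. f i y)"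
  by (induction I rule: infinite_finite_induct) auto

lemma bmeas_exp [intro]: 
  assumes "bmeas f" shows "bmeas (\<lambda>y. exp (f y))"
proof -
  obtain B where B: "\<And>y. \<bar>f y\<bar> \<le> B" using assms bmeas_bound by blast
  have "\<bar>exp (f y)\<bar> \<le> exp B" for y using B[of y] by simp
  then show ?thesis using assms by (intro bmeasI) (auto simp: bmeas_def)
qed

lemma bmeas_abs [intro]: 
  assumes "bmeas f" shows "bmeas (\<lambda>y. \<bar>f y\<bar>)"
  using assms by (auto simp: bmeas_def)

lemma bmeas_shift [intro]: 
  assumes "bmeas f" shows "bmeas (\<lambda>y. f (shift n y))"
  using assms by (auto simp: bmeas_def)

lemma bmeas_divide [intro]: "bmeas f \<Longrightarrow> bmeas (\<lambda>y. f y / c)"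
  using bmeas_cmult[of f "1 / c"] by simp

text \<open>The most recent innovation is integrated out. As a function of the remaining sequence,
  \<open>avg f\<close> at \<open>shift 1 y\<close> is the conditional expectation of
  \<open>f\<close> given the past.\<close>

definition avg :: "((nat \<Rightarrow> 'b) \<Rightarrow> real) \<Rightarrow> (nat \<Rightarrow> 'b) \<Rightarrow> real" where
  "avg f y = (\<integral>x. f (case_nat x y) \<partial>\<mu>)"

lemma measurable_case_nat_pair [measurable]: "(\<lambda>(x, y). case_nat x y) \<in> \<mu> \<Otimes>\<^sub>M S \<rightarrow>\<^sub>M S"
  by (simp add: split_def)

lemma measurable_case_nat_slice [measurable]: "(\<lambda>x. case_nat x y) \<in> \<mu> \<rightarrow>\<^sub>M S"
  by (rule measurable_PiM_single') (auto simp: space_PiM space_mu split: nat.split)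

lemma borel_measurable_avg [measurable]:
  assumes [measurable]: "f \<in> borel_measurable S"
  shows "avg f \<in> borel_measurable S"
  unfolding avg_def by measurable

lemma integrable_slice: 
  assumes "bmeas f" shows "integrable \<mu> (\<lambda>x. f (case_nat x y))"
proof -
  obtain B where B: "\<And>y. \<bar>f y\<bar> \<le> B" using assms bmeas_bound by blast
  show ?thesis using assms B
    by (intro M.integrable_const_bound[of _ B]) (auto intro: measurable_compose[OF measurable_case_nat_slice])
qed

lemma avg_bound:
  assumes "bmeas f" "\<And>y. f y \<le> B" shows "avg f y \<le> B"
  unfolding avg_def using integral_mono[OF integrable_slice[OF assms(1)], of "\<lambda>_. B"] assms(2)
  by (simp add: M.prob_space)

lemma bmeas_avg [intro]: assumes "bmeas f" shows "bmeas (avg f)"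
proof -
  obtain B where B: "\<And>y. \<bar>f y\<bar> \<le> B" using assms bmeas_bound by blast
  have "avg f y \<le> B" for y
    using B assms by (intro avg_bound) (auto simp: abs_le_iff)
  moreover have "avg (\<lambda>y. - f y) y \<le> B" for y
    using B assms by (intro avg_bound) (auto simp: abs_le_iff)
  then have "- avg f y \<le> B" for y
    by (simp add: avg_def)
  ultimately have "\<bar>avg f y\<bar> \<le> B" for y by (simp add: abs_le_iff)
  then show ?thesis using assms by (intro bmeasI[of _ B]) (auto intro: borel_measurable_avg)
qed

lemmas bmeas_intros = bmeas_const bmeas_add bmeas_mult bmeas_uminus bmeas_diff bmeas_divide
  bmeas_power bmeas_sum bmeas_prod bmeas_exp bmeas_abs bmeas_avg bmeas_shift

lemma avg_add: "bmeas f \<Longrightarrow> bmeas g \<Longrightarrow> avg (\<lambda>y. f y + g y) = (\<lambda>y. avg f y + avg g y)"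
  by (simp add: avg_def fun_eq_iff integrable_slice)

lemma avg_diff: "bmeas f \<Longrightarrow> bmeas g \<Longrightarrow> avg (\<lambda>y. f y - g y) = (\<lambda>y. avg f y - avg g y)"
  by (simp add: avg_def fun_eq_iff integrable_slice)

lemma avg_sum: "(\<And>i. i \<in> I \<Longrightarrow> bmeas (f i)) \<Longrightarrow> avg (\<lambda>y. \<Sum>i\<in>I. f i y) = (\<lambda>y. \<Sum>i\<in>I. avg (f i) y)"
  by (simp add: avg_def fun_eq_iff integrable_slice)

lemma avg_cmult: "avg (\<lambda>y. c * f y) = (\<lambda>y. c * avg f y)"
  by (simp add: avg_def fun_eq_iff)

lemma avg_const [simp]: "avg (\<lambda>_. c) = (\<lambda>_. c)"
  by (simp add: avg_def fun_eq_iff M.prob_space)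

lemma avg_mono: "bmeas f \<Longrightarrow> bmeas g \<Longrightarrow> (\<And>y. f y \<le> g y) \<Longrightarrow> avg f y \<le> avg g y"
  unfolding avg_def by (intro integral_mono integrable_slice) auto

lemma avg_mult_shift: "avg (\<lambda>y. f y * g (shift (Suc 0) y)) = (\<lambda>y. avg f y * g y)"
  by (simp add: avg_def fun_eq_iff)

lemma avg_shift: "avg (\<lambda>y. g (shift (Suc 0) y)) = g"
  by (simp add: avg_def fun_eq_iff M.prob_space)

lemma integral_avg:
  assumes f: "bmeas f" shows "(\<integral>y. avg f y \<partial>S) = (\<integral>y. f y \<partial>S)"
proof -
  interpret Q: pair_prob_space \<mu> S ..
  have [measurable]: "f \<in> borel_measurable S" using f by auto
  obtain B where B: "\<And>y. \<bar>f y\<bar> \<le> B" using f bmeas_bound by blast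
  have "(\<integral>y. f y \<partial>S) = (\<integral>y. f y \<partial>distr (\<mu> \<Otimes>\<^sub>M S) S (\<lambda>(x, y). case_nat x y))"
    by (simp only: PiM_iter)
  also have "\<dots> = (\<integral>p. f (case_nat (fst p) (snd p)) \<partial>(\<mu> \<Otimes>\<^sub>M S))"
    by (subst integral_distr) (auto simp: split_def)
  also have "\<dots> = (\<integral>y. (\<integral>x. f (case_nat x y) \<partial>\<mu>) \<partial>S)"
    using B by (subst Q.integral_snd) 
      (auto simp: split_def intro!: Q.P.integrable_const_bound[of _ B])
  finally show ?thesis by (simp add: avg_def)
qed

lemma avg_square_le:
  assumes "bmeas f" shows "(avg f y)\<^sup>2 \<le> avg (\<lambda>y. (f y)\<^sup>2) y"
proof -
  let ?m = "avg f y"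
  have "0 \<le> avg (\<lambda>z. (f z - ?m)\<^sup>2) y"
    by (simp add: avg_def)
  also have "avg (\<lambda>z. (f z - ?m)\<^sup>2) = (\<lambda>z. avg (\<lambda>z. (f z)\<^sup>2 - (2 * ?m * f z - ?m\<^sup>2)) z)"
    by (intro ext arg_cong[of _ _ "\<lambda>f. avg f _"]) (auto simp: power2_eq_square algebra_simps)
  also have "avg (\<lambda>z. (f z)\<^sup>2 - (2 * ?m * f z - ?m\<^sup>2)) = (\<lambda>z. avg (\<lambda>z. (f z)\<^sup>2) z - (avg (\<lambda>z. 2 * ?m * f z) z - ?m\<^sup>2))"
    by (subst avg_diff[OF bmeas_power[OF assms] bmeas_diff[OF bmeas_cmult[OF assms] bmeas_const]],
        subst avg_diff[OF bmeas_cmult[OF assms] bmeas_const]) simp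
  also have "avg (\<lambda>z. 2 * ?m * f z) y = 2 * ?m * ?m"
    by (simp add: avg_def)
  finally show ?thesis by (simp add: power2_eq_square)
qed

lemma bmeas_funpow_avg [intro]: "bmeas f \<Longrightarrow> bmeas ((avg ^^ j) f)"
  by (induction j) auto

lemma integral_funpow_avg: "bmeas f \<Longrightarrow> (\<integral>y. (avg ^^ j) f y \<partial>S) = (\<integral>y. f y \<partial>S)"
proof (induction j)
  case (Suc j)
  then show ?case using integral_avg[OF bmeas_funpow_avg[OF Suc.prems, of j]] by simp
qed simp

lemma finite_range_avg: 
  fixes f :: "(nat \<Rightarrow> 'b) \<Rightarrow> real"
  shows "finite_range (Suc K) f \<Longrightarrow> finite_range K (avg f)"
  unfolding finite_range_def avg_def
proof (intro allI impI)
  fix y z :: "nat \<Rightarrow> 'b"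
  assume f: "\<forall>y z. (\<forall>i<Suc K. y i = z i) \<longrightarrow> f y = f z" and yz: "\<forall>i<K. y i = z i"
  have "f (case_nat x y) = f (case_nat x z)" for x
    using yz by (intro f[rule_format]) (auto split: nat.split)
  then show "(\<integral>x. f (case_nat x y) \<partial>\<mu>) = (\<integral>x. f (case_nat x z) \<partial>\<mu>)" by simp
qed

text \<open>A function of \<open>K\<close> innovations has no randomness left after \<open>K\<close>
  averages.\<close>

lemma funpow_avg_const:
  assumes "bmeas f" "finite_range K f"
  shows "(avg ^^ K) f = (\<lambda>_. \<integral>y. f y \<partial>S)"
proof -
  have "finite_range (K - j) ((avg ^^ j) f)" if "j \<le> K" for j using that
  proof (induction j)
    case (Suc j)
    then have "finite_range (Suc (K - Suc j)) ((avg ^^ j) f)" by (simp add: Suc_diff_Suc)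
    from finite_range_avg[OF this] show ?case by simp
  qed (use assms in auto)
  from this[of K] have "(avg ^^ K) f y = (avg ^^ K) f z" for y z
    by (simp add: finite_range_def)
  then obtain c where c: "(avg ^^ K) f = (\<lambda>_. c)" by (metis (no_types) ext)
  then have "c = (\<integral>y. (avg ^^ K) f y \<partial>S)" by (simp add: P.prob_space)
  with c show ?thesis by (simp add: integral_funpow_avg assms)
qed

lemma funpow_avg_mult_shift:
  "(avg ^^ j) (\<lambda>y. f y * g (shift j y)) = (\<lambda>y. (avg ^^ j) f y * g y)"
proof (induction j arbitrary: f g)
  case (Suc j)
  have "(avg ^^ Suc j) (\<lambda>y. f y * g (shift (Suc j) y)) 
     = avg ((avg ^^ j) (\<lambda>y. f y * (\<lambda>z. g (shift (Suc 0) z)) (shift j y)))"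
    by simp
  also have "\<dots> = avg (\<lambda>y. (avg ^^ j) f y * g (shift (Suc 0) y))"
    by (subst Suc) simp
  also have "\<dots> = (\<lambda>y. (avg ^^ Suc j) f y * g y)"
    by (simp add: avg_mult_shift)
  finally show ?case .
qed simp

lemma integral_mono_bmeas:
  assumes "bmeas f" "bmeas g" "\<And>y. f y \<le> g y"
  shows "(\<integral>y. f y \<partial>S) \<le> (\<integral>y. g y \<partial>S)"
  using assms by (intro integral_mono integrable_bmeas)

text \<open>The second factor depends only on innovations beyond the first \<open>K\<close>; averaging
  \<open>K\<close> times turns the first factor into its mean.\<close>

lemma integral_mult_indep:
  assumes "bmeas f" "finite_range K f" "bmeas g"
  shows "(\<integral>y. f y * g (shift K y) \<partial>S) = (\<integral>y. f y \<partial>S) * (\<integral>y. g y \<partial>S)"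
proof -
  have "(\<integral>y. f y * g (shift K y) \<partial>S) = (\<integral>y. (avg ^^ K) (\<lambda>y. f y * g (shift K y)) y \<partial>S)"
    by (subst integral_funpow_avg) (use assms in auto)
  also have "\<dots> = (\<integral>y. (\<integral>y. f y \<partial>S) * g y \<partial>S)"
    by (simp add: funpow_avg_mult_shift funpow_avg_const assms(1,2))
  finally show ?thesis by simp
qed

end

section \<open>Norms in \<open>L\<^sup>2\<close> and elementary inequalities\<close>

definition l2norm :: "'c measure \<Rightarrow> ('c \<Rightarrow> real) \<Rightarrow> real" where
  "l2norm N f = sqrt (\<integral>x. (f x)\<^sup>2 \<partial>N)"

lemma l2norm_nonneg [simp]: "0 \<le> l2norm N f"
  by (simp add: l2norm_def)

lemma l2norm_square: "(l2norm N f)\<^sup>2 = (\<integral>x. (f x)\<^sup>2 \<partial>N)"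
  by (simp add: l2norm_def)

lemma integrable_square_add:
  fixes f g :: "'c \<Rightarrow> real"
  assumes [measurable]: "f \<in> borel_measurable N" "g \<in> borel_measurable N"
    and "integrable N (\<lambda>x. (f x)\<^sup>2)" "integrable N (\<lambda>x. (g x)\<^sup>2)"
  shows "integrable N (\<lambda>x. (f x + g x)\<^sup>2)"
proof (rule Bochner_Integration.integrable_bound)
  show "integrable N (\<lambda>x. 2 * (f x)\<^sup>2 + 2 * (g x)\<^sup>2)" using assms by auto
  have "(f x + g x)\<^sup>2 \<le> 2 * (f x)\<^sup>2 + 2 * (g x)\<^sup>2" for x
    using sum_squares_bound[of "f x" "g x"] by (simp add: power2_sum)
  then show "AE x in N. norm ((f x + g x)\<^sup>2) \<le> norm (2 * (f x)\<^sup>2 + 2 * (g x)\<^sup>2)" by simp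
qed simp

lemma integrable_square_diff:
  fixes f g :: "'c \<Rightarrow> real"
  assumes "f \<in> borel_measurable N" "g \<in> borel_measurable N"
    and "integrable N (\<lambda>x. (f x)\<^sup>2)" "integrable N (\<lambda>x. (g x)\<^sup>2)"
  shows "integrable N (\<lambda>x. (f x - g x)\<^sup>2)"
  using integrable_square_add[of f N "\<lambda>x. - g x"] assms by simp

lemma l2norm_uminus [simp]: "l2norm N (\<lambda>x. - f x) = l2norm N f"
  by (simp add: l2norm_def)

lemma l2norm_triangle:
  fixes f g :: "'c \<Rightarrow> real"
  assumes [measurable]: "f \<in> borel_measurable N" "g \<in> borel_measurable N"
    and i: "integrable N (\<lambda>x. (f x)\<^sup>2)" "integrable N (\<lambda>x. (g x)\<^sup>2)"
  shows "l2norm N (\<lambda>x. f x + g x) \<le> l2norm N f + l2norm N g"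
proof (rule field_le_epsilon)
  fix e :: real assume e: "e > 0"
  define a b where "a = l2norm N f + e / 2" and "b = l2norm N g + e / 2"
  have ab: "a > 0" "b > 0" using e by (auto simp: a_def b_def add_nonneg_pos)
  have "(f x + g x)\<^sup>2 \<le> (1 + b / a) * (f x)\<^sup>2 + (1 + a / b) * (g x)\<^sup>2" for x
  proof -
    have "0 \<le> (b * f x - a * g x)\<^sup>2 / (a * b)" using ab by simp
    also have "\<dots> = (b / a) * (f x)\<^sup>2 + (a / b) * (g x)\<^sup>2 - 2 * f x * g x"
      using ab by (simp add: field_simps power2_eq_square)
    finally show ?thesis by (simp add: power2_sum algebra_simps)
  qed
  then have "(\<integral>x. (f x + g x)\<^sup>2 \<partial>N) \<le> (\<integral>x. (1 + b / a) * (f x)\<^sup>2 + (1 + a / b) * (g x)\<^sup>2 \<partial>N)"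
    using i by (intro integral_mono integrable_square_add) auto
  also have "\<dots> = (1 + b / a) * (l2norm N f)\<^sup>2 + (1 + a / b) * (l2norm N g)\<^sup>2"
    using i by (simp add: l2norm_square)
  also have "\<dots> \<le> (1 + b / a) * a\<^sup>2 + (1 + a / b) * b\<^sup>2"
    using ab e by (intro add_mono mult_left_mono power_mono) (auto simp: a_def b_def)
  also have "\<dots> = (a + b)\<^sup>2"
  proof -
    have "(1 + b / a) * a\<^sup>2 = a\<^sup>2 + a * b" "(1 + a / b) * b\<^sup>2 = b\<^sup>2 + a * b"
      using ab by (simp_all add: distrib_right power2_eq_square)
    then show ?thesis by (simp add: power2_sum)
  qed
  finally have "l2norm N (\<lambda>x. f x + g x) \<le> a + b"
    using ab by (simp add: l2norm_def real_le_lsqrt)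
  then show "l2norm N (\<lambda>x. f x + g x) \<le> l2norm N f + l2norm N g + e"
    by (simp add: a_def b_def)
qed

lemma l2norm_triangle_diff:
  fixes f g :: "'c \<Rightarrow> real"
  assumes "f \<in> borel_measurable N" "g \<in> borel_measurable N"
    and "integrable N (\<lambda>x. (f x)\<^sup>2)" "integrable N (\<lambda>x. (g x)\<^sup>2)"
  shows "l2norm N (\<lambda>x. f x - g x) \<le> l2norm N f + l2norm N g"
  using l2norm_triangle[of f N "\<lambda>x. - g x"] assms by simp

lemma l2norm_sum:
  fixes f :: "'i \<Rightarrow> 'c \<Rightarrow> real"
  assumes [measurable]: "\<And>i. i \<in> I \<Longrightarrow> f i \<in> borel_measurable N"
    and "\<And>i. i \<in> I \<Longrightarrow> integrable N (\<lambda>x. (f i x)\<^sup>2)"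
  shows "integrable N (\<lambda>x. (\<Sum>i\<in>I. f i x)\<^sup>2) \<and> l2norm N (\<lambda>x. \<Sum>i\<in>I. f i x) \<le> (\<Sum>i\<in>I. l2norm N (f i))"
  using assms
proof (induction I rule: infinite_finite_induct)
  case (insert i I)
  then have IH: "integrable N (\<lambda>x. (\<Sum>i\<in>I. f i x)\<^sup>2)" "l2norm N (\<lambda>x. \<Sum>i\<in>I. f i x) \<le> (\<Sum>i\<in>I. l2norm N (f i))"
    by auto
  have m: "(\<lambda>x. \<Sum>i\<in>I. f i x) \<in> borel_measurable N" using insert.prems by auto
  have "l2norm N (\<lambda>x. f i x + (\<Sum>i\<in>I. f i x)) \<le> l2norm N (f i) + l2norm N (\<lambda>x. \<Sum>i\<in>I. f i x)"
    using insert.prems IH m by (intro l2norm_triangle) auto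
  moreover have "integrable N (\<lambda>x. (f i x + (\<Sum>i\<in>I. f i x))\<^sup>2)"
    using insert.prems IH m by (intro integrable_square_add) auto
  ultimately show ?case using insert IH by simp
qed (auto simp: l2norm_def)

lemma l2norm_mono:
  fixes f g :: "'c \<Rightarrow> real"
  assumes "integrable N (\<lambda>x. (g x)\<^sup>2)" "f \<in> borel_measurable N" "\<And>x. \<bar>f x\<bar> \<le> \<bar>g x\<bar>"
  shows "integrable N (\<lambda>x. (f x)\<^sup>2)" "l2norm N f \<le> l2norm N g"
proof -
  have *: "(f x)\<^sup>2 \<le> (g x)\<^sup>2" for x using assms(3)[of x] by (simp add: abs_le_square_iff)
  show i: "integrable N (\<lambda>x. (f x)\<^sup>2)"
    by (rule Bochner_Integration.integrable_bound[OF assms(1)]) (use assms * in auto)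
  show "l2norm N f \<le> l2norm N g"
    unfolding l2norm_def by (intro real_sqrt_le_mono integral_mono i assms(1) *)
qed

lemma (in prob_space) expectation_abs_le_l2norm:
  fixes f :: "'a \<Rightarrow> real"
  assumes [measurable]: "f \<in> borel_measurable M" and i: "integrable M (\<lambda>x. (f x)\<^sup>2)"
  shows "integrable M f" "expectation (\<lambda>x. \<bar>f x\<bar>) \<le> l2norm M f"
proof -
  show I: "integrable M f"
    by (rule square_integrable_imp_integrable) (use i in auto)
  let ?m = "expectation (\<lambda>x. \<bar>f x\<bar>)"
  have "0 \<le> expectation (\<lambda>x. (\<bar>f x\<bar> - ?m)\<^sup>2)" by simp
  also have "\<dots> = expectation (\<lambda>x. (f x)\<^sup>2 - (2 * ?m * \<bar>f x\<bar> - ?m\<^sup>2))"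
    by (intro Bochner_Integration.integral_cong) (auto simp: power2_eq_square algebra_simps)
  also have "\<dots> = expectation (\<lambda>x. (f x)\<^sup>2) - ?m\<^sup>2"
    using i I by (simp add: prob_space power2_eq_square)
  finally show "?m \<le> l2norm M f"
    unfolding l2norm_def by (intro real_le_rsqrt) simp
qed

text \<open>The quotient of the two sides has derivative of the same sign as \<open>x\<close>, so it is
  smallest at \<open>0\<close>. The square in the exponent is what makes the bound hold for all
  real \<open>x\<close>, with no boundedness required later.\<close>

lemma exp_minus_half_square_le:
  fixes x :: real
  shows "exp (x - x\<^sup>2 / 2) \<le> 1 + x + x\<^sup>2 / 2"
proof -
  define \<phi> where "\<phi> = (\<lambda>x::real. (1 + x + x\<^sup>2 / 2) * exp (x\<^sup>2 / 2 - x))"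
  have pos: "1 + x / 2 + x\<^sup>2 / 2 \<ge> 0" for x :: real
    using zero_le_power2[of "x + 1/2"] by (simp add: power2_eq_square algebra_simps)
  have D: "(\<phi> has_real_derivative exp (x\<^sup>2 / 2 - x) * (x * (1 + x / 2 + x\<^sup>2 / 2))) (at x)" for x
    unfolding \<phi>_def
    by (rule derivative_eq_intros refl | simp)+ (simp add: power2_eq_square algebra_simps)
  have "\<phi> 0 \<le> \<phi> x"
  proof (cases "x \<ge> 0")
    case True
    show ?thesis
    proof (rule DERIV_nonneg_imp_nondecreasing[OF True])
      fix t :: real assume "0 \<le> t"
      then have "0 \<le> exp (t\<^sup>2 / 2 - t) * (t * (1 + t / 2 + t\<^sup>2 / 2))"
        using pos[of t] by (intro mult_nonneg_nonneg) auto
      with D[of t] show "\<exists>d. (\<phi> has_real_derivative d) (at t) \<and> 0 \<le> d" by blast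
    qed
  next
    case False
    then have x: "x \<le> 0" by simp
    show ?thesis
    proof (rule DERIV_nonpos_imp_nonincreasing[OF x])
      fix t :: real assume "t \<le> 0"
      then have "exp (t\<^sup>2 / 2 - t) * (t * (1 + t / 2 + t\<^sup>2 / 2)) \<le> 0"
        using pos[of t] by (intro mult_nonneg_nonpos mult_nonpos_nonneg) auto
      with D[of t] show "\<exists>d. (\<phi> has_real_derivative d) (at t) \<and> d \<le> 0" by blast
    qed
  qed
  then have "1 \<le> (1 + x + x\<^sup>2 / 2) * exp (x\<^sup>2 / 2 - x)" by (simp add: \<phi>_def)
  then have "1 * exp (x - x\<^sup>2 / 2) \<le> (1 + x + x\<^sup>2 / 2) * exp (x\<^sup>2 / 2 - x) * exp (x - x\<^sup>2 / 2)"
    by (intro mult_right_mono) auto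
  also have "\<dots> = 1 + x + x\<^sup>2 / 2"
    by (simp add: mult.assoc flip: exp_add)
  finally show ?thesis by simp
qed

text \<open>Optimisation over the parameter of an exponential inequality; the minimising value is
  \<open>sqrt (L / c)\<close>.\<close>

lemma le_two_sqrt_of_quadratic:
  fixes x L c :: real
  assumes "L > 0" "c \<ge> 0" "\<And>l. l > 0 \<Longrightarrow> l * x \<le> L + l\<^sup>2 * c"
  shows "x \<le> 2 * sqrt (L * c)"
proof (cases "c = 0")
  case True
  show ?thesis
  proof (rule ccontr)
    assume "\<not> ?thesis"
    then have "x > 0" using True by simp
    with assms(3)[of "2 * L / x"] assms(1) True show False by simp
  qed
next
  case False
  with assms have c: "c > 0" by simp
  define l where "l = sqrt (L / c)"
  have l: "l > 0" "l\<^sup>2 = L / c" using c assms by (auto simp: l_def)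
  have "l * x \<le> 2 * L" using assms(3)[OF l(1)] l c by simp
  then have "x \<le> 2 * (L / l)" using l by (simp add: field_simps)
  also have "L / l = L / sqrt L * sqrt c"
    by (simp add: l_def real_sqrt_divide)
  also have "\<dots> = sqrt (L * c)"
    using assms(1) by (simp add: real_div_sqrt real_sqrt_mult)
  finally show ?thesis .
qed

section \<open>Exponential inequalities for weighted martingale sums\<close>

context innovation_space
begin

text \<open>The summand of the sum of the optional and the predictable quadratic variation of a martingale
  with differences \<open>H\<close>.\<close>

definition quad :: "((nat \<Rightarrow> 'b) \<Rightarrow> real) \<Rightarrow> (nat \<Rightarrow> 'b) \<Rightarrow> real" where
  "quad H y = (H y)\<^sup>2 + avg (\<lambda>y. (H y)\<^sup>2) (shift (Suc 0) y)"

lemma quad_nonneg: "bmeas H \<Longrightarrow> 0 \<le> quad H y"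
  unfolding quad_def avg_def by (intro add_nonneg_nonneg integral_nonneg_AE) auto

lemma bmeas_quad [intro]: "bmeas H \<Longrightarrow> bmeas (quad H)"
  unfolding quad_def by (intro bmeas_intros)

lemma integral_quad: "bmeas H \<Longrightarrow> (\<integral>y. quad H y \<partial>S) = 2 * (l2norm S H)\<^sup>2"
  unfolding quad_def
  by (subst Bochner_Integration.integral_add)
     (simp_all add: integral_shift integral_avg bmeas_power l2norm_square bmeas_avg bmeas_shift integrable_bmeas)

text \<open>Induction on the past: conditionally on it the last factor has mean at most \<open>(1 +
  a\<^sup>2 v / 2) exp (- a\<^sup>2 v / 2) \<le> 1\<close>, where \<open>v\<close> is the
  conditional variance. The optional part of \<open>quad\<close> gives the quadratic upper bound
  for the exponential, the predictable part compensates its mean.\<close>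

lemma exponential_supermartingale:
  assumes H: "bmeas H" "avg H = (\<lambda>_. 0)"
  shows "(\<integral>y. exp (\<Sum>i<n. a i * H (shift i y) - (a i)\<^sup>2 / 2 * quad H (shift i y)) \<partial>S) \<le> 1"
proof (induction n arbitrary: a)
  case (Suc n)
  define G where "G y = exp (\<Sum>i<n. a (Suc i) * H (shift i y) - (a (Suc i))\<^sup>2 / 2 * quad H (shift i y))" for y
  define B where "B y = exp (a 0 * H y - (a 0 * H y)\<^sup>2 / 2)" for y
  define C where "C y = exp (- ((a 0)\<^sup>2 / 2 * avg (\<lambda>y. (H y)\<^sup>2) y))" for y
  have bm: "bmeas G" "bmeas B" "bmeas C"
    unfolding G_def B_def C_def by (intro bmeas_intros bmeas_quad H)+
  have "exp (\<Sum>i<Suc n. a i * H (shift i y) - (a i)\<^sup>2 / 2 * quad H (shift i y)) 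
      = B y * (\<lambda>z. C z * G z) (shift (Suc 0) y)" for y
    unfolding sum.lessThan_Suc_shift B_def C_def G_def exp_add[symmetric]
    by (simp add: quad_def power_mult_distrib field_simps)
  then have "(\<integral>y. exp (\<Sum>i<Suc n. a i * H (shift i y) - (a i)\<^sup>2 / 2 * quad H (shift i y)) \<partial>S)
      = (\<integral>y. B y * (\<lambda>z. C z * G z) (shift (Suc 0) y) \<partial>S)" by presburger
  also have "\<dots> = (\<integral>y. avg (\<lambda>y. B y * (\<lambda>z. C z * G z) (shift (Suc 0) y)) y \<partial>S)"
    by (intro integral_avg[symmetric] bmeas_intros bm)
  also have "\<dots> = (\<integral>y. avg B y * C y * G y \<partial>S)"
    by (subst avg_mult_shift) (simp add: mult.assoc)
  also have "\<dots> \<le> (\<integral>y. G y \<partial>S)"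
  proof (intro integral_mono integrable_bmeas)
    fix y
    have "avg B y \<le> avg (\<lambda>y. 1 + (a 0 * H y + (a 0)\<^sup>2 / 2 * (H y)\<^sup>2)) y"
    proof (intro avg_mono bm bmeas_intros H)
      show "B y \<le> 1 + (a 0 * H y + (a 0)\<^sup>2 / 2 * (H y)\<^sup>2)" for y
        using exp_minus_half_square_le[of "a 0 * H y"] by (simp add: B_def power_mult_distrib)
    qed
    also have "\<dots> = 1 + (a 0)\<^sup>2 / 2 * avg (\<lambda>y. (H y)\<^sup>2) y"
      using H(1) fun_cong[OF H(2), of y]
      by (simp add: avg_add avg_cmult bmeas_intros del: times_divide_eq_left)
    also have "\<dots> \<le> exp ((a 0)\<^sup>2 / 2 * avg (\<lambda>y. (H y)\<^sup>2) y)"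
      by (rule exp_ge_add_one_self)
    finally have "avg B y * C y \<le> exp ((a 0)\<^sup>2 / 2 * avg (\<lambda>y. (H y)\<^sup>2) y) * C y"
      by (intro mult_right_mono) (auto simp: C_def)
    also have "\<dots> = 1" by (simp add: C_def flip: exp_add)
    finally show "avg B y * C y * G y \<le> G y"
      by (simp add: G_def)
  qed (use bm in \<open>auto intro!: bmeas_mult bmeas_avg\<close>)
  also have "\<dots> \<le> 1" unfolding G_def by (rule Suc.IH)
  finally show ?case .
qed simp

text \<open>Martingale differences are orthogonal.\<close>

lemma l2norm_martingale_sum:
  assumes H: "bmeas H" "avg H = (\<lambda>_. 0)"
  shows "(\<integral>y. (\<Sum>i<n. a i * H (shift i y))\<^sup>2 \<partial>S) = (\<Sum>i<n. (a i)\<^sup>2) * (l2norm S H)\<^sup>2"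
proof (induction n arbitrary: a)
  case (Suc n)
  define G where "G y = (\<Sum>i<n. a (Suc i) * H (shift i y))" for y
  have bG: "bmeas G" unfolding G_def by (intro bmeas_intros H)
  have "(\<Sum>i<Suc n. a i * H (shift i y))\<^sup>2 
     = (a 0)\<^sup>2 * (H y)\<^sup>2 + (2 * a 0 * (H y * G (shift (Suc 0) y)) + (G (shift (Suc 0) y))\<^sup>2)" for y
    unfolding sum.lessThan_Suc_shift G_def by (simp add: power2_eq_square algebra_simps)
  then have "(\<integral>y. (\<Sum>i<Suc n. a i * H (shift i y))\<^sup>2 \<partial>S) 
    = (\<integral>y. (a 0)\<^sup>2 * (H y)\<^sup>2 + (2 * a 0 * (H y * G (shift (Suc 0) y)) + (G (shift (Suc 0) y))\<^sup>2) \<partial>S)"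
    by presburger
  also have "\<dots> = (a 0)\<^sup>2 * (\<integral>y. (H y)\<^sup>2 \<partial>S) + (2 * a 0 * (\<integral>y. H y * G (shift (Suc 0) y) \<partial>S) 
      + (\<integral>y. (G (shift (Suc 0) y))\<^sup>2 \<partial>S))"
    using H(1) bG
    by (simp add: integrable_bmeas bmeas_power bmeas_cmult bmeas_shift bmeas_mult bmeas_add)
  also have "(\<integral>y. H y * G (shift (Suc 0) y) \<partial>S) = 0"
    using integral_avg[of "\<lambda>y. H y * G (shift (Suc 0) y)"] H bG
    by (simp add: avg_mult_shift bmeas_mult bmeas_shift)
  also have "(\<integral>y. (G (shift (Suc 0) y))\<^sup>2 \<partial>S) = (\<integral>y. (G y)\<^sup>2 \<partial>S)"
    using bG by (intro integral_shift) auto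
  finally show ?case
    using Suc.IH[of "\<lambda>i. a (Suc i)"] unfolding sum.lessThan_Suc_shift G_def
    by (simp add: l2norm_square algebra_simps)
qed simp

definition maxform :: "'k set \<Rightarrow> nat \<Rightarrow> ('k \<Rightarrow> nat \<Rightarrow> real) \<Rightarrow> ((nat \<Rightarrow> 'b) \<Rightarrow> real) \<Rightarrow> (nat \<Rightarrow> 'b) \<Rightarrow> real" where
  "maxform A n w f y = (MAX k\<in>A. \<bar>\<Sum>i<n. w k i * f (shift i y)\<bar>)"

lemma maxform_le_iff:
  assumes "finite A" "A \<noteq> {}"
  shows "maxform A n w f y \<le> c \<longleftrightarrow> (\<forall>k\<in>A. \<bar>\<Sum>i<n. w k i * f (shift i y)\<bar> \<le> c)"
  using assms by (simp add: maxform_def)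

lemma maxform_ge:
  assumes "finite A" "k \<in> A"
  shows "\<bar>\<Sum>i<n. w k i * f (shift i y)\<bar> \<le> maxform A n w f y"
  using assms by (simp add: maxform_def)

lemma maxform_nonneg:
  assumes "finite A" "A \<noteq> {}"
  shows "0 \<le> maxform A n w f y"
  using assms maxform_ge by (meson abs_ge_zero all_not_in_conv order_trans)

lemma maxform_triangle:
  assumes A: "finite A" "A \<noteq> {}" and f: "\<And>y. f y = g y + h y"
  shows "maxform A n w f y \<le> maxform A n w g y + maxform A n w h y"
  unfolding maxform_le_iff[OF A]
proof
  fix k assume k: "k \<in> A"
  have "(\<Sum>i<n. w k i * f (shift i y)) = (\<Sum>i<n. w k i * g (shift i y)) + (\<Sum>i<n. w k i * h (shift i y))"
    by (simp add: f algebra_simps sum.distrib)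
  then show "\<bar>\<Sum>i<n. w k i * f (shift i y)\<bar> \<le> maxform A n w g y + maxform A n w h y"
    using maxform_ge[OF A(1) k, where n=n and w=w and y=y and f=g] maxform_ge[OF A(1) k, where n=n and w=w and y=y and f=h] by linarith
qed

lemma borel_measurable_maxform [measurable]:
  assumes "finite A" and [measurable]: "f \<in> borel_measurable S"
  shows "maxform A n w f \<in> borel_measurable S"
  unfolding maxform_def[abs_def]
  by (rule borel_measurable_Max[OF assms(1)]) simp

lemma bmeas_maxform: 
  assumes A: "finite A" "A \<noteq> {}" and f: "bmeas f"
  shows "bmeas (maxform A n w f)"
proof -
  obtain B where B: "B > 0" "\<And>y. \<bar>f y\<bar> \<le> B" using f bmeas_bound by blast
  have "maxform A n w f y \<le> (\<Sum>k\<in>A. \<Sum>i<n. \<bar>w k i\<bar> * B)" for y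
    unfolding maxform_le_iff[OF A]
  proof
    fix k assume k: "k \<in> A"
    have "\<bar>\<Sum>i<n. w k i * f (shift i y)\<bar> \<le> (\<Sum>i<n. \<bar>w k i\<bar> * B)"
      by (rule order_trans[OF sum_abs]) (auto simp: abs_mult intro!: sum_mono mult_left_mono B)
    also have "\<dots> \<le> (\<Sum>k\<in>A. \<Sum>i<n. \<bar>w k i\<bar> * B)"
      using k A B by (intro member_le_sum) (auto intro!: sum_nonneg)
    finally show "\<bar>\<Sum>i<n. w k i * f (shift i y)\<bar> \<le> \<dots>" .
  qed
  with maxform_nonneg[OF A] have "\<bar>maxform A n w f y\<bar> \<le> (\<Sum>k\<in>A. \<Sum>i<n. \<bar>w k i\<bar> * B)" for y
    by (simp add: abs_of_nonneg)
  then show ?thesis using A(1) f by (intro bmeasI borel_measurable_maxform) auto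
qed

text \<open>The exponential of a maximum of absolute values is at most the sum of the exponentials over all
  indices and both signs. One common compensator works for all of them because the weights have a
  common envelope \<open>\<omega>\<close>.\<close>

lemma exponential_maxform:
  assumes A: "finite A" "A \<noteq> {}" and H: "bmeas H" "avg H = (\<lambda>_. 0)"
    and w: "\<And>k i. k \<in> A \<Longrightarrow> i < n \<Longrightarrow> \<bar>w k i\<bar> \<le> \<omega> i" and l: "l > 0"
  shows "(\<integral>y. exp (l * maxform A n w H y - l\<^sup>2 / 2 * (\<Sum>i<n. (\<omega> i)\<^sup>2 * quad H (shift i y))) \<partial>S) \<le> 2 * real (card A)"
proof -
  define M where "M k y = (\<Sum>i<n. w k i * H (shift i y))" for k y
  define V where "V y = (\<Sum>i<n. (\<omega> i)\<^sup>2 * quad H (shift i y))" for y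
  have bm: "bmeas (M k)" "bmeas V" for k unfolding M_def V_def by (intro bmeas_intros bmeas_quad H)+
  have *: "(\<integral>y. exp (c * M k y - l\<^sup>2 / 2 * V y) \<partial>S) \<le> 1" if "k \<in> A" "\<bar>c\<bar> = l" for k c
  proof -
    have "c * M k y - l\<^sup>2 / 2 * V y 
      \<le> (\<Sum>i<n. (c * w k i) * H (shift i y) - (c * w k i)\<^sup>2 / 2 * quad H (shift i y))" for y
    proof -
      have "c\<^sup>2 = l\<^sup>2" using that(2) by auto
      have "(\<Sum>i<n. (c * w k i)\<^sup>2 / 2 * quad H (shift i y)) \<le> (\<Sum>i<n. l\<^sup>2 / 2 * ((\<omega> i)\<^sup>2 * quad H (shift i y)))"
      proof (intro sum_mono)
        fix i assume "i \<in> {..<n}"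
        then have "(w k i)\<^sup>2 \<le> (\<omega> i)\<^sup>2" using w[OF that(1), of i] by (metis abs_ge_zero lessThan_iff power2_abs power_mono)
        then show "(c * w k i)\<^sup>2 / 2 * quad H (shift i y) \<le> l\<^sup>2 / 2 * ((\<omega> i)\<^sup>2 * quad H (shift i y))"
          using quad_nonneg[OF H(1), of "shift i y"] unfolding power_mult_distrib \<open>c\<^sup>2 = l\<^sup>2\<close>
          by (simp add: mult_left_mono mult_right_mono mult.assoc)
      qed
      then show ?thesis by (simp add: M_def V_def sum_subtractf sum_distrib_left mult.assoc)
    qed
    note le = this
    have "(\<integral>y. exp (c * M k y - l\<^sup>2 / 2 * V y) \<partial>S) 
       \<le> (\<integral>y. exp (\<Sum>i<n. (c * w k i) * H (shift i y) - (c * w k i)\<^sup>2 / 2 * quad H (shift i y)) \<partial>S)"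
    proof (rule integral_mono_bmeas)
      show "bmeas (\<lambda>y. exp (c * M k y - l\<^sup>2 / 2 * V y))"
        by (intro bmeas_intros bm)
      show "bmeas (\<lambda>y. exp (\<Sum>i<n. (c * w k i) * H (shift i y) - (c * w k i)\<^sup>2 / 2 * quad H (shift i y)))"
        by (intro bmeas_intros bmeas_quad H)
    qed (use le in simp)
    also have "\<dots> \<le> 1" by (rule exponential_supermartingale[OF H])
    finally show ?thesis .
  qed
  have "exp (l * maxform A n w H y - l\<^sup>2 / 2 * V y) 
    \<le> (\<Sum>k\<in>A. exp (l * M k y - l\<^sup>2 / 2 * V y) + exp (- l * M k y - l\<^sup>2 / 2 * V y))" for y
  proof -
    obtain k where k: "k \<in> A" "maxform A n w H y = \<bar>M k y\<bar>"
    proof -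
      have "(MAX k\<in>A. \<bar>M k y\<bar>) \<in> (\<lambda>k. \<bar>M k y\<bar>) ` A" using A by (intro Max_in) auto
      then obtain k where "k \<in> A" "(MAX k\<in>A. \<bar>M k y\<bar>) = \<bar>M k y\<bar>" by blast
      then show ?thesis by (intro that[of k]) (simp_all add: maxform_def M_def)
    qed
    have "exp (l * maxform A n w H y - l\<^sup>2 / 2 * V y) 
        \<le> exp (l * M k y - l\<^sup>2 / 2 * V y) + exp (- l * M k y - l\<^sup>2 / 2 * V y)"
      unfolding k(2) by (cases "M k y \<ge> 0") (simp_all add: abs_if)
    also have "\<dots> \<le> (\<Sum>k\<in>A. exp (l * M k y - l\<^sup>2 / 2 * V y) + exp (- l * M k y - l\<^sup>2 / 2 * V y))"
      using k A by (intro member_le_sum[where f="\<lambda>k. exp (l * M k y - l\<^sup>2 / 2 * V y) + exp (- l * M k y - l\<^sup>2 / 2 * V y)"]) auto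
    finally show ?thesis .
  qed
  note le = this
  have "(\<integral>y. exp (l * maxform A n w H y - l\<^sup>2 / 2 * V y) \<partial>S) 
    \<le> (\<integral>y. (\<Sum>k\<in>A. exp (l * M k y - l\<^sup>2 / 2 * V y) + exp (- l * M k y - l\<^sup>2 / 2 * V y)) \<partial>S)"
  proof (rule integral_mono_bmeas)
    show "bmeas (\<lambda>y. exp (l * maxform A n w H y - l\<^sup>2 / 2 * V y))"
      by (intro bmeas_intros bmeas_maxform A H bm)
    show "bmeas (\<lambda>y. \<Sum>k\<in>A. exp (l * M k y - l\<^sup>2 / 2 * V y) + exp (- l * M k y - l\<^sup>2 / 2 * V y))"
      by (intro bmeas_intros bm)
  qed (rule le)
  also have "\<dots> = (\<Sum>k\<in>A. (\<integral>y. exp (l * M k y - l\<^sup>2 / 2 * V y) \<partial>S) + (\<integral>y. exp (- l * M k y - l\<^sup>2 / 2 * V y) \<partial>S))"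
    by (subst Bochner_Integration.integral_sum)
      (intro integrable_bmeas bmeas_intros bm sum.cong refl Bochner_Integration.integral_add)+
  also have "\<dots> \<le> (\<Sum>k\<in>A. 1 + 1)"
    using l by (intro sum_mono add_mono *) auto
  finally show ?thesis by (simp add: V_def)
qed

text \<open>The expectation of an exponential bounds, by Jensen, the exponential of the expectation; the
  compensator has an explicit mean, and optimising over \<open>l\<close> gives the factor
  \<open>sqrt (ln (2 card A))\<close>.\<close>

lemma expectation_maxform_martingale:
  assumes A: "finite A" "A \<noteq> {}" and H: "bmeas H" "avg H = (\<lambda>_. 0)"
    and w: "\<And>k i. k \<in> A \<Longrightarrow> i < n \<Longrightarrow> \<bar>w k i\<bar> \<le> \<omega> i"
  shows "(\<integral>y. maxform A n w H y \<partial>S) \<le> 2 * sqrt (ln (2 * real (card A)) * (\<Sum>i<n. (\<omega> i)\<^sup>2)) * l2norm S H"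
proof -
  define V where "V y = (\<Sum>i<n. (\<omega> i)\<^sup>2 * quad H (shift i y))" for y
  define N where "N = 2 * real (card A)"
  have N: "N > 1" using A card_gt_0_iff[of A] by (simp add: N_def)
  have bm: "bmeas (maxform A n w H)" "bmeas V" 
    unfolding V_def by (intro bmeas_intros bmeas_maxform bmeas_quad A H)+
  have bq: "bmeas (\<lambda>y. quad H (shift i y))" for i by (intro bmeas_intros bmeas_quad H)
  have EV: "(\<integral>y. V y \<partial>S) = 2 * ((\<Sum>i<n. (\<omega> i)\<^sup>2) * (l2norm S H)\<^sup>2)"
  proof -
    have "(\<integral>y. quad H (shift i y) \<partial>S) = 2 * (l2norm S H)\<^sup>2" for i
      using integral_shift[of "quad H" i] H(1) by (simp add: integral_quad bmeas_quad)
    moreover have "(\<integral>y. V y \<partial>S) = (\<Sum>i<n. (\<omega> i)\<^sup>2 * (\<integral>y. quad H (shift i y) \<partial>S))"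
      unfolding V_def using integrable_bmeas[OF bq] by simp
    ultimately show ?thesis
      by (simp only: mult.left_commute[of _ 2] sum_distrib_left[symmetric] sum_distrib_right[symmetric])
  qed
  have "(\<integral>y. maxform A n w H y \<partial>S) \<le> 2 * sqrt (ln N * ((\<Sum>i<n. (\<omega> i)\<^sup>2) * (l2norm S H)\<^sup>2))"
  proof (rule le_two_sqrt_of_quadratic)
    fix l :: real assume l: "l > 0"
    define U where "U y = l * maxform A n w H y - l\<^sup>2 / 2 * V y" for y
    have bU: "bmeas U" unfolding U_def by (intro bmeas_intros bm)
    have "U y \<le> ln N - 1 + 1 / N * exp (U y)" for y
    proof -
      have "1 + (U y - ln N) \<le> exp (U y - ln N)" by (rule exp_ge_add_one_self)
      also have "\<dots> = 1 / N * exp (U y)" using N by (simp add: exp_diff)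
      finally show ?thesis by linarith
    qed
    then have "(\<integral>y. U y \<partial>S) \<le> (\<integral>y. ln N - 1 + 1 / N * exp (U y) \<partial>S)"
      by (intro integral_mono integrable_bmeas bmeas_intros bU)
    also have "\<dots> = ln N - 1 + 1 / N * (\<integral>y. exp (U y) \<partial>S)"
      using integrable_bmeas[OF bmeas_exp[OF bU]] by simp
    also have "\<dots> \<le> ln N - 1 + 1 / N * N"
    proof (intro add_left_mono mult_left_mono)
      show "(\<integral>y. exp (U y) \<partial>S) \<le> N"
        unfolding U_def V_def N_def by (rule exponential_maxform[OF A H w l])
      show "0 \<le> 1 / N" using N by simp
    qed
    also have "\<dots> = ln N" using N by simp
    finally have "(\<integral>y. U y \<partial>S) \<le> ln N" .
    moreover have "(\<integral>y. U y \<partial>S) = l * (\<integral>y. maxform A n w H y \<partial>S) - l\<^sup>2 / 2 * (\<integral>y. V y \<partial>S)"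
      unfolding U_def using integrable_bmeas[OF bm(1)] integrable_bmeas[OF bm(2)] by simp
    ultimately show "l * (\<integral>y. maxform A n w H y \<partial>S) \<le> ln N + l\<^sup>2 * ((\<Sum>i<n. (\<omega> i)\<^sup>2) * (l2norm S H)\<^sup>2)"
      unfolding EV by argo
  next
    show "0 < ln N" using N by (rule ln_gt_zero)
    show "0 \<le> (\<Sum>i<n. (\<omega> i)\<^sup>2) * (l2norm S H)\<^sup>2"
      by (intro mult_nonneg_nonneg sum_nonneg zero_le_power2)
  qed
  also have "\<dots> = 2 * sqrt (ln N * (\<Sum>i<n. (\<omega> i)\<^sup>2)) * l2norm S H"
    unfolding mult.assoc[symmetric] by (subst real_sqrt_mult) simp
  finally show ?thesis unfolding N_def .
qed

end

section \<open>Martingale decomposition and dependence coefficients\<close>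

lemma finite_range_funop:
  "finite_range K f \<Longrightarrow> finite_range K g \<Longrightarrow> finite_range K (\<lambda>y. F (f y) (g y))"
  unfolding finite_range_def by (intro allI impI) metis

context innovation_space
begin

text \<open>The projection of \<open>q\<close> onto the innovation \<open>j\<close> steps back, written in
  the coordinates of that time: the difference of two successive conditional expectations.\<close>

definition mpart :: "((nat \<Rightarrow> 'b) \<Rightarrow> real) \<Rightarrow> nat \<Rightarrow> (nat \<Rightarrow> 'b) \<Rightarrow> real" where
  "mpart q j y = (avg ^^ j) q y - (avg ^^ Suc j) q (shift (Suc 0) y)"

lemma bmeas_mpart: "bmeas q \<Longrightarrow> bmeas (mpart q j)"
  unfolding mpart_def by (intro bmeas_intros bmeas_funpow_avg)

lemma avg_mpart: 
  assumes "bmeas q" shows "avg (mpart q j) = (\<lambda>_. 0)"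
proof -
  have "avg (mpart q j) = (\<lambda>y. avg ((avg ^^ j) q) y - avg (\<lambda>y. (avg ^^ Suc j) q (shift (Suc 0) y)) y)"
    unfolding mpart_def
    by (rule avg_diff[OF bmeas_funpow_avg[OF assms] bmeas_shift[OF bmeas_funpow_avg[OF assms]]])
  then show ?thesis using avg_shift[of "(avg ^^ Suc j) q"] by simp
qed

lemma finite_range_funpow_avg: 
  fixes q :: "(nat \<Rightarrow> 'b) \<Rightarrow> real"
  shows "finite_range K q \<Longrightarrow> finite_range K ((avg ^^ j) q)"
proof (induction j)
  case (Suc j)
  have "finite_range K (avg ((avg ^^ j) q))"
    by (rule finite_range_avg, rule finite_range_mono[OF Suc.IH[OF Suc.prems]]) simp
  then show ?case by simp
qed simp

lemma finite_range_mpart: 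
  fixes q :: "(nat \<Rightarrow> 'b) \<Rightarrow> real"
  assumes "finite_range K q" shows "finite_range (Suc K) (mpart q j)"
  unfolding mpart_def
  using finite_range_shift[OF finite_range_funpow_avg[OF assms], of "Suc 0" "Suc j"]
    finite_range_mono[OF finite_range_funpow_avg[OF assms], of "Suc K" j]
  by (intro finite_range_funop[where F = "(-)"]) simp_all

text \<open>The projections telescope, and the last conditional expectation is the mean.\<close>

lemma martingale_decomposition:
  assumes "bmeas q" "finite_range K q" "(\<integral>y. q y \<partial>S) = 0"
  shows "q y = (\<Sum>j<K. mpart q j (shift j y))"
proof -
  have "(\<Sum>j<K. mpart q j (shift j y)) = (\<Sum>j<K. (avg ^^ j) q (shift j y) - (avg ^^ Suc j) q (shift (Suc j) y))"
    by (simp add: mpart_def)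
  also have "\<dots> = (avg ^^ 0) q (shift 0 y) - (avg ^^ K) q (shift K y)"
    by (rule sum_lessThan_telescope')
  finally show ?thesis using funpow_avg_const[OF assms(1,2)] assms(3) by simp
qed

lemma measurable_upd [measurable]: "(\<lambda>p. (fst p)(j := snd p)) \<in> S \<Otimes>\<^sub>M \<mu> \<rightarrow>\<^sub>M S"
  by (rule measurable_PiM_single') (auto simp: space_PiM space_pair_measure space_mu fun_upd_def)

lemma measurable_upd_left [measurable]: "(\<lambda>y. y(j := x)) \<in> S \<rightarrow>\<^sub>M S"
  by (rule measurable_PiM_single') (auto simp: space_PiM space_mu fun_upd_def)

lemma measurable_upd_right [measurable]: "(\<lambda>x. y(j := x)) \<in> \<mu> \<rightarrow>\<^sub>M S"
  by (rule measurable_PiM_single') (auto simp: space_PiM space_mu fun_upd_def)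

text \<open>Averaging over a single coordinate instead of an initial segment; it links the coupling in
  \<open>dep\<close> with the projections.\<close>

definition resample :: "nat \<Rightarrow> ((nat \<Rightarrow> 'b) \<Rightarrow> real) \<Rightarrow> (nat \<Rightarrow> 'b) \<Rightarrow> real" where
  "resample j q y = (\<integral>x. q (y(j := x)) \<partial>\<mu>)"

lemma bmeas_resample: 
  assumes q: "bmeas q" shows "bmeas (resample j q)"
proof -
  obtain B where B: "\<And>y. \<bar>q y\<bar> \<le> B" using q bmeas_bound by blast
  have [measurable]: "q \<in> borel_measurable S" using q by simp
  have m: "resample j q \<in> borel_measurable S" 
    unfolding resample_def
    by (rule M.borel_measurable_lebesgue_integral) (use measurable_compose[OF measurable_upd, of q borel j] in \<open>simp add: split_def del: fun_upd_apply\<close>)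
  have i: "integrable \<mu> (\<lambda>x. q (y(j := x)))" for y
    using B measurable_compose[OF measurable_upd_right bmeasD[OF q]]
    by (intro M.integrable_const_bound[of _ B]) auto
  have "\<bar>resample j q y\<bar> \<le> B" for y
    unfolding resample_def
    using B by (intro order_trans[OF integral_abs_bound] M.integral_le_const integrable_abs i) auto
  with m show ?thesis by (rule bmeasI)
qed

lemma avg_resample:
  assumes q: "bmeas q" shows "avg (resample (Suc j) q) = resample j (avg q)"
proof
  fix y :: "nat \<Rightarrow> 'b"
  interpret Q: pair_prob_space \<mu> \<mu> ..
  obtain B where B: "\<And>y. \<bar>q y\<bar> \<le> B" using q bmeas_bound by blast
  have [measurable]: "q \<in> borel_measurable S" using q by simp
  have eq: "(case_nat z y)(Suc j := x) = case_nat z (y(j := x))" for x z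
    by (auto simp: fun_eq_iff split: nat.split)
  have m: "(\<lambda>(z, x). case_nat z (y(j := x))) \<in> \<mu> \<Otimes>\<^sub>M \<mu> \<rightarrow>\<^sub>M S"
    by (rule measurable_PiM_single') (auto simp: space_PiM space_pair_measure space_mu fun_upd_def split_def split: nat.split)
  have "avg (resample (Suc j) q) y = (\<integral>z. (\<integral>x. q (case_nat z (y(j := x))) \<partial>\<mu>) \<partial>\<mu>)"
    by (simp add: avg_def resample_def eq)
  also have "\<dots> = (\<integral>x. (\<integral>z. q (case_nat z (y(j := x))) \<partial>\<mu>) \<partial>\<mu>)"
    by (rule Q.Fubini_integral[symmetric])
      (use B measurable_compose[OF m, of q borel] in \<open>auto simp: split_def intro!: Q.P.integrable_const_bound[of _ B]\<close>)
  also have "\<dots> = resample j (avg q) y"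
    by (simp add: avg_def resample_def)
  finally show "avg (resample (Suc j) q) y = resample j (avg q) y" .
qed

text \<open>Integrating out coordinate \<open>j\<close> first and then the \<open>j\<close> later ones
  amounts to integrating out the first \<open>j + 1\<close> coordinates.\<close>

lemma funpow_avg_resample:
  "bmeas q \<Longrightarrow> (avg ^^ j) (resample j q) = (\<lambda>y. (avg ^^ Suc j) q (shift (Suc 0) y))"
proof (induction j arbitrary: q)
  case 0
  have "y(0 := x) = case_nat x (shift (Suc 0) y)" for y and x :: 'b
    by (auto simp: fun_eq_iff shift_def split: nat.split)
  then have "resample 0 q y = avg q (shift (Suc 0) y)" for y
    by (simp add: resample_def avg_def)
  then show ?case by (simp add: fun_eq_iff)
next
  case (Suc j)
  have "(avg ^^ Suc j) (resample (Suc j) q) = (avg ^^ j) (resample j (avg q))"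
    using avg_resample[OF Suc.prems] by (simp only: funpow_Suc_right o_apply)
  also have "\<dots> = (\<lambda>y. (avg ^^ Suc j) (avg q) (shift (Suc 0) y))"
    by (rule Suc.IH[OF bmeas_avg[OF Suc.prems]])
  finally show ?case by (simp only: funpow_Suc_right o_apply)
qed

lemma integral_resample: "bmeas q \<Longrightarrow> (\<integral>y. resample j q y \<partial>S) = (\<integral>y. q y \<partial>S)"
  using integral_funpow_avg[OF bmeas_resample, of q j j] integral_funpow_avg[of q "Suc j"]
    integral_shift[of "(avg ^^ Suc j) q" "Suc 0"] bmeas_funpow_avg[of q "Suc j"]
  by (simp add: funpow_avg_resample del: funpow.simps)

lemma integral_upd_bmeas:
  assumes q: "bmeas q" shows "(\<integral>p. q ((fst p)(j := snd p)) \<partial>(S \<Otimes>\<^sub>M \<mu>)) = (\<integral>y. q y \<partial>S)"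
proof -
  interpret Q: pair_prob_space S \<mu> ..
  obtain B where B: "\<And>y. \<bar>q y\<bar> \<le> B" using q bmeas_bound by blast
  have "(\<integral>p. q ((fst p)(j := snd p)) \<partial>(S \<Otimes>\<^sub>M \<mu>)) = (\<integral>y. resample j q y \<partial>S)"
    unfolding resample_def
    using Q.integral_fst'[of "\<lambda>p. q ((fst p)(j := snd p))"] B
      measurable_compose[OF measurable_upd, of q borel j] q
    by (simp add: Q.P.integrable_const_bound[of _ B])
  then show ?thesis by (simp add: integral_resample q)
qed

text \<open>Replacing one coordinate by an independent copy preserves the product measure.\<close>

lemma distr_upd: "distr (S \<Otimes>\<^sub>M \<mu>) S (\<lambda>p. (fst p)(j := snd p)) = S"
proof (rule measure_eqI)
  interpret Q: pair_prob_space S \<mu> ..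
  let ?f = "\<lambda>p. (fst p)(j := snd p)"
  fix A assume "A \<in> sets (distr (S \<Otimes>\<^sub>M \<mu>) S ?f)"
  then have A: "A \<in> sets S" by simp
  have "Q.P.prob (?f -` A \<inter> space (S \<Otimes>\<^sub>M \<mu>)) = (\<integral>p. indicator (?f -` A \<inter> space (S \<Otimes>\<^sub>M \<mu>)) p \<partial>(S \<Otimes>\<^sub>M \<mu>))"
    using measurable_sets[OF measurable_upd A] by simp
  also have "\<dots> = (\<integral>p. indicator A (?f p) \<partial>(S \<Otimes>\<^sub>M \<mu>))"
    by (intro Bochner_Integration.integral_cong) (auto simp: indicator_def)
  also have "\<dots> = (\<integral>y. indicator A y \<partial>S)"
    using A by (intro integral_upd_bmeas bmeasI[of _ 1]) (auto simp: indicator_def)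
  also have "\<dots> = measure S A"
    using A by simp
  finally show "emeasure (distr (S \<Otimes>\<^sub>M \<mu>) S ?f) A = emeasure S A"
    using A by (simp add: emeasure_distr Q.P.emeasure_eq_measure P.emeasure_eq_measure)
qed simp

text \<open>The physical dependence measure of order two: innovation \<open>j\<close> steps back is replaced
  by an independent copy.\<close>

definition dep :: "((nat \<Rightarrow> 'b) \<Rightarrow> real) \<Rightarrow> nat \<Rightarrow> real" where
  "dep q j = l2norm (S \<Otimes>\<^sub>M \<mu>) (\<lambda>p. q (fst p) - q ((fst p)(j := snd p)))"

lemma dep_nonneg [simp]: "0 \<le> dep q j"
  by (simp add: dep_def)

lemma measurable_resampled:
  "q \<in> borel_measurable S \<Longrightarrow> (\<lambda>p. q ((fst p)(j := snd p))) \<in> borel_measurable (S \<Otimes>\<^sub>M \<mu>)"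
  by (rule measurable_compose[OF measurable_upd])

lemma measurable_dep:
  fixes q :: "(nat \<Rightarrow> 'b) \<Rightarrow> real"
  shows "q \<in> borel_measurable S \<Longrightarrow> (\<lambda>p. q (fst p) - q ((fst p)(j := snd p))) \<in> borel_measurable (S \<Otimes>\<^sub>M \<mu>)"
  using measurable_resampled[of q j] measurable_compose[OF measurable_fst[of S \<mu>], of q borel]
  by (simp add: borel_measurable_diff)

lemma integrable_resampled_square:
  fixes q :: "(nat \<Rightarrow> 'b) \<Rightarrow> real"
  assumes [measurable]: "q \<in> borel_measurable S" and i: "integrable S (\<lambda>y. (q y)\<^sup>2)"
  shows "integrable (S \<Otimes>\<^sub>M \<mu>) (\<lambda>p. (q (fst p))\<^sup>2)"
    "integrable (S \<Otimes>\<^sub>M \<mu>) (\<lambda>p. (q ((fst p)(j := snd p)))\<^sup>2)"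
    "(\<integral>p. (q (fst p))\<^sup>2 \<partial>(S \<Otimes>\<^sub>M \<mu>)) = (\<integral>y. (q y)\<^sup>2 \<partial>S)"
    "(\<integral>p. (q ((fst p)(j := snd p)))\<^sup>2 \<partial>(S \<Otimes>\<^sub>M \<mu>)) = (\<integral>y. (q y)\<^sup>2 \<partial>S)"
proof -
  have 1: "distr (S \<Otimes>\<^sub>M \<mu>) S fst = S" by (rule M.distr_pair_fst)
  show "integrable (S \<Otimes>\<^sub>M \<mu>) (\<lambda>p. (q (fst p))\<^sup>2)"
    using i integrable_distr[of fst "S \<Otimes>\<^sub>M \<mu>" S "\<lambda>y. (q y)\<^sup>2"] by (simp add: 1)
  show "(\<integral>p. (q (fst p))\<^sup>2 \<partial>(S \<Otimes>\<^sub>M \<mu>)) = (\<integral>y. (q y)\<^sup>2 \<partial>S)"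
    using integral_distr[of fst "S \<Otimes>\<^sub>M \<mu>" S "\<lambda>y. (q y)\<^sup>2"] by (simp add: 1)
  show "integrable (S \<Otimes>\<^sub>M \<mu>) (\<lambda>p. (q ((fst p)(j := snd p)))\<^sup>2)"
    using i integrable_distr[OF measurable_upd[of j], of "\<lambda>y. (q y)\<^sup>2"] by (simp add: distr_upd del: fun_upd_apply)
  show "(\<integral>p. (q ((fst p)(j := snd p)))\<^sup>2 \<partial>(S \<Otimes>\<^sub>M \<mu>)) = (\<integral>y. (q y)\<^sup>2 \<partial>S)"
    using integral_distr[OF measurable_upd[of j], of "\<lambda>y. (q y)\<^sup>2"] by (simp add: distr_upd del: fun_upd_apply)
qed

lemma integrable_dep:
  fixes q :: "(nat \<Rightarrow> 'b) \<Rightarrow> real"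
  assumes m: "q \<in> borel_measurable S" and i: "integrable S (\<lambda>y. (q y)\<^sup>2)"
  shows "integrable (S \<Otimes>\<^sub>M \<mu>) (\<lambda>p. (q (fst p) - q ((fst p)(j := snd p)))\<^sup>2)"
  by (rule integrable_square_diff[OF measurable_compose[OF measurable_fst m] measurable_resampled[OF m]
        integrable_resampled_square(1,2)[OF m i]])

lemma dep_le_l2norm:
  fixes q :: "(nat \<Rightarrow> 'b) \<Rightarrow> real"
  assumes m: "q \<in> borel_measurable S" and i: "integrable S (\<lambda>y. (q y)\<^sup>2)"
  shows "dep q j \<le> 2 * l2norm S q"
proof -
  have "dep q j \<le> l2norm (S \<Otimes>\<^sub>M \<mu>) (\<lambda>p. q (fst p)) + l2norm (S \<Otimes>\<^sub>M \<mu>) (\<lambda>p. q ((fst p)(j := snd p)))"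
    unfolding dep_def
    by (rule l2norm_triangle_diff[OF measurable_compose[OF measurable_fst m] measurable_resampled[OF m]
        integrable_resampled_square(1,2)[OF m i]])
  also have "\<dots> = 2 * l2norm S q"
    unfolding l2norm_def integrable_resampled_square(3,4)[OF m i] by simp
  finally show ?thesis .
qed

lemma dep_diff_le:
  fixes q r :: "(nat \<Rightarrow> 'b) \<Rightarrow> real"
  assumes m: "q \<in> borel_measurable S" "r \<in> borel_measurable S" 
    and i: "integrable S (\<lambda>y. (q y)\<^sup>2)" "integrable S (\<lambda>y. (r y)\<^sup>2)"
  shows "dep (\<lambda>y. q y - r y) j \<le> dep q j + dep r j"
proof -
  have "dep (\<lambda>y. q y - r y) j 
    = l2norm (S \<Otimes>\<^sub>M \<mu>) (\<lambda>p. (q (fst p) - q ((fst p)(j := snd p))) - (r (fst p) - r ((fst p)(j := snd p))))"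
    unfolding dep_def by (rule arg_cong[of _ _ "l2norm _"]) (auto simp: fun_eq_iff)
  also have "\<dots> \<le> dep q j + dep r j"
    unfolding dep_def
    by (rule l2norm_triangle_diff[OF measurable_dep[OF m(1)] measurable_dep[OF m(2)] integrable_dep[OF m(1) i(1)] integrable_dep[OF m(2) i(2)]])
  finally show ?thesis .
qed

lemma dep_square:
  assumes q: "bmeas q"
  shows "(dep q j)\<^sup>2 = (\<integral>x. (\<integral>y. (q y - q (y(j := x)))\<^sup>2 \<partial>S) \<partial>\<mu>)"
    and "(dep q j)\<^sup>2 = (\<integral>y. (\<integral>x. (q y - q (y(j := x)))\<^sup>2 \<partial>\<mu>) \<partial>S)"
    and "integrable \<mu> (\<lambda>x. \<integral>y. (q y - q (y(j := x)))\<^sup>2 \<partial>S)"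
    and "integrable S (\<lambda>y. \<integral>x. (q y - q (y(j := x)))\<^sup>2 \<partial>\<mu>)"
proof -
  interpret Q: pair_prob_space S \<mu> ..
  have i: "integrable (S \<Otimes>\<^sub>M \<mu>) (\<lambda>p. (q (fst p) - q ((fst p)(j := snd p)))\<^sup>2)"
    by (rule integrable_dep[OF bmeasD[OF q] integrable_bmeas[OF bmeas_power[OF q]]])
  then have i': "integrable (S \<Otimes>\<^sub>M \<mu>) (\<lambda>(y, x). (q y - q (y(j := x)))\<^sup>2)"
    by (simp add: split_def del: fun_upd_apply)
  have e: "(dep q j)\<^sup>2 = (\<integral>p. (q (fst p) - q ((fst p)(j := snd p)))\<^sup>2 \<partial>(S \<Otimes>\<^sub>M \<mu>))"
    unfolding dep_def l2norm_square ..
  show "(dep q j)\<^sup>2 = (\<integral>x. (\<integral>y. (q y - q (y(j := x)))\<^sup>2 \<partial>S) \<partial>\<mu>)"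
    using Q.integral_snd[OF i'] e by (simp add: split_def del: fun_upd_apply)
  show "(dep q j)\<^sup>2 = (\<integral>y. (\<integral>x. (q y - q (y(j := x)))\<^sup>2 \<partial>\<mu>) \<partial>S)"
    using Q.integral_fst'[OF i] e by (simp del: fun_upd_apply)
  show "integrable \<mu> (\<lambda>x. \<integral>y. (q y - q (y(j := x)))\<^sup>2 \<partial>S)"
    by (rule Q.integrable_snd[OF i'])
  show "integrable S (\<lambda>y. \<integral>x. (q y - q (y(j := x)))\<^sup>2 \<partial>\<mu>)"
    using Q.integrable_fst'[OF i] by (simp del: fun_upd_apply)
qed

lemma l2norm_funpow_avg_le:
  assumes q: "bmeas q" shows "l2norm S ((avg ^^ j) q) \<le> l2norm S q"
proof (induction j)
  case (Suc j)
  have b: "bmeas ((avg ^^ j) q)" using q by blast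
  have "(\<integral>y. (avg ((avg ^^ j) q) y)\<^sup>2 \<partial>S) \<le> (\<integral>y. avg (\<lambda>y. ((avg ^^ j) q y)\<^sup>2) y \<partial>S)"
    by (intro integral_mono_bmeas bmeas_intros b avg_square_le)
  also have "\<dots> = (\<integral>y. ((avg ^^ j) q y)\<^sup>2 \<partial>S)"
    by (intro integral_avg bmeas_intros b)
  finally have "l2norm S ((avg ^^ Suc j) q) \<le> l2norm S ((avg ^^ j) q)"
    by (simp add: l2norm_def)
  with Suc show ?case by simp
qed simp

text \<open>The projection is the conditional expectation of \<open>q - resample j q\<close>, and the latter
  averages the coupled difference; both averages are contractions in \<open>L\<^sup>2\<close>.\<close>

lemma l2norm_mpart_le:
  assumes q: "bmeas q" shows "l2norm S (mpart q j) \<le> dep q j"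
proof -
  obtain B where B: "B > 0" "\<And>y. \<bar>q y\<bar> \<le> B" using q bmeas_bound by blast
  define k where "k y = q y - resample j q y" for y
  have bk: "bmeas k" unfolding k_def by (intro bmeas_intros bmeas_resample q)
  have "(avg ^^ i) (\<lambda>y. f y - r y) = (\<lambda>y. (avg ^^ i) f y - (avg ^^ i) r y)" if "bmeas f" "bmeas r" for f r i
    using that by (induction i) (auto simp: avg_diff bmeas_funpow_avg)
  then have "(avg ^^ j) k = mpart q j"
    using q bmeas_resample[OF q] unfolding k_def by (simp add: funpow_avg_resample mpart_def fun_eq_iff)
  then have "l2norm S (mpart q j) \<le> l2norm S k"
    using l2norm_funpow_avg_le[OF bk, of j] by simp
  also have "l2norm S k \<le> dep q j"
  proof -
    have kk: "(k y)\<^sup>2 \<le> (\<integral>x. (q y - q (y(j := x)))\<^sup>2 \<partial>\<mu>)" for y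
    proof -
      have m: "(\<lambda>x. q y - q (y(j := x))) \<in> borel_measurable \<mu>"
        using measurable_compose[OF measurable_upd_right, of q borel] q by simp
      have bd: "\<bar>q y - q (y(j := x))\<bar> \<le> 2 * B" for x using B(2)[of y] B(2)[of "y(j := x)"] by linarith
      have i: "integrable \<mu> (\<lambda>x. (q y - q (y(j := x)))\<^sup>2)" 
        using m bd power_mono[OF bd abs_ge_zero, of _ 2]
        by (intro M.integrable_const_bound[of _ "(2 * B)\<^sup>2"]) auto
      have i2: "integrable \<mu> (\<lambda>x. q y - q (y(j := x)))" by (rule M.expectation_abs_le_l2norm[OF m i])
      have i3: "integrable \<mu> (\<lambda>x. q (y(j := x)))"
        using B measurable_compose[OF measurable_upd_right bmeasD[OF q]]
        by (intro M.integrable_const_bound[of _ B]) auto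
      have "k y = (\<integral>x. q y - q (y(j := x)) \<partial>\<mu>)"
        using i3 by (simp add: k_def resample_def M.prob_space)
      then have "\<bar>k y\<bar> \<le> (\<integral>x. \<bar>q y - q (y(j := x))\<bar> \<partial>\<mu>)" by (simp add: integral_abs_bound)
      also have "\<dots> \<le> l2norm \<mu> (\<lambda>x. q y - q (y(j := x)))" by (rule M.expectation_abs_le_l2norm[OF m i])
      finally have "(k y)\<^sup>2 \<le> (l2norm \<mu> (\<lambda>x. q y - q (y(j := x))))\<^sup>2"
        by (metis abs_ge_zero power2_abs power_mono)
      then show ?thesis by (simp add: l2norm_square)
    qed
    have "(\<integral>y. (k y)\<^sup>2 \<partial>S) \<le> (dep q j)\<^sup>2"
      unfolding dep_square(2)[OF q]
      by (intro integral_mono integrable_bmeas bmeas_power bk dep_square(4)[OF q] kk)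
    then show ?thesis unfolding l2norm_def by (intro real_le_lsqrt) auto
  qed
  finally show ?thesis .
qed

lemma maxform_shift: "maxform A n w (\<lambda>y. f (shift j y)) y = maxform A n w f (shift j y)"
  by (simp add: maxform_def add.commute)

lemma maxform_sum:
  assumes A: "finite A" "A \<noteq> {}"
  shows "maxform A n w (\<lambda>y. \<Sum>j\<in>J. f j y) y \<le> (\<Sum>j\<in>J. maxform A n w (f j) y)"
proof (induction J rule: infinite_finite_induct)
  case (insert j J)
  then show ?case
    using maxform_triangle[OF A, of "\<lambda>y. \<Sum>j\<in>insert j J. f j y" "f j" "\<lambda>y. \<Sum>j\<in>J. f j y" n w y] by simp
qed (use A in \<open>simp_all add: maxform_le_iff\<close>)

text \<open>Each term of the martingale decomposition obeys the martingale bound with its own projection; by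
  stationarity the time shift of the term does not matter.\<close>

lemma expectation_maxform_bounded:
  assumes A: "finite A" "A \<noteq> {}" and q: "bmeas q" "finite_range K q" "(\<integral>y. q y \<partial>S) = 0"
    and w: "\<And>k i. k \<in> A \<Longrightarrow> i < n \<Longrightarrow> \<bar>w k i\<bar> \<le> \<omega> i"
  shows "(\<integral>y. maxform A n w q y \<partial>S) \<le> 2 * sqrt (ln (2 * real (card A)) * (\<Sum>i<n. (\<omega> i)\<^sup>2)) * (\<Sum>j<K. dep q j)"
proof -
  let ?c = "2 * sqrt (ln (2 * real (card A)) * (\<Sum>i<n. (\<omega> i)\<^sup>2))"
  have b: "bmeas (\<lambda>y. mpart q j (shift j y))" for j by (intro bmeas_intros bmeas_mpart q)
  have "q = (\<lambda>y. \<Sum>j<K. mpart q j (shift j y))"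
    using martingale_decomposition[OF q] by blast
  then have "maxform A n w q y \<le> (\<Sum>j<K. maxform A n w (\<lambda>y. mpart q j (shift j y)) y)" for y
    using maxform_sum[OF A, of n w "\<lambda>j y. mpart q j (shift j y)" "{..<K}" y] by metis
  then have "(\<integral>y. maxform A n w q y \<partial>S) \<le> (\<integral>y. (\<Sum>j<K. maxform A n w (\<lambda>y. mpart q j (shift j y)) y) \<partial>S)"
    by (intro integral_mono_bmeas bmeas_sum bmeas_maxform A q b)
  also have "\<dots> = (\<Sum>j<K. \<integral>y. maxform A n w (mpart q j) (shift j y) \<partial>S)"
    using integrable_bmeas[OF bmeas_shift[OF bmeas_maxform[OF A bmeas_mpart[OF q(1)]]]]
      maxform_shift[of A n w "mpart q j" j for j] by simp
  also have "\<dots> = (\<Sum>j<K. \<integral>y. maxform A n w (mpart q j) y \<partial>S)"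
    by (intro sum.cong refl integral_shift bmeasD bmeas_maxform A bmeas_mpart q)
  also have "\<dots> \<le> (\<Sum>j<K. ?c * dep q j)"
  proof (intro sum_mono)
    fix j
    have "?c \<ge> 0" using A card_gt_0_iff[of A] by (intro mult_nonneg_nonneg real_sqrt_ge_zero sum_nonneg) auto
    have "(\<integral>y. maxform A n w (mpart q j) y \<partial>S) \<le> ?c * l2norm S (mpart q j)"
      by (rule expectation_maxform_martingale[OF A bmeas_mpart[OF q(1)] avg_mpart[OF q(1)] w])
    also have "\<dots> \<le> ?c * dep q j" by (intro mult_left_mono l2norm_mpart_le q \<open>?c \<ge> 0\<close>)
    finally show "(\<integral>y. maxform A n w (mpart q j) y \<partial>S) \<le> ?c * dep q j" .
  qed
  finally show ?thesis by (simp add: sum_distrib_left)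
qed

lemma l2norm_sum_bounded:
  assumes q: "bmeas q" "finite_range K q" "(\<integral>y. q y \<partial>S) = 0"
  shows "l2norm S (\<lambda>y. \<Sum>i<n. a i * q (shift i y)) \<le> sqrt (\<Sum>i<n. (a i)\<^sup>2) * (\<Sum>j<K. dep q j)"
proof -
  define G where "G j y = (\<Sum>i<n. a i * mpart q j (shift i y))" for j y
  have b: "bmeas (G j)" for j unfolding G_def by (intro bmeas_intros bmeas_mpart q)
  have "(\<Sum>i<n. a i * q (shift i y)) = (\<Sum>j<K. G j (shift j y))" for y
  proof -
    have "(\<Sum>i<n. a i * q (shift i y)) = (\<Sum>i<n. a i * (\<Sum>j<K. mpart q j (shift j (shift i y))))"
      by (intro sum.cong refl arg_cong2[where f = "(*)"] martingale_decomposition q)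
    also have "\<dots> = (\<Sum>j<K. G j (shift j y))"
      unfolding G_def sum_distrib_left by (subst sum.swap) (simp add: add.commute)
    finally show ?thesis .
  qed
  then have "l2norm S (\<lambda>y. \<Sum>i<n. a i * q (shift i y)) = l2norm S (\<lambda>y. \<Sum>j<K. G j (shift j y))"
    by simp
  also have "\<dots> \<le> (\<Sum>j<K. l2norm S (\<lambda>y. G j (shift j y)))"
    by (intro l2norm_sum[THEN conjunct2] bmeasD integrable_bmeas bmeas_intros b)
  also have "\<dots> \<le> (\<Sum>j<K. sqrt (\<Sum>i<n. (a i)\<^sup>2) * dep q j)"
  proof (intro sum_mono)
    fix j
    have "l2norm S (\<lambda>y. G j (shift j y)) = l2norm S (G j)"
      unfolding l2norm_def using integral_shift[of "\<lambda>y. (G j y)\<^sup>2" j] bmeas_power[OF b] by simp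
    also have "\<dots> = sqrt (\<Sum>i<n. (a i)\<^sup>2) * l2norm S (mpart q j)"
      unfolding l2norm_def[of S "G j"] G_def
      by (simp add: l2norm_martingale_sum[OF bmeas_mpart[OF q(1)] avg_mpart[OF q(1)]] real_sqrt_mult)
    also have "\<dots> \<le> sqrt (\<Sum>i<n. (a i)\<^sup>2) * dep q j"
      by (intro mult_left_mono l2norm_mpart_le q real_sqrt_ge_zero sum_nonneg) auto
    finally show "l2norm S (\<lambda>y. G j (shift j y)) \<le> sqrt (\<Sum>i<n. (a i)\<^sup>2) * dep q j" .
  qed
  finally show ?thesis by (simp add: sum_distrib_left)
qed

end

section \<open>Approximation by bounded functions of finitely many innovations\<close>

lemma (in prob_space) square_expectation_le:
  fixes f :: "'a \<Rightarrow> real"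
  assumes m: "f \<in> borel_measurable M" and i: "integrable M (\<lambda>x. (f x)\<^sup>2)"
  shows "(expectation f)\<^sup>2 \<le> expectation (\<lambda>x. (f x)\<^sup>2)"
proof -
  have "\<bar>expectation f\<bar> \<le> expectation (\<lambda>x. \<bar>f x\<bar>)" by (rule integral_abs_bound)
  also have "\<dots> \<le> l2norm M f" by (rule expectation_abs_le_l2norm[OF m i])
  finally have "\<bar>expectation f\<bar>\<^sup>2 \<le> (l2norm M f)\<^sup>2" by (rule power_mono) simp
  then show ?thesis by (simp add: l2norm_square)
qed

definition cutoff :: "real \<Rightarrow> real \<Rightarrow> real" where
  "cutoff c x = max (- c) (min c x)"

lemma cutoff_bound: "0 \<le> c \<Longrightarrow> \<bar>cutoff c x\<bar> \<le> c"
  by (auto simp: cutoff_def)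

lemma cutoff_lipschitz: "\<bar>cutoff c x - cutoff c y\<bar> \<le> \<bar>x - y\<bar>"
  by (auto simp: cutoff_def max_def min_def abs_if)

lemma cutoff_id: "\<bar>x\<bar> \<le> c \<Longrightarrow> cutoff c x = x"
  by (auto simp: cutoff_def)

lemma cutoff_dist: "0 \<le> c \<Longrightarrow> \<bar>x - cutoff c x\<bar> \<le> \<bar>x\<bar>"
  by (auto simp: cutoff_def max_def min_def abs_if)

lemma borel_measurable_cutoff [measurable]: "cutoff c \<in> borel_measurable borel"
  unfolding cutoff_def by measurable

context innovation_space
begin

text \<open>The conditional expectation given the first \<open>n\<close> innovations.\<close>

definition cexp :: "nat \<Rightarrow> ((nat \<Rightarrow> 'b) \<Rightarrow> real) \<Rightarrow> (nat \<Rightarrow> 'b) \<Rightarrow> real" where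
  "cexp n f y = (\<integral>z. f (comb_seq n y z) \<partial>S)"

lemma measurable_comb_seq_right [measurable]: "(\<lambda>z. comb_seq n y z) \<in> S \<rightarrow>\<^sub>M S"
  by (rule measurable_PiM_single') (auto simp: space_PiM space_mu comb_seq_def)

lemma bmeas_comb_seq_right: "bmeas f \<Longrightarrow> bmeas (\<lambda>z. f (comb_seq n y z))"
  unfolding bmeas_def using measurable_compose[OF measurable_comb_seq_right, of f borel] by blast

lemma bmeas_cexp:
  assumes f: "bmeas f" shows "bmeas (cexp n f)"
proof -
  obtain B where B: "\<And>y. \<bar>f y\<bar> \<le> B" using f bmeas_bound by blast
  have "cexp n f \<in> borel_measurable S"
    unfolding cexp_def
    by (rule P.borel_measurable_lebesgue_integral)
       (use measurable_compose[OF measurable_comb_seq bmeasD[OF f]] in \<open>simp add: split_def\<close>)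
  moreover have "\<bar>cexp n f y\<bar> \<le> B" for y
    unfolding cexp_def
    using B integrable_bmeas[OF bmeas_comb_seq_right[OF f]]
    by (intro order_trans[OF integral_abs_bound] P.integral_le_const integrable_abs) auto
  ultimately show ?thesis by (rule bmeasI)
qed

lemma finite_range_cexp: 
  fixes f :: "(nat \<Rightarrow> 'b) \<Rightarrow> real" shows "finite_range n (cexp n f)"
proof -
  have "cexp n f y = cexp n f y'" if "\<forall>i<n. y i = y' i" for y y' :: "nat \<Rightarrow> 'b"
  proof -
    have "comb_seq n y = comb_seq n y'"
      using that by (auto simp: comb_seq_def fun_eq_iff)
    then show ?thesis by (simp add: cexp_def)
  qed
  then show ?thesis by (simp add: finite_range_def)
qed

lemma cexp_finite_range:
  fixes f :: "(nat \<Rightarrow> 'b) \<Rightarrow> real" assumes "finite_range n f" shows "cexp n f = f"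
proof
  fix y
  have "f (comb_seq n y z) = f y" for z
    using assms by (auto simp: finite_range_def comb_seq_def)
  then show "cexp n f y = f y" by (simp add: cexp_def)
qed

lemma integral_cexp:
  assumes f: "bmeas f" shows "(\<integral>y. cexp n f y \<partial>S) = (\<integral>y. f y \<partial>S)"
proof -
  interpret Q: pair_prob_space S S ..
  obtain B where B: "\<And>y. \<bar>f y\<bar> \<le> B" using f bmeas_bound by blast
  have m: "(\<lambda>p. f (comb_seq n (fst p) (snd p))) \<in> borel_measurable (S \<Otimes>\<^sub>M S)"
    using measurable_compose[OF measurable_comb_seq bmeasD[OF f]] by (simp add: split_def)
  have "(\<integral>y. f y \<partial>S) = (\<integral>y. f y \<partial>distr (S \<Otimes>\<^sub>M S) S (\<lambda>(y, z). comb_seq n y z))"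
    by (simp only: PiM_comb_seq)
  also have "\<dots> = (\<integral>p. f (comb_seq n (fst p) (snd p)) \<partial>(S \<Otimes>\<^sub>M S))"
    using f by (subst integral_distr[OF measurable_comb_seq]) (auto simp: split_def)
  also have "\<dots> = (\<integral>y. cexp n f y \<partial>S)"
    unfolding cexp_def
    using Q.integral_fst'[of "\<lambda>p. f (comb_seq n (fst p) (snd p))"] B m
    by (simp add: Q.P.integrable_const_bound[of _ B])
  finally show ?thesis by simp
qed

lemma cexp_square_le: "bmeas f \<Longrightarrow> (cexp n f y)\<^sup>2 \<le> cexp n (\<lambda>y. (f y)\<^sup>2) y"
  unfolding cexp_def
  by (intro P.square_expectation_le bmeasD integrable_bmeas bmeas_power bmeas_comb_seq_right)

lemma cexp_diff: "bmeas f \<Longrightarrow> bmeas h \<Longrightarrow> cexp n (\<lambda>y. f y - h y) = (\<lambda>y. cexp n f y - cexp n h y)"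
  unfolding cexp_def
  by (intro ext Bochner_Integration.integral_diff integrable_bmeas bmeas_comb_seq_right)

lemma l2norm_cexp_le:
  assumes f: "bmeas f" shows "l2norm S (cexp n f) \<le> l2norm S f"
proof -
  have "(\<integral>y. (cexp n f y)\<^sup>2 \<partial>S) \<le> (\<integral>y. cexp n (\<lambda>y. (f y)\<^sup>2) y \<partial>S)"
    by (intro integral_mono_bmeas bmeas_power bmeas_cexp f cexp_square_le)
  also have "\<dots> = (\<integral>y. (f y)\<^sup>2 \<partial>S)" by (intro integral_cexp bmeas_power f)
  finally show ?thesis by (simp add: l2norm_def)
qed

lemma bmeas_upd: "bmeas f \<Longrightarrow> bmeas (\<lambda>y. f (y(j := x)))"
  unfolding bmeas_def using measurable_compose[OF measurable_upd_left, of f borel] by blast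

text \<open>Conditioning commutes with the replacement of a coordinate and is a contraction; for
  \<open>j\<close> outside the first \<open>n\<close> coordinates the left side vanishes.\<close>

lemma dep_cexp_le:
  assumes f: "bmeas f" shows "dep (cexp n f) j \<le> dep f j"
proof -
  have le: "(\<integral>y. (cexp n f y - cexp n f (y(j := x)))\<^sup>2 \<partial>S) \<le> (\<integral>y. (f y - f (y(j := x)))\<^sup>2 \<partial>S)" for x
  proof (cases "j < n")
    case True
    define F where "F y = f y - f (y(j := x))" for y
    have bF: "bmeas F" unfolding F_def by (intro bmeas_diff f bmeas_upd)
    have "comb_seq n (y(j := x)) z = (comb_seq n y z)(j := x)" for y z :: "nat \<Rightarrow> 'b"
      using True by (auto simp: comb_seq_def fun_eq_iff)
    then have "cexp n F y = cexp n f y - cexp n f (y(j := x))" for y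
      unfolding F_def
      by (subst cexp_diff[OF f bmeas_upd[OF f]]) (simp add: cexp_def)
    then have "(\<integral>y. (cexp n f y - cexp n f (y(j := x)))\<^sup>2 \<partial>S) = (\<integral>y. (cexp n F y)\<^sup>2 \<partial>S)" by simp
    also have "\<dots> \<le> (\<integral>y. cexp n (\<lambda>y. (F y)\<^sup>2) y \<partial>S)"
      by (intro integral_mono_bmeas bmeas_power bmeas_cexp bF cexp_square_le)
    also have "\<dots> = (\<integral>y. (F y)\<^sup>2 \<partial>S)" by (intro integral_cexp bmeas_power bF)
    finally show ?thesis by (simp add: F_def)
  next
    case False
    have "comb_seq n (y(j := x)) z = comb_seq n y z" for y z :: "nat \<Rightarrow> 'b"
      using False by (auto simp: comb_seq_def fun_eq_iff)
    then have "cexp n f (y(j := x)) = cexp n f y" for y by (simp add: cexp_def)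
    then show ?thesis by simp
  qed
  have "(dep (cexp n f) j)\<^sup>2 \<le> (dep f j)\<^sup>2"
    unfolding dep_square(1)[OF bmeas_cexp[OF f]] dep_square(1)[OF f]
    by (intro integral_mono dep_square(3)[OF bmeas_cexp[OF f]] dep_square(3)[OF f] le)
  then show ?thesis by (rule power2_le_imp_le) simp
qed

lemma dep_mono:
  fixes f h :: "(nat \<Rightarrow> 'b) \<Rightarrow> real"
  assumes f: "f \<in> borel_measurable S" and h: "h \<in> borel_measurable S" "integrable S (\<lambda>y. (h y)\<^sup>2)"
    and le: "\<And>y y'. \<bar>f y - f y'\<bar> \<le> \<bar>h y - h y'\<bar>"
  shows "dep f j \<le> dep h j"
  unfolding dep_def
  by (rule l2norm_mono(2)[OF integrable_dep[OF h] measurable_dep[OF f] le])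

text \<open>Cylinder events generate the product \<open>\<sigma>\<close>-algebra and are stable under
  intersection, and the approximable events are closed under complements and countable disjoint
  unions.\<close>

lemma indicator_approx:
  assumes "A \<in> sets S"
  shows "\<forall>e>0. \<exists>K h. bmeas h \<and> finite_range K h \<and> (\<integral>y. \<bar>indicator A y - h y\<bar> \<partial>S) < e"
proof -
  have "A \<in> sigma_sets (\<Pi>\<^sub>E i\<in>UNIV. space \<mu>) (prod_algebra UNIV (\<lambda>_::nat. \<mu>))"
    using assms by (simp add: sets_PiM)
  then show ?thesis
  proof (induction rule: sigma_sets_induct_disjoint[OF Int_stable_prod_algebra prod_algebra_sets_into_space, 
        consumes 1, case_names basic empty compl union])
    case (basic A)
    then obtain J E where A: "A = prod_emb UNIV (\<lambda>_. \<mu>) J (Pi\<^sub>E J E)" and J: "finite J" 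
      and E: "\<And>i. i \<in> J \<Longrightarrow> E i \<in> sets \<mu>"
      by (elim prod_algebraE) auto
    have A': "A = {y. \<forall>i\<in>J. y i \<in> E i}"
      unfolding A by (auto simp: prod_emb_def space_mu PiE_def Pi_def extensional_def restrict_def)
    have "A \<in> sets S" unfolding A using J E by (intro sets_PiM_I) auto
    then have "bmeas (indicator A)" by (intro bmeasI[of _ 1]) (auto simp: indicator_def)
    moreover have "finite_range (Suc (Max (insert 0 J))) (indicator A :: _ \<Rightarrow> real)"
      unfolding finite_range_def A'
    proof (intro allI impI)
      fix y z :: "nat \<Rightarrow> 'b" assume "\<forall>i<Suc (Max (insert 0 J)). y i = z i"
      then have "y i = z i" if "i \<in> J" for i using that J by (simp add: le_imp_less_Suc)
      then show "indicator {y. \<forall>i\<in>J. y i \<in> E i} y = (indicator {y. \<forall>i\<in>J. y i \<in> E i} z :: real)"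
        by (auto simp: indicator_def)
    qed
    ultimately show ?case by (intro allI impI exI conjI) auto
  next
    case empty
    have "finite_range 0 (\<lambda>_::nat \<Rightarrow> 'b. 0)" by (simp add: finite_range_def)
    then show ?case by (intro allI impI exI[of _ 0] exI[of _ "\<lambda>_. 0"]) auto
  next
    case (compl A)
    show ?case
    proof (intro allI impI)
      fix e :: real assume "e > 0"
      with compl obtain K h where h: "bmeas h" "finite_range K h" "(\<integral>y. \<bar>indicator A y - h y\<bar> \<partial>S) < e" by blast
      have "\<bar>indicator (Pi\<^sub>E UNIV (\<lambda>_. space \<mu>) - A) y - (1 - h y)\<bar> = \<bar>indicator A y - h y\<bar>" for y
        by (auto simp: indicator_def space_mu)
      moreover have "finite_range K (\<lambda>y. 1 - h y)" using h(2) by (simp add: finite_range_def)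
      ultimately show "\<exists>K h. bmeas h \<and> finite_range K h \<and> 
          (\<integral>y. \<bar>indicator (Pi\<^sub>E UNIV (\<lambda>_. space \<mu>) - A) y - h y\<bar> \<partial>S) < e"
        using h by (intro exI[of _ K] exI[of _ "\<lambda>y. 1 - h y"]) (auto intro!: bmeas_diff bmeas_const)
    qed
  next
    case (union A)
    show ?case
    proof (intro allI impI)
      fix e :: real assume e: "e > 0"
      have sA: "A i \<in> sets S" for i using union by (auto simp: sets_PiM)
      have "(\<lambda>n. \<Sum>i<n. measure S (A i)) \<longlonglongrightarrow> measure S (\<Union>i. A i)"
        using P.finite_measure_UNION[of A] union(1) sA by (auto simp: sums_def)
      then have "\<forall>\<^sub>F n in sequentially. dist (\<Sum>i<n. measure S (A i)) (measure S (\<Union>i. A i)) < e / 2"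
        using e by (intro tendstoD) auto
      then obtain N where N: "\<bar>(\<Sum>i<N. measure S (A i)) - measure S (\<Union>i. A i)\<bar> < e / 2"
        by (auto simp: eventually_sequentially dist_real_def)
      define \<eta> where "\<eta> = e / (2 * (real N + 1))"
      have \<eta>: "\<eta> > 0" "real N * \<eta> < e / 2" using e by (auto simp: \<eta>_def field_simps)
      have "\<forall>i. \<exists>K h. bmeas h \<and> finite_range K h \<and> (\<integral>y. \<bar>indicator (A i) y - h y\<bar> \<partial>S) < \<eta>"
        using union(3) \<eta>(1) by blast
      then obtain K h where h: "\<And>i. bmeas (h i)" "\<And>i. finite_range (K i) (h i)" 
        "\<And>i. (\<integral>y. \<bar>indicator (A i) y - h i y\<bar> \<partial>S) < \<eta>" by metis
      define U where "U = (\<Union>i. A i)"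
      have sU: "U \<in> sets S" unfolding U_def using sA by auto
      define h' where "h' y = (\<Sum>i<N. h i y)" for y
      have bh': "bmeas h'" unfolding h'_def by (intro bmeas_sum h)
      have fr: "finite_range (Max (insert 0 (K ` {..<N}))) h'"
        unfolding h'_def finite_range_def
      proof (intro allI impI sum.cong refl)
        fix y z :: "nat \<Rightarrow> 'b" and i assume yz: "\<forall>i<Max (insert 0 (K ` {..<N})). y i = z i" and i: "i \<in> {..<N}"
        have "K i \<le> Max (insert 0 (K ` {..<N}))" using i by (intro Max_ge) auto
        with yz h(2)[of i] show "h i y = h i z" unfolding finite_range_def by (meson order_less_le_trans)
      qed
      have bi: "bmeas (indicator B)" if "B \<in> sets S" for B
        using that by (intro bmeasI[of _ 1]) (auto simp: indicator_def)
      have sub: "(\<Sum>i<N. indicator (A i) y) \<le> (indicator U y :: real)" for y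
      proof -
        have "(\<Sum>i<N. indicator (A i) y) = (indicator (\<Union>i<N. A i) y :: real)"
          using union(1) by (subst indicator_UN_disjoint) (auto simp: disjoint_family_on_def)
        also have "\<dots> \<le> indicator U y" by (auto simp: U_def indicator_def)
        finally show ?thesis .
      qed
      have "\<bar>indicator U y - h' y\<bar> \<le> (indicator U y - (\<Sum>i<N. indicator (A i) y)) + (\<Sum>i<N. \<bar>indicator (A i) y - h i y\<bar>)" for y
      proof -
        have "indicator U y - h' y = (indicator U y - (\<Sum>i<N. indicator (A i) y)) + (\<Sum>i<N. indicator (A i) y - h i y)"
          by (simp add: h'_def sum_subtractf)
        then show ?thesis using sub[of y] sum_abs[of "\<lambda>i. indicator (A i) y - h i y" "{..<N}"] by linarith
      qed
      then have "(\<integral>y. \<bar>indicator U y - h' y\<bar> \<partial>S) 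
        \<le> (\<integral>y. (indicator U y - (\<Sum>i<N. indicator (A i) y)) + (\<Sum>i<N. \<bar>indicator (A i) y - h i y\<bar>) \<partial>S)"
        by (intro integral_mono_bmeas bmeas_abs bmeas_diff bmeas_add bmeas_sum bi sU sA bh' h)
      also have "\<dots> = (measure S U - (\<Sum>i<N. measure S (A i))) + (\<Sum>i<N. (\<integral>y. \<bar>indicator (A i) y - h i y\<bar> \<partial>S))"
        using integrable_bmeas[OF bi[OF sU]] integrable_bmeas[OF bi[OF sA]] 
          integrable_bmeas[OF bmeas_abs[OF bmeas_diff[OF bi[OF sA] h(1)]]] sU sA
        by simp
      also have "\<dots> < e / 2 + e / 2"
      proof (intro add_less_le_mono)
        show "measure S U - (\<Sum>i<N. measure S (A i)) < e / 2" using N unfolding U_def by linarith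
        have "(\<Sum>i<N. (\<integral>y. \<bar>indicator (A i) y - h i y\<bar> \<partial>S)) \<le> (\<Sum>i<N. \<eta>)"
          using h(3) by (intro sum_mono less_imp_le)
        then show "(\<Sum>i<N. (\<integral>y. \<bar>indicator (A i) y - h i y\<bar> \<partial>S)) \<le> e / 2" using \<eta> by simp
      qed
      also have "\<dots> = e" by simp
      finally have "(\<integral>y. \<bar>indicator (\<Union>i. A i) y - h' y\<bar> \<partial>S) < e" unfolding U_def .
      then show "\<exists>K h. bmeas h \<and> finite_range K h \<and> (\<integral>y. \<bar>indicator (\<Union>i. A i) y - h y\<bar> \<partial>S) < e"
        by (intro exI conjI) (rule bh' fr | assumption)+
    qed
  qed
qed

lemma integrable_approx:
  fixes f :: "(nat \<Rightarrow> 'b) \<Rightarrow> real"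
  assumes "integrable S f"
  shows "\<forall>e>0. \<exists>K h. bmeas h \<and> finite_range K h \<and> (\<integral>y. \<bar>f y - h y\<bar> \<partial>S) < e"
  using assms
proof (induction rule: integrable_induct)
  case (base A c)
  show ?case
  proof (intro allI impI)
    fix e :: real assume e: "e > 0"
    have "e / (\<bar>c\<bar> + 1) > 0" using e by (simp add: add_nonneg_pos)
    then obtain K h where h: "bmeas h" "finite_range K h" "(\<integral>y. \<bar>indicator A y - h y\<bar> \<partial>S) < e / (\<bar>c\<bar> + 1)"
      using indicator_approx[OF base(1)] by blast
    have "\<bar>indicator A y *\<^sub>R c - c * h y\<bar> = \<bar>c\<bar> * \<bar>indicator A y - h y\<bar>" for y
      by (simp add: abs_mult[symmetric] algebra_simps)
    then have "(\<integral>y. \<bar>indicator A y *\<^sub>R c - c * h y\<bar> \<partial>S) = \<bar>c\<bar> * (\<integral>y. \<bar>indicator A y - h y\<bar> \<partial>S)"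
      by simp
    also have "\<dots> \<le> (\<bar>c\<bar> + 1) * (\<integral>y. \<bar>indicator A y - h y\<bar> \<partial>S)" by (intro mult_right_mono) auto
    also have "\<dots> < (\<bar>c\<bar> + 1) * (e / (\<bar>c\<bar> + 1))" by (intro mult_strict_left_mono h) simp
    also have "\<dots> = e" by simp
    finally have "(\<integral>y. \<bar>indicator A y *\<^sub>R c - c * h y\<bar> \<partial>S) < e" .
    moreover have "finite_range K (\<lambda>y. c * h y)" using h(2) by (simp add: finite_range_def)
    ultimately show "\<exists>K h. bmeas h \<and> finite_range K h \<and> (\<integral>y. \<bar>indicator A y *\<^sub>R c - h y\<bar> \<partial>S) < e"
      using bmeas_cmult[OF h(1)] by blast
  qed
next
  case (add f g)
  show ?case
  proof (intro allI impI)
    fix e :: real assume e: "e > 0"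
    then obtain K h where h: "bmeas h" "finite_range K h" "(\<integral>y. \<bar>f y - h y\<bar> \<partial>S) < e / 2"
      using add(3) half_gt_zero by blast
    from e obtain L k where k: "bmeas k" "finite_range L k" "(\<integral>y. \<bar>g y - k y\<bar> \<partial>S) < e / 2"
      using add(4) half_gt_zero by blast
    have i: "integrable S (\<lambda>y. \<bar>f y - h y\<bar>)" "integrable S (\<lambda>y. \<bar>g y - k y\<bar>)"
      using add h k integrable_bmeas by (auto intro!: integrable_abs Bochner_Integration.integrable_diff)
    have "(\<integral>y. \<bar>f y + g y - (h y + k y)\<bar> \<partial>S) \<le> (\<integral>y. \<bar>f y - h y\<bar> + \<bar>g y - k y\<bar> \<partial>S)"
      using add h k integrable_bmeas i by (intro integral_mono integrable_abs) auto
    also have "\<dots> < e" using i h k by simp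
    finally have "(\<integral>y. \<bar>f y + g y - (h y + k y)\<bar> \<partial>S) < e" .
    moreover have "finite_range (max K L) (\<lambda>y. h y + k y)"
      using finite_range_mono[OF h(2), of "max K L"] finite_range_mono[OF k(2), of "max K L"]
      by (intro finite_range_funop[where F = "(+)"]) auto
    ultimately show "\<exists>K h. bmeas h \<and> finite_range K h \<and> (\<integral>y. \<bar>f y + g y - h y\<bar> \<partial>S) < e"
      using bmeas_add[OF h(1) k(1)] by blast
  qed
next
  case (lim f s)
  have bound: "norm (s i y) \<le> 2 * norm (f y)" for i y
    using lim by simp
  show ?case
  proof (intro allI impI)
    fix e :: real assume e: "e > 0"
    have "(\<lambda>i. \<integral>y. \<bar>f y - s i y\<bar> \<partial>S) \<longlonglongrightarrow> (\<integral>y. 0 \<partial>S)"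
    proof (rule integral_dominated_convergence[where w = "\<lambda>y. 3 * \<bar>f y\<bar>"])
      show "AE y in S. (\<lambda>i. \<bar>f y - s i y\<bar>) \<longlonglongrightarrow> 0"
      proof (intro AE_I2)
        fix y assume "y \<in> space S"
        then have "(\<lambda>i. s i y) \<longlonglongrightarrow> f y" using lim by blast
        then have "(\<lambda>i. \<bar>f y - s i y\<bar>) \<longlonglongrightarrow> \<bar>f y - f y\<bar>" by (intro tendsto_intros)
        then show "(\<lambda>i. \<bar>f y - s i y\<bar>) \<longlonglongrightarrow> 0" by simp
      qed
      show "AE y in S. norm \<bar>f y - s i y\<bar> \<le> 3 * \<bar>f y\<bar>" for i
      proof (intro AE_I2)
        fix y assume "y \<in> space S"
        then have "\<bar>s i y\<bar> \<le> 2 * \<bar>f y\<bar>" using bound[of i y] by simp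
        then show "norm \<bar>f y - s i y\<bar> \<le> 3 * \<bar>f y\<bar>" by simp
      qed
    qed (use lim in auto)
    then have "\<forall>\<^sub>F i in sequentially. dist (\<integral>y. \<bar>f y - s i y\<bar> \<partial>S) 0 < e / 2"
      using e by (intro tendstoD) auto
    then obtain i where i: "(\<integral>y. \<bar>f y - s i y\<bar> \<partial>S) < e / 2"
      by (auto simp: eventually_sequentially dist_real_def)
    obtain K h where h: "bmeas h" "finite_range K h" "(\<integral>y. \<bar>s i y - h y\<bar> \<partial>S) < e / 2"
      using lim.IH[of i] half_gt_zero[OF e] by blast
    have ii: "integrable S (\<lambda>y. \<bar>f y - s i y\<bar>)" "integrable S (\<lambda>y. \<bar>s i y - h y\<bar>)" "integrable S (\<lambda>y. \<bar>f y - h y\<bar>)"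
      using lim h integrable_bmeas by (auto intro!: integrable_abs Bochner_Integration.integrable_diff)
    have "(\<integral>y. \<bar>f y - h y\<bar> \<partial>S) \<le> (\<integral>y. \<bar>f y - s i y\<bar> + \<bar>s i y - h y\<bar> \<partial>S)"
      using ii by (intro integral_mono) auto
    also have "\<dots> < e" using ii h i by simp
    finally show "\<exists>K h. bmeas h \<and> finite_range K h \<and> (\<integral>y. \<bar>f y - h y\<bar> \<partial>S) < e" using h by blast
  qed
qed

lemma bmeas_cutoff:
  assumes "g \<in> borel_measurable S" "0 \<le> c" shows "bmeas (\<lambda>y. cutoff c (g y))"
  using measurable_compose[OF assms(1) borel_measurable_cutoff] cutoff_bound[OF assms(2)]
  unfolding bmeas_def by blast

text \<open>A function of finitely many innovations is reproduced by \<open>cexp\<close>, such functions are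
  dense in \<open>L\<^sup>1\<close>, and for bounded functions convergence in
  \<open>L\<^sup>1\<close> implies convergence in \<open>L\<^sup>2\<close>.\<close>

lemma cexp_converges_L2:
  assumes f: "bmeas f" and e: "e > 0"
  shows "\<exists>K. \<forall>n\<ge>K. l2norm S (\<lambda>y. f y - cexp n f y) \<le> e"
proof -
  obtain B where B: "B > 0" "\<And>y. \<bar>f y\<bar> \<le> B" using f bmeas_bound by blast
  have "e\<^sup>2 / (8 * B) > 0" using e B by simp
  then obtain K h where h: "bmeas h" "finite_range K h" "(\<integral>y. \<bar>f y - h y\<bar> \<partial>S) < e\<^sup>2 / (8 * B)"
    using integrable_approx[OF integrable_bmeas[OF f]] by blast
  define k where "k y = cutoff B (h y)" for y
  have bk: "bmeas k" unfolding k_def using B(1) h(1) by (simp add: bmeas_cutoff)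
  have fk: "finite_range n k" if "n \<ge> K" for n
    unfolding k_def using finite_range_mono[OF h(2) that]
    by (rule finite_range_funop[where F = "\<lambda>a _. cutoff B a"]) (rule finite_range_mono[OF h(2) that])
  define d where "d y = k y - f y" for y
  have bd: "bmeas d" unfolding d_def by (intro bmeas_diff bk f)
  have "(d y)\<^sup>2 \<le> 2 * B * \<bar>f y - h y\<bar>" for y
  proof -
    have 1: "\<bar>d y\<bar> \<le> \<bar>f y - h y\<bar>"
      using cutoff_lipschitz[of B "h y" "f y"] cutoff_id[OF B(2)[of y]] by (simp add: d_def k_def)
    have 2: "\<bar>d y\<bar> \<le> 2 * B"
      using cutoff_bound[of B "h y"] B(1) B(2)[of y] unfolding d_def k_def by linarith
    have "(d y)\<^sup>2 = \<bar>d y\<bar> * \<bar>d y\<bar>" by (simp add: power2_eq_square)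
    also have "\<dots> \<le> 2 * B * \<bar>f y - h y\<bar>" using 1 2 B by (intro mult_mono) auto
    finally show ?thesis .
  qed
  then have "(\<integral>y. (d y)\<^sup>2 \<partial>S) \<le> (\<integral>y. 2 * B * \<bar>f y - h y\<bar> \<partial>S)"
    by (intro integral_mono_bmeas bmeas_power bd bmeas_cmult bmeas_abs bmeas_diff f h)
  also have "\<dots> \<le> 2 * B * (e\<^sup>2 / (8 * B))" 
    using mult_left_mono[OF less_imp_le[OF h(3)], of "2 * B"] B(1)
    unfolding integral_mult_right_zero by simp
  also have "\<dots> = (e / 2)\<^sup>2" using B by (simp add: power2_eq_square field_simps)
  finally have "(\<integral>y. (d y)\<^sup>2 \<partial>S) \<le> (e / 2)\<^sup>2" .
  then have d: "l2norm S d \<le> e / 2" using e unfolding l2norm_def by (intro real_le_lsqrt) simp_all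
  have "l2norm S (\<lambda>y. f y - cexp n f y) \<le> e" if "n \<ge> K" for n
  proof -
    have "f y - cexp n f y = cexp n d y - d y" for y
      unfolding d_def by (simp add: cexp_diff[OF bk f] cexp_finite_range[OF fk[OF that]])
    then have "l2norm S (\<lambda>y. f y - cexp n f y) = l2norm S (\<lambda>y. cexp n d y - d y)" by simp
    also have "\<dots> \<le> l2norm S (cexp n d) + l2norm S d"
      by (intro l2norm_triangle_diff bmeasD integrable_bmeas bmeas_power bmeas_cexp bd)
    also have "\<dots> \<le> e" using l2norm_cexp_le[OF bd, of n] d by linarith
    finally show ?thesis .
  qed
  then show ?thesis by blast
qed

lemma cutoff_converges_L2:
  fixes g :: "(nat \<Rightarrow> 'b) \<Rightarrow> real"
  assumes [measurable]: "g \<in> borel_measurable S" and i: "integrable S (\<lambda>y. (g y)\<^sup>2)" and e: "e > 0"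
  shows "\<exists>c>0. l2norm S (\<lambda>y. g y - cutoff c (g y)) \<le> e"
proof -
  have "(\<lambda>n. \<integral>y. (g y - cutoff (real n) (g y))\<^sup>2 \<partial>S) \<longlonglongrightarrow> (\<integral>y. 0 \<partial>S)"
  proof (rule integral_dominated_convergence[where w = "\<lambda>y. (g y)\<^sup>2"])
    show "AE y in S. (\<lambda>n. (g y - cutoff (real n) (g y))\<^sup>2) \<longlonglongrightarrow> 0"
    proof (intro AE_I2 tendsto_eventually)
      fix y
      obtain N where "\<bar>g y\<bar> \<le> real N" using real_arch_simple by blast
      then have "cutoff (real n) (g y) = g y" if "n \<ge> N" for n using that by (intro cutoff_id) linarith
      then show "\<forall>\<^sub>F n in sequentially. (g y - cutoff (real n) (g y))\<^sup>2 = 0"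
        unfolding eventually_sequentially by (intro exI[of _ N]) simp
    qed
    show "AE y in S. norm ((g y - cutoff (real n) (g y))\<^sup>2) \<le> (g y)\<^sup>2" for n
      using cutoff_dist[of "real n"] by (intro AE_I2) (simp add: abs_le_square_iff)
  qed (use i in auto)
  then have "\<forall>\<^sub>F n in sequentially. dist (\<integral>y. (g y - cutoff (real n) (g y))\<^sup>2 \<partial>S) 0 < e\<^sup>2"
    using e by (intro tendstoD) auto
  then obtain N where N: "\<forall>n\<ge>N. (\<integral>y. (g y - cutoff (real n) (g y))\<^sup>2 \<partial>S) < e\<^sup>2"
    by (auto simp: eventually_sequentially dist_real_def)
  have "l2norm S (\<lambda>y. g y - cutoff (real (Suc N)) (g y)) \<le> e"
    unfolding l2norm_def using N[rule_format, of "Suc N"] e by (intro real_le_lsqrt) auto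
  then show ?thesis by (intro exI[of _ "real (Suc N)"]) auto
qed

text \<open>Cutting off the values, conditioning on finitely many innovations and centring are all
  compatible with the coupling, so that no dependence coefficient grows. This domination is
  essential: it makes the tails of the coefficient series uniformly small.\<close>

lemma exists_bounded_approximant:
  fixes g :: "(nat \<Rightarrow> 'b) \<Rightarrow> real"
  assumes m: "g \<in> borel_measurable S" and i: "integrable S (\<lambda>y. (g y)\<^sup>2)" and z: "(\<integral>y. g y \<partial>S) = 0" 
    and e: "e > 0"
  shows "\<exists>K q. bmeas q \<and> finite_range K q \<and> (\<integral>y. q y \<partial>S) = 0 \<and> (\<forall>j. dep q j \<le> dep g j)
     \<and> l2norm S (\<lambda>y. g y - q y) \<le> e"
proof -
  obtain c where c: "c > 0" "l2norm S (\<lambda>y. g y - cutoff c (g y)) \<le> e / 4"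
    using cutoff_converges_L2[OF m i, of "e / 4"] e by auto
  define f where "f y = cutoff c (g y)" for y
  have bf: "bmeas f" unfolding f_def
    using c m by (simp add: bmeas_cutoff)
  obtain K where K: "l2norm S (\<lambda>y. f y - cexp K f y) \<le> e / 4"
    using cexp_converges_L2[OF bf, of "e / 4"] e by auto
  define a where "a = (\<integral>y. f y \<partial>S)"
  define q where "q y = cexp K f y - a" for y
  have bq: "bmeas q" unfolding q_def by (intro bmeas_diff bmeas_const bmeas_cexp bf)
  have fq: "finite_range K q" unfolding q_def using finite_range_cexp[of K f] by (simp add: finite_range_def)
  have zq: "(\<integral>y. q y \<partial>S) = 0"
    unfolding q_def using integrable_bmeas[OF bmeas_cexp[OF bf]] by (simp add: integral_cexp[OF bf] a_def)
  have dq: "dep q j \<le> dep g j" for j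
  proof -
    have "dep q j = dep (cexp K f) j" unfolding dep_def q_def by simp
    also have "\<dots> \<le> dep f j" by (rule dep_cexp_le[OF bf])
    also have "\<dots> \<le> dep g j"
      by (rule dep_mono[OF bmeasD[OF bf] m i]) (simp add: f_def cutoff_lipschitz)
    finally show ?thesis .
  qed
  have i1: "integrable S (\<lambda>y. (g y - f y)\<^sup>2)"
    by (intro integrable_square_diff m i bmeasD bf integrable_bmeas bmeas_power)
  have m1: "(\<lambda>y. g y - f y) \<in> borel_measurable S" using m bf by auto
  have a: "\<bar>a\<bar> \<le> e / 4"
  proof -
    have "a = - (\<integral>y. g y - f y \<partial>S)"
      using P.expectation_abs_le_l2norm(1)[OF m i] integrable_bmeas[OF bf] z by (simp add: a_def)
    then have "\<bar>a\<bar> = \<bar>\<integral>y. g y - f y \<partial>S\<bar>" by simp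
    also have "\<dots> \<le> (\<integral>y. \<bar>g y - f y\<bar> \<partial>S)" by (rule integral_abs_bound)
    also have "\<dots> \<le> l2norm S (\<lambda>y. g y - f y)" by (rule P.expectation_abs_le_l2norm[OF m1 i1])
    finally show ?thesis using c(2) by (simp add: f_def)
  qed
  have "l2norm S (\<lambda>y. g y - q y) = l2norm S (\<lambda>y. (g y - f y) + ((f y - cexp K f y) + a))"
    unfolding q_def by (rule arg_cong[of _ _ "l2norm S"]) (simp add: fun_eq_iff)
  also have "\<dots> \<le> l2norm S (\<lambda>y. g y - f y) + l2norm S (\<lambda>y. (f y - cexp K f y) + a)"
    by (intro l2norm_triangle m1 i1 bmeasD integrable_bmeas bmeas_power bmeas_add bmeas_diff bf bmeas_cexp bmeas_const)
  finally have 1: "l2norm S (\<lambda>y. g y - q y) \<le> l2norm S (\<lambda>y. g y - f y) + l2norm S (\<lambda>y. (f y - cexp K f y) + a)" .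
  have 2: "l2norm S (\<lambda>y. (f y - cexp K f y) + a) \<le> l2norm S (\<lambda>y. f y - cexp K f y) + l2norm S (\<lambda>_. a)"
    by (intro l2norm_triangle bmeasD integrable_bmeas bmeas_power bmeas_diff bf bmeas_cexp bmeas_const)
  have 3: "l2norm S (\<lambda>_. a) = \<bar>a\<bar>" by (simp add: l2norm_def)
  have 4: "l2norm S (\<lambda>y. g y - f y) \<le> e / 4" using c(2) by (simp add: f_def)
  have "l2norm S (\<lambda>y. g y - q y) \<le> e" using 1 2 3 4 K a e by linarith
  with bq fq zq dq show ?thesis by blast
qed

section \<open>Maximal inequalities under summable dependence\<close>

lemma integrable_maxform:
  assumes A: "finite A" "A \<noteq> {}" and f: "integrable S f"
  shows "integrable S (maxform A n w f)"
    and "(\<integral>y. maxform A n w f y \<partial>S) \<le> (\<Sum>k\<in>A. \<Sum>i<n. \<bar>w k i\<bar>) * (\<integral>y. \<bar>f y\<bar> \<partial>S)"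
proof -
  have m [measurable]: "f \<in> borel_measurable S" using f by simp
  have i: "integrable S (\<lambda>y. \<bar>f (shift i y)\<bar>)" for i
    by (rule integrable_shift[OF integrable_abs[OF f]])
  have I: "integrable S (\<lambda>y. \<Sum>k\<in>A. \<Sum>i<n. \<bar>w k i\<bar> * \<bar>f (shift i y)\<bar>)"
    by (intro Bochner_Integration.integrable_sum integrable_mult_right i)
  have le: "maxform A n w f y \<le> (\<Sum>k\<in>A. \<Sum>i<n. \<bar>w k i\<bar> * \<bar>f (shift i y)\<bar>)" for y
    unfolding maxform_le_iff[OF A]
  proof
    fix k assume k: "k \<in> A"
    have "\<bar>\<Sum>i<n. w k i * f (shift i y)\<bar> \<le> (\<Sum>i<n. \<bar>w k i\<bar> * \<bar>f (shift i y)\<bar>)"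
      by (rule order_trans[OF sum_abs]) (simp add: abs_mult)
    also have "\<dots> \<le> (\<Sum>k\<in>A. \<Sum>i<n. \<bar>w k i\<bar> * \<bar>f (shift i y)\<bar>)"
      using k A by (intro member_le_sum[of k A "\<lambda>k. \<Sum>i<n. \<bar>w k i\<bar> * \<bar>f (shift i y)\<bar>"]) (auto intro!: sum_nonneg)
    finally show "\<bar>\<Sum>i<n. w k i * f (shift i y)\<bar> \<le> \<dots>" .
  qed
  show J: "integrable S (maxform A n w f)"
  proof (rule Bochner_Integration.integrable_bound[OF I borel_measurable_maxform[OF A(1) m]])
    have "norm (maxform A n w f y) \<le> norm (\<Sum>k\<in>A. \<Sum>i<n. \<bar>w k i\<bar> * \<bar>f (shift i y)\<bar>)" for y
      using le[of y] maxform_nonneg[OF A, of n w f y] by simp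
    then show "AE y in S. norm (maxform A n w f y) \<le> norm (\<Sum>k\<in>A. \<Sum>i<n. \<bar>w k i\<bar> * \<bar>f (shift i y)\<bar>)" by simp
  qed
  have "(\<integral>y. maxform A n w f y \<partial>S) \<le> (\<integral>y. (\<Sum>k\<in>A. \<Sum>i<n. \<bar>w k i\<bar> * \<bar>f (shift i y)\<bar>) \<partial>S)"
    by (intro integral_mono J I le)
  also have "\<dots> = (\<Sum>k\<in>A. \<Sum>i<n. \<bar>w k i\<bar> * (\<integral>y. \<bar>f (shift i y)\<bar> \<partial>S))"
    using i by (simp add: Bochner_Integration.integral_sum Bochner_Integration.integrable_sum)
  also have "\<dots> = (\<Sum>k\<in>A. \<Sum>i<n. \<bar>w k i\<bar> * (\<integral>y. \<bar>f y\<bar> \<partial>S))"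
    using integral_shift[of "\<lambda>y. \<bar>f y\<bar>"] by simp
  finally show "(\<integral>y. maxform A n w f y \<partial>S) \<le> (\<Sum>k\<in>A. \<Sum>i<n. \<bar>w k i\<bar>) * (\<integral>y. \<bar>f y\<bar> \<partial>S)"
    by (simp add: sum_distrib_right)
qed

lemma l2norm_shift:
  assumes [measurable]: "f \<in> borel_measurable S" shows "l2norm S (\<lambda>y. f (shift i y)) = l2norm S f"
  unfolding l2norm_def using integral_shift[of "\<lambda>y. (f y)\<^sup>2" i] by simp

lemma l2norm_sum_shift:
  fixes f :: "(nat \<Rightarrow> 'b) \<Rightarrow> real"
  assumes m [measurable]: "f \<in> borel_measurable S" and i: "integrable S (\<lambda>y. (f y)\<^sup>2)"
  shows "integrable S (\<lambda>y. (\<Sum>i<n. f (shift i y))\<^sup>2)" "l2norm S (\<lambda>y. \<Sum>i<n. f (shift i y)) \<le> real n * l2norm S f"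
proof -
  have "integrable S (\<lambda>y. (f (shift i y))\<^sup>2)" for i by (rule integrable_shift[OF i])
  then have "integrable S (\<lambda>y. (\<Sum>i<n. f (shift i y))\<^sup>2) \<and> 
     l2norm S (\<lambda>y. \<Sum>i<n. f (shift i y)) \<le> (\<Sum>i<n. l2norm S (\<lambda>y. f (shift i y)))"
    by (intro l2norm_sum) auto
  then show "integrable S (\<lambda>y. (\<Sum>i<n. f (shift i y))\<^sup>2)" "l2norm S (\<lambda>y. \<Sum>i<n. f (shift i y)) \<le> real n * l2norm S f"
    by (auto simp: l2norm_shift[OF m])
qed

text \<open>The first \<open>J\<close> coefficients of the difference are small because the difference is
  small in \<open>L\<^sup>2\<close>, the others because they are dominated by the tail for
  \<open>g\<close>.\<close>

lemma sum_dep_diff_le: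
  fixes g q q' :: "(nat \<Rightarrow> 'b) \<Rightarrow> real"
  assumes sm: "summable (dep g)"
    and q: "bmeas q" "\<And>j. dep q j \<le> dep g j"
    and q': "bmeas q'" "\<And>j. dep q' j \<le> dep g j"
    and d: "l2norm S (\<lambda>y. q' y - q y) \<le> 2 * \<delta>"
  shows "(\<Sum>j<L. dep (\<lambda>y. q' y - q y) j) \<le> real J * (4 * \<delta>) + 2 * (\<Sum>j. dep g (j + J))"
proof -
  define b where "b j = (if j < J then 4 * \<delta> else 2 * dep g j)" for j
  have d0: "0 \<le> \<delta>" using d l2norm_nonneg[of S "\<lambda>y. q' y - q y"] by linarith
  have smJ: "summable (\<lambda>j. dep g (j + J))" using sm by (simp add: summable_iff_shift)
  have eq: "b (j + J) = 2 * dep g (j + J)" for j by (simp add: b_def)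
  have "summable (\<lambda>j. b (j + J))" unfolding eq using smJ by (rule summable_mult)
  then have sb: "summable b" by (simp add: summable_iff_shift)
  have le: "dep (\<lambda>y. q' y - q y) j \<le> b j" for j
  proof (cases "j < J")
    case True
    have "dep (\<lambda>y. q' y - q y) j \<le> 2 * l2norm S (\<lambda>y. q' y - q y)"
      by (intro dep_le_l2norm bmeasD integrable_bmeas bmeas_power bmeas_diff q q')
    then show ?thesis using d True by (simp add: b_def)
  next
    case False
    have "dep (\<lambda>y. q' y - q y) j \<le> dep q' j + dep q j"
      by (intro dep_diff_le bmeasD integrable_bmeas bmeas_power q q')
    then show ?thesis using False q(2)[of j] q'(2)[of j] by (simp add: b_def)
  qed
  have "(\<Sum>j<L. dep (\<lambda>y. q' y - q y) j) \<le> (\<Sum>j<L. b j)" by (intro sum_mono le)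
  also have "\<dots> \<le> (\<Sum>j. b j)" using d0 by (intro sum_le_suminf[OF sb]) (auto simp: b_def)
  also have "\<dots> = (\<Sum>j. b (j + J)) + (\<Sum>j<J. b j)" by (rule suminf_split_initial_segment[OF sb])
  also have "(\<Sum>j<J. b j) = real J * (4 * \<delta>)" by (simp add: b_def)
  also have "(\<Sum>j. b (j + J)) = 2 * (\<Sum>j. dep g (j + J))" unfolding eq by (rule suminf_mult[OF smJ])
  finally show ?thesis by simp
qed

text \<open>The bound for bounded functions of finitely many innovations passes to the limit, as the
  coefficients of the approximants never exceed those of \<open>g\<close>.\<close>

lemma l2norm_sum_stationary:
  fixes g :: "(nat \<Rightarrow> 'b) \<Rightarrow> real"
  assumes m: "g \<in> borel_measurable S" and i: "integrable S (\<lambda>y. (g y)\<^sup>2)" and z: "(\<integral>y. g y \<partial>S) = 0"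
    and sm: "summable (dep g)"
  shows "l2norm S (\<lambda>y. \<Sum>i<n. g (shift i y)) \<le> sqrt n * (\<Sum>j. dep g j)"
proof (rule field_le_epsilon)
  fix e :: real assume e: "e > 0"
  then have "e / (real n + 1) > 0" by (simp add: add_nonneg_pos)
  then obtain K q where q: "bmeas q" "finite_range K q" "(\<integral>y. q y \<partial>S) = 0" "\<And>j. dep q j \<le> dep g j"
    and d: "l2norm S (\<lambda>y. g y - q y) \<le> e / (real n + 1)"
    using exists_bounded_approximant[OF m i z] by blast
  have mq: "(\<lambda>y. g y - q y) \<in> borel_measurable S" using m q by auto
  have iq: "integrable S (\<lambda>y. (g y - q y)\<^sup>2)"
    by (intro integrable_square_diff m i bmeasD integrable_bmeas bmeas_power q)
  have bq: "bmeas (\<lambda>y. \<Sum>i<n. q (shift i y))" by (intro bmeas_intros q)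
  have "l2norm S (\<lambda>y. \<Sum>i<n. g (shift i y)) 
    = l2norm S (\<lambda>y. (\<Sum>i<n. (\<lambda>y. g y - q y) (shift i y)) + (\<Sum>i<n. q (shift i y)))"
    by (simp add: sum_subtractf)
  also have "\<dots> \<le> l2norm S (\<lambda>y. \<Sum>i<n. (\<lambda>y. g y - q y) (shift i y)) + l2norm S (\<lambda>y. \<Sum>i<n. q (shift i y))"
    using l2norm_sum_shift(1)[OF mq iq, of n] mq 
    by (intro l2norm_triangle bmeasD[OF bq] integrable_bmeas[OF bmeas_power[OF bq]])
       (auto intro!: borel_measurable_sum measurable_compose[OF measurable_shift])
  also have "\<dots> \<le> e + sqrt n * (\<Sum>j. dep g j)"
  proof (rule add_mono)
    have "l2norm S (\<lambda>y. \<Sum>i<n. (\<lambda>y. g y - q y) (shift i y)) \<le> real n * (e / (real n + 1))"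
      by (rule order_trans[OF l2norm_sum_shift(2)[OF mq iq]]) (intro mult_left_mono d, simp)
    also have "\<dots> \<le> e" using e by (simp add: field_simps)
    finally show "l2norm S (\<lambda>y. \<Sum>i<n. (\<lambda>y. g y - q y) (shift i y)) \<le> e" .
    have "l2norm S (\<lambda>y. \<Sum>i<n. q (shift i y)) \<le> sqrt n * (\<Sum>j<K. dep q j)"
      using l2norm_sum_bounded[OF q(1-3), of "\<lambda>_. 1" n] by simp
    also have "(\<Sum>j<K. dep q j) \<le> (\<Sum>j<K. dep g j)" by (intro sum_mono q)
    also have "(\<Sum>j<K. dep g j) \<le> (\<Sum>j. dep g j)" by (intro sum_le_suminf sm) auto
    finally show "l2norm S (\<lambda>y. \<Sum>i<n. q (shift i y)) \<le> sqrt n * (\<Sum>j. dep g j)" by (simp add: mult_left_mono)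
  qed
  finally show "l2norm S (\<lambda>y. \<Sum>i<n. g (shift i y)) \<le> sqrt n * (\<Sum>j. dep g j) + e" by simp
qed

text \<open>The difference \<open>g - q\<close> is not a function of finitely many innovations, so the
  maximal inequality applies only to \<open>q' - q\<close> with a second approximant
  \<open>q'\<close>. For fixed \<open>n\<close> and index set the crude bound for the maximum of
  \<open>g - q'\<close> tends to zero as \<open>q'\<close> approaches \<open>g\<close>, while
  \<open>q\<close> stays the same for all \<open>n\<close>.\<close>

lemma exists_maximal_approximant:
  fixes g :: "(nat \<Rightarrow> 'b) \<Rightarrow> real"
  assumes m: "g \<in> borel_measurable S" and i: "integrable S (\<lambda>y. (g y)\<^sup>2)" and z: "(\<integral>y. g y \<partial>S) = 0"
    and sm: "summable (dep g)" and \<eta>: "\<eta> > 0"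
  shows "\<exists>K q. bmeas q \<and> finite_range K q \<and> (\<integral>y. q y \<partial>S) = 0 \<and> (\<forall>j. dep q j \<le> dep g j)
    \<and> (\<forall>(A::nat set) n w. finite A \<longrightarrow> A \<noteq> {} \<longrightarrow> (\<forall>k\<in>A. \<forall>i<n. \<bar>w k i\<bar> \<le> 1) \<longrightarrow>
         (\<integral>y. maxform A n w (\<lambda>y. g y - q y) y \<partial>S) \<le> \<eta> * sqrt (ln (2 * real (card A)) * n))
    \<and> (\<forall>n. l2norm S (\<lambda>y. \<Sum>i<n. g (shift i y) - q (shift i y)) \<le> \<eta> * sqrt n)"
proof -
  obtain J where J: "norm (\<Sum>j. dep g (j + J)) < \<eta> / 8"
    using suminf_exist_split[OF _ sm, of "\<eta> / 8"] \<eta> by auto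
  \<comment> \<open>\<open>J\<close> coefficients of the difference, each at most \<open>4 \<delta>\<close>, sum to at most \<open>\<eta> / 4\<close>\<close>
  define \<delta> where "\<delta> = \<eta> / (16 * (real J + 1))"
  have \<delta>: "\<delta> > 0" "real J * (4 * \<delta>) \<le> \<eta> / 4" using \<eta> by (auto simp: \<delta>_def field_simps)
  obtain K q where q: "bmeas q" "finite_range K q" "(\<integral>y. q y \<partial>S) = 0" "\<And>j. dep q j \<le> dep g j"
    and d: "l2norm S (\<lambda>y. g y - q y) \<le> \<delta>"
    using exists_bounded_approximant[OF m i z \<delta>(1)] by blast
  have mq: "(\<lambda>y. g y - q y) \<in> borel_measurable S" using m q by auto
  have iq: "integrable S (\<lambda>y. (g y - q y)\<^sup>2)"
    by (intro integrable_square_diff m i bmeasD integrable_bmeas bmeas_power q)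
  \<comment> \<open>a second approximant, arbitrarily close to \<open>g\<close>\<close>
  have second: "\<exists>L q'. bmeas q' \<and> bmeas (\<lambda>y. q' y - q y) \<and> finite_range L (\<lambda>y. q' y - q y) \<and> (\<integral>y. q' y - q y \<partial>S) = 0
     \<and> (\<Sum>j<L. dep (\<lambda>y. q' y - q y) j) \<le> \<eta> / 2 \<and> l2norm S (\<lambda>y. g y - q' y) \<le> e" if e: "e > 0" for e
  proof -
    have "min e \<delta> > 0" using e \<delta> by simp
    then obtain K' q' where q': "bmeas q'" "finite_range K' q'" "(\<integral>y. q' y \<partial>S) = 0" "\<And>j. dep q' j \<le> dep g j"
      and d': "l2norm S (\<lambda>y. g y - q' y) \<le> min e \<delta>"
      using exists_bounded_approximant[OF m i z] by blast
    have mq': "(\<lambda>y. g y - q' y) \<in> borel_measurable S" using m q' by auto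
    have iq': "integrable S (\<lambda>y. (g y - q' y)\<^sup>2)"
      by (intro integrable_square_diff m i bmeasD integrable_bmeas bmeas_power q')
    have "l2norm S (\<lambda>y. q' y - q y) = l2norm S (\<lambda>y. (g y - q y) - (g y - q' y))" by simp
    also have "\<dots> \<le> l2norm S (\<lambda>y. g y - q y) + l2norm S (\<lambda>y. g y - q' y)"
      by (intro l2norm_triangle_diff mq iq mq' iq')
    also have "\<dots> \<le> 2 * \<delta>" using d d' by simp
    finally have "(\<Sum>j<max K K'. dep (\<lambda>y. q' y - q y) j) \<le> real J * (4 * \<delta>) + 2 * (\<Sum>j. dep g (j + J))"
      using sum_dep_diff_le[OF sm q(1,4) q'(1,4)] by blast
    also have "\<dots> \<le> \<eta> / 2" using \<delta>(2) J by (simp add: abs_if split: if_splits)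
    finally have "(\<Sum>j<max K K'. dep (\<lambda>y. q' y - q y) j) \<le> \<eta> / 2" .
    moreover have "finite_range (max K K') (\<lambda>y. q' y - q y)"
      using finite_range_mono[OF q(2), of "max K K'"] finite_range_mono[OF q'(2), of "max K K'"]
      by (intro finite_range_funop[where F = "(-)"]) auto
    moreover have "(\<integral>y. q' y - q y \<partial>S) = 0"
      using q(3) q'(3) integrable_bmeas[OF q(1)] integrable_bmeas[OF q'(1)] by simp
    moreover have "bmeas (\<lambda>y. q' y - q y)" by (intro bmeas_diff q q')
    ultimately show ?thesis using q'(1) d' by (intro exI conjI) auto
  qed
  have "(\<integral>y. maxform A n w (\<lambda>y. g y - q y) y \<partial>S) \<le> \<eta> * sqrt (ln (2 * real (card A)) * n)"
    if A: "finite A" "A \<noteq> {}" and w: "\<forall>k\<in>A. \<forall>i<n. \<bar>w k i\<bar> \<le> 1" for A :: "nat set" and n and w :: "nat \<Rightarrow> nat \<Rightarrow> real"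
  proof (rule field_le_epsilon)
    fix e :: real assume e: "e > 0"
    define W where "W = (\<Sum>k\<in>A. \<Sum>i<n. \<bar>w k i\<bar>)"
    have W: "W \<ge> 0" unfolding W_def by (intro sum_nonneg) auto
    have "e / (W + 1) > 0" using e W by (simp add: add_nonneg_pos)
    from second[OF this] obtain L q' where q': "bmeas q'" "bmeas (\<lambda>y. q' y - q y)" "finite_range L (\<lambda>y. q' y - q y)"
      "(\<integral>y. q' y - q y \<partial>S) = 0" "(\<Sum>j<L. dep (\<lambda>y. q' y - q y) j) \<le> \<eta> / 2" "l2norm S (\<lambda>y. g y - q' y) \<le> e / (W + 1)" by blast
    have mq': "(\<lambda>y. g y - q' y) \<in> borel_measurable S" using m q' by auto
    have iq': "integrable S (\<lambda>y. (g y - q' y)\<^sup>2)"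
      by (intro integrable_square_diff m i bmeasD integrable_bmeas bmeas_power q')
    have i1: "integrable S (\<lambda>y. g y - q' y)" by (rule P.expectation_abs_le_l2norm[OF mq' iq'])
    have i2: "integrable S (\<lambda>y. g y - q y)" by (rule P.expectation_abs_le_l2norm[OF mq iq])
    have c0: "ln (2 * real (card A)) \<ge> 0" using A card_gt_0_iff[of A] by simp
    have "(\<integral>y. maxform A n w (\<lambda>y. g y - q y) y \<partial>S) 
      \<le> (\<integral>y. maxform A n w (\<lambda>y. g y - q' y) y + maxform A n w (\<lambda>y. q' y - q y) y \<partial>S)"
      using integrable_maxform(1)[OF A i1, of n w] integrable_maxform(1)[OF A i2, of n w] 
        integrable_maxform(1)[OF A integrable_bmeas[OF q'(2)], of n w]
      by (intro integral_mono maxform_triangle A) auto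
    also have "\<dots> = (\<integral>y. maxform A n w (\<lambda>y. g y - q' y) y \<partial>S) + (\<integral>y. maxform A n w (\<lambda>y. q' y - q y) y \<partial>S)"
      by (intro Bochner_Integration.integral_add integrable_maxform(1) A i1 integrable_bmeas q')
    also have "\<dots> \<le> e + \<eta> * sqrt (ln (2 * real (card A)) * n)"
    proof (rule add_mono)
      have "(\<integral>y. maxform A n w (\<lambda>y. g y - q' y) y \<partial>S) \<le> W * (\<integral>y. \<bar>g y - q' y\<bar> \<partial>S)"
        unfolding W_def by (rule integrable_maxform(2)[OF A i1])
      also have "\<dots> \<le> W * (e / (W + 1))"
        by (rule mult_left_mono[OF order_trans[OF P.expectation_abs_le_l2norm(2)[OF mq' iq'] q'(6)] W])
      also have "\<dots> \<le> e" using e W by (simp add: field_simps)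
      finally show "(\<integral>y. maxform A n w (\<lambda>y. g y - q' y) y \<partial>S) \<le> e" .
      have "(\<integral>y. maxform A n w (\<lambda>y. q' y - q y) y \<partial>S) 
         \<le> 2 * sqrt (ln (2 * real (card A)) * (\<Sum>i<n. 1\<^sup>2)) * (\<Sum>j<L. dep (\<lambda>y. q' y - q y) j)"
        using w by (intro expectation_maxform_bounded A q') auto
      also have "\<dots> \<le> 2 * sqrt (ln (2 * real (card A)) * (\<Sum>i<n. 1\<^sup>2)) * (\<eta> / 2)"
        using c0 by (intro mult_left_mono q') auto
      also have "\<dots> = \<eta> * sqrt (ln (2 * real (card A)) * n)" by simp
      finally show "(\<integral>y. maxform A n w (\<lambda>y. q' y - q y) y \<partial>S) \<le> \<eta> * sqrt (ln (2 * real (card A)) * n)" .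
    qed
    finally show "(\<integral>y. maxform A n w (\<lambda>y. g y - q y) y \<partial>S) \<le> \<eta> * sqrt (ln (2 * real (card A)) * n) + e" by simp
  qed
  moreover have "l2norm S (\<lambda>y. \<Sum>i<n. g (shift i y) - q (shift i y)) \<le> \<eta> * sqrt n" for n
  proof (rule field_le_epsilon)
    fix e :: real assume e: "e > 0"
    then have "e / (real n + 1) > 0" by (simp add: add_nonneg_pos)
    from second[OF this] obtain L q' where q': "bmeas q'" "bmeas (\<lambda>y. q' y - q y)" "finite_range L (\<lambda>y. q' y - q y)"
      "(\<integral>y. q' y - q y \<partial>S) = 0" "(\<Sum>j<L. dep (\<lambda>y. q' y - q y) j) \<le> \<eta> / 2" "l2norm S (\<lambda>y. g y - q' y) \<le> e / (real n + 1)" by blast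
    have mq': "(\<lambda>y. g y - q' y) \<in> borel_measurable S" using m q' by auto
    have iq': "integrable S (\<lambda>y. (g y - q' y)\<^sup>2)"
      by (intro integrable_square_diff m i bmeasD integrable_bmeas bmeas_power q')
    have b: "bmeas (\<lambda>y. \<Sum>i<n. (\<lambda>y. q' y - q y) (shift i y))"
      by (intro bmeas_sum bmeas_shift[of "\<lambda>y. q' y - q y"] q')
    have "l2norm S (\<lambda>y. \<Sum>i<n. g (shift i y) - q (shift i y))
       = l2norm S (\<lambda>y. (\<Sum>i<n. (\<lambda>y. g y - q' y) (shift i y)) + (\<Sum>i<n. (\<lambda>y. q' y - q y) (shift i y)))"
      by (simp add: sum_subtractf)
    also have "\<dots> \<le> l2norm S (\<lambda>y. \<Sum>i<n. (\<lambda>y. g y - q' y) (shift i y)) + l2norm S (\<lambda>y. \<Sum>i<n. (\<lambda>y. q' y - q y) (shift i y))"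
      using l2norm_sum_shift(1)[OF mq' iq', of n] mq'
      by (intro l2norm_triangle bmeasD[OF b] integrable_bmeas[OF bmeas_power[OF b]])
         (auto intro!: borel_measurable_sum measurable_compose[OF measurable_shift])
    also have "\<dots> \<le> e + \<eta> * sqrt n"
    proof (rule add_mono)
      have "l2norm S (\<lambda>y. \<Sum>i<n. (\<lambda>y. g y - q' y) (shift i y)) \<le> real n * (e / (real n + 1))"
        by (rule order_trans[OF l2norm_sum_shift(2)[OF mq' iq']]) (intro mult_left_mono q', simp)
      also have "\<dots> \<le> e" using e by (simp add: field_simps)
      finally show "l2norm S (\<lambda>y. \<Sum>i<n. (\<lambda>y. g y - q' y) (shift i y)) \<le> e" .
      have "l2norm S (\<lambda>y. \<Sum>i<n. (\<lambda>y. q' y - q y) (shift i y)) \<le> sqrt n * (\<Sum>j<L. dep (\<lambda>y. q' y - q y) j)"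
        using l2norm_sum_bounded[OF q'(2-4), of "\<lambda>_. 1" n] by simp
      also have "\<dots> \<le> sqrt n * (\<eta> / 2)" by (intro mult_left_mono q') simp
      also have "\<dots> \<le> \<eta> * sqrt n" using \<eta> by simp
      finally show "l2norm S (\<lambda>y. \<Sum>i<n. (\<lambda>y. q' y - q y) (shift i y)) \<le> \<eta> * sqrt n" .
    qed
    finally show "l2norm S (\<lambda>y. \<Sum>i<n. g (shift i y) - q (shift i y)) \<le> \<eta> * sqrt n + e" by simp
  qed
  ultimately show ?thesis using q by (intro exI[of _ K] exI[of _ q]) blast
qed

section \<open>Upper concentration of trigonometric maxima\<close>

lemma sets_UNIV [simp]: "UNIV \<in> sets S"
  using sets.top[of S] by simp

lemma sets_level [simp]:
  fixes f :: "(nat \<Rightarrow> 'b) \<Rightarrow> real"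
  assumes [measurable]: "f \<in> borel_measurable S"
  shows "{y. c \<le> f y} \<in> sets S" "{y. c < f y} \<in> sets S"
proof -
  have "{y \<in> space S. c \<le> f y} \<in> sets S" "{y \<in> space S. c < f y} \<in> sets S" by measurable
  then show "{y. c \<le> f y} \<in> sets S" "{y. c < f y} \<in> sets S" by simp_all
qed

lemma markov:
  assumes f: "integrable S f" and nn: "\<And>y. 0 \<le> f y" and c: "c > 0"
  shows "measure S {y. c \<le> f y} \<le> (\<integral>y. f y \<partial>S) / c"
  using integral_Markov_inequality_measure[of S f "space S" c] f nn c by auto

lemma prob_cover_le:
  assumes "A \<in> sets S" "B \<in> sets S" "C \<subseteq> A \<union> B"
  shows "measure S C \<le> measure S A + measure S B"
proof -
  have "measure S C \<le> measure S (A \<union> B)"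
    using assms by (intro P.finite_measure_mono) auto
  also have "\<dots> \<le> measure S A + measure S B"
    using assms by (intro measure_Un_le) auto
  finally show ?thesis .
qed

lemma finite_range_quad:
  fixes H :: "(nat \<Rightarrow> 'b) \<Rightarrow> real"
  assumes "finite_range K H" shows "finite_range (Suc K) (quad H)"
proof -
  have 1: "finite_range K (\<lambda>y. (H y)\<^sup>2)"
    using finite_range_funop[OF assms assms, of "\<lambda>a b. a\<^sup>2"] by simp
  have 2: "finite_range K (avg (\<lambda>y. (H y)\<^sup>2))"
    using finite_range_avg[OF finite_range_mono[OF 1, of "Suc K"]] by simp
  have 3: "finite_range (Suc K) (\<lambda>y. avg (\<lambda>y. (H y)\<^sup>2) (shift (Suc 0) y))"
    using finite_range_shift[OF 2, of "Suc 0"] by simp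
  have 4: "finite_range (Suc K) (\<lambda>y. (H y)\<^sup>2)" using finite_range_mono[OF 1, of "Suc K"] by simp
  show ?thesis unfolding quad_def
    by (rule finite_range_funop[OF 4 3, of "(+)"])
qed

text \<open>A law of large numbers: the centred summand is again a bounded function of finitely many
  innovations, so its sums have \<open>L\<^sup>2\<close> norm of order \<open>sqrt n\<close>.\<close>

lemma quad_sum_concentration:
  assumes H: "bmeas H" "finite_range K H" and d: "l2norm S H < d"
  shows "(\<lambda>n. measure S {y. 2 * real n * d\<^sup>2 \<le> (\<Sum>i<n. quad H (shift i y))}) \<longlonglongrightarrow> 0"
proof -
  define a where "a = 2 * (l2norm S H)\<^sup>2"
  define q where "q y = quad H y - a" for y
  have bq: "bmeas q" unfolding q_def by (intro bmeas_diff bmeas_quad H bmeas_const)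
  have fq: "finite_range (Suc K) q"
    using finite_range_funop[OF finite_range_quad[OF H(2)] finite_range_quad[OF H(2)], of "\<lambda>u v. u - a"]
    by (simp add: q_def[abs_def])
  have zq: "(\<integral>y. q y \<partial>S) = 0"
    unfolding q_def using integrable_bmeas[OF bmeas_quad[OF H(1)]] by (simp add: integral_quad[OF H(1)] a_def)
  define C where "C = (\<Sum>j<Suc K. dep q j)"
  define \<kappa> where "\<kappa> = 2 * d\<^sup>2 - a"
  have \<kappa>: "\<kappa> > 0" unfolding \<kappa>_def a_def using power_strict_mono[OF d l2norm_nonneg, of 2] by simp
  have "measure S {y. 2 * real n * d\<^sup>2 \<le> (\<Sum>i<n. quad H (shift i y))} \<le> C / \<kappa> / sqrt n" if n: "n > 0" for n
  proof -
    have b: "bmeas (\<lambda>y. \<Sum>i<n. q (shift i y))" by (intro bmeas_intros bq)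
    have "{y. 2 * real n * d\<^sup>2 \<le> (\<Sum>i<n. quad H (shift i y))} \<subseteq> {y. real n * \<kappa> \<le> \<bar>\<Sum>i<n. q (shift i y)\<bar>}"
      by (auto simp: q_def \<kappa>_def sum_subtractf algebra_simps)
    then have "measure S {y. 2 * real n * d\<^sup>2 \<le> (\<Sum>i<n. quad H (shift i y))} 
        \<le> measure S {y. real n * \<kappa> \<le> \<bar>\<Sum>i<n. q (shift i y)\<bar>}"
      using bmeasD[OF bmeas_abs[OF b]] by (intro P.finite_measure_mono sets_level)
    also have "\<dots> \<le> (\<integral>y. \<bar>\<Sum>i<n. q (shift i y)\<bar> \<partial>S) / (real n * \<kappa>)"
      by (intro markov integrable_bmeas bmeas_abs b) (use n \<kappa> in auto)
    also have "\<dots> \<le> l2norm S (\<lambda>y. \<Sum>i<n. q (shift i y)) / (real n * \<kappa>)"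
      by (rule divide_right_mono[OF P.expectation_abs_le_l2norm(2)[OF bmeasD[OF b] integrable_bmeas[OF bmeas_power[OF b]]]])
        (use n \<kappa> in simp)
    also have "\<dots> \<le> (sqrt n * C) / (real n * \<kappa>)"
      using l2norm_sum_bounded[OF bq fq zq, of "\<lambda>_. 1" n] n \<kappa> unfolding C_def 
      by (intro divide_right_mono) auto
    also have "\<dots> = C / \<kappa> / sqrt n" 
    proof -
      have "s * C / (s * s * \<kappa>) = C / \<kappa> / s" if "s > 0" for s :: real
        using that \<kappa> by simp
      from this[of "sqrt n"] show ?thesis using n by simp
    qed
    finally show ?thesis .
  qed
  then have "\<forall>\<^sub>F n in sequentially. measure S {y. 2 * real n * d\<^sup>2 \<le> (\<Sum>i<n. quad H (shift i y))} \<le> C / \<kappa> / sqrt n"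
    by (rule eventually_mono[OF eventually_gt_at_top[of 0]])
  moreover have "(\<lambda>n. C / \<kappa> / sqrt (real n)) \<longlonglongrightarrow> 0" by real_asymp
  ultimately show ?thesis
    by (rule tendsto_sandwich[OF _ _ tendsto_const, rotated]) (auto simp: measure_nonneg)
qed

text \<open>On the event that the quadratic variation is below twice its typical size, the exponential
  inequality gives the bound \<open>8 n\<close> times \<open>n\<close> to the power \<open>-
  41/40\<close>. A constant above \<open>4\<close> in the square root is what makes this vanish,
  since there are \<open>4 n\<close> sums and \<open>quad\<close> counts the variance twice.\<close>

lemma maxform_martingale_concentration:
  fixes w :: "nat \<Rightarrow> nat \<Rightarrow> nat \<Rightarrow> real"
  assumes H: "bmeas H" "avg H = (\<lambda>_. 0)" "finite_range K H" and d: "l2norm S H < d"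
    and w: "\<And>n k i. \<bar>w n k i\<bar> \<le> 1"
  shows "(\<lambda>n. measure S {y. sqrt (41/10 * real n * ln n) * d \<le> maxform {..<4*n} n (w n) H y}) \<longlonglongrightarrow> 0"
proof -
  have d0: "d > 0" using d l2norm_nonneg[of S H] by linarith
  let ?V = "\<lambda>n y. \<Sum>i<n. quad H (shift i y)"
  have "measure S {y. sqrt (41/10 * real n * ln n) * d \<le> maxform {..<4*n} n (w n) H y}
     \<le> measure S {y. 2 * real n * d\<^sup>2 \<le> ?V n y} + 8 * real n * exp (- (41/40) * ln n)" if n: "n \<ge> 2" for n
  proof -
    define x where "x = sqrt (41/10 * real n * ln n) * d"
    \<comment> \<open>the maximiser of \<open>l x - l\<^sup>2 n d\<^sup>2\<close>\<close>
    define l where "l = x / (2 * real n * d\<^sup>2)"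
    have A: "finite {..<4*n}" "{..<4*n} \<noteq> {}" using n by (auto simp: lessThan_empty_iff bot_nat_def)
    have ln: "ln (real n) > 0" using n by simp
    have x: "x > 0" "x\<^sup>2 = 41/10 * real n * ln n * d\<^sup>2" using n ln d0 by (auto simp: x_def power_mult_distrib)
    have l: "l > 0" using x n d0 by (simp add: l_def)
    have ex: "l * x - l\<^sup>2 / 2 * (2 * real n * d\<^sup>2) = 41/40 * ln n"
    proof -
      have "l * x - l\<^sup>2 / 2 * (2 * real n * d\<^sup>2) = x\<^sup>2 / (4 * real n * d\<^sup>2)"
        using n d0 by (simp add: l_def field_simps power2_eq_square)
      also have "\<dots> = 41/40 * ln n" unfolding x(2) using n d0 by simp
      finally show ?thesis .
    qed
    define U where "U y = exp (l * maxform {..<4*n} n (w n) H y - l\<^sup>2 / 2 * (\<Sum>i<n. 1\<^sup>2 * quad H (shift i y)))" for y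
    have bU: "bmeas U" unfolding U_def by (intro bmeas_intros bmeas_maxform bmeas_quad A H)
    have bV: "bmeas (?V n)" by (intro bmeas_intros bmeas_quad H)
    have "(\<integral>y. U y \<partial>S) \<le> 2 * real (card {..<4*n})"
      unfolding U_def by (rule exponential_maxform[OF A H(1,2) _ l]) (use w in auto)
    then have EU: "(\<integral>y. U y \<partial>S) \<le> 8 * real n" by simp
    have "{y. x \<le> maxform {..<4*n} n (w n) H y} \<subseteq> {y. 2 * real n * d\<^sup>2 \<le> ?V n y} \<union> {y. exp (41/40 * ln n) \<le> U y}"
    proof
      fix y assume "y \<in> {y. x \<le> maxform {..<4*n} n (w n) H y}"
      then have y: "x \<le> maxform {..<4*n} n (w n) H y" by simp
      show "y \<in> {y. 2 * real n * d\<^sup>2 \<le> ?V n y} \<union> {y. exp (41/40 * ln n) \<le> U y}"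
      proof (cases "2 * real n * d\<^sup>2 \<le> ?V n y")
        case False
        then have "l\<^sup>2 / 2 * ?V n y \<le> l\<^sup>2 / 2 * (2 * real n * d\<^sup>2)" by (intro mult_left_mono) auto
        moreover have "l * x \<le> l * maxform {..<4*n} n (w n) H y" using y l by simp
        ultimately have "41/40 * ln n \<le> l * maxform {..<4*n} n (w n) H y - l\<^sup>2 / 2 * ?V n y" using ex by linarith
        then show ?thesis by (simp add: U_def)
      qed simp
    qed
    then have "measure S {y. x \<le> maxform {..<4*n} n (w n) H y} 
       \<le> measure S {y. 2 * real n * d\<^sup>2 \<le> ?V n y} + measure S {y. exp (41/40 * ln n) \<le> U y}"
      by (intro prob_cover_le sets_level bmeasD bU bV)
    also have "measure S {y. exp (41/40 * ln n) \<le> U y} \<le> (\<integral>y. U y \<partial>S) / exp (41/40 * ln n)"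
      by (intro markov integrable_bmeas bU) (auto simp: U_def)
    also have "\<dots> \<le> 8 * real n / exp (41/40 * ln n)" by (intro divide_right_mono EU) simp
    also have "\<dots> = 8 * real n * exp (- (41/40) * ln n)" by (simp add: exp_minus field_simps)
    finally show ?thesis by (simp add: x_def)
  qed
  then have "\<forall>\<^sub>F n in sequentially. measure S {y. sqrt (41/10 * real n * ln n) * d \<le> maxform {..<4*n} n (w n) H y}
     \<le> measure S {y. 2 * real n * d\<^sup>2 \<le> ?V n y} + 8 * real n * exp (- (41/40) * ln n)"
    unfolding eventually_sequentially by blast
  moreover have "(\<lambda>n. measure S {y. 2 * real n * d\<^sup>2 \<le> ?V n y} + 8 * real n * exp (- (41/40) * ln n)) \<longlonglongrightarrow> 0 + 0"
  proof (rule tendsto_add[OF quad_sum_concentration[OF H(1,3) d]])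
    show "(\<lambda>n. 8 * real n * exp (- (41/40) * ln (real n))) \<longlonglongrightarrow> 0" by real_asymp
  qed
  then have "(\<lambda>n. measure S {y. 2 * real n * d\<^sup>2 \<le> ?V n y} + 8 * real n * exp (- (41/40) * ln n)) \<longlonglongrightarrow> 0" by simp
  ultimately show ?thesis
    by (rule tendsto_sandwich[OF _ _ tendsto_const, rotated]) (auto simp: measure_nonneg)
qed

text \<open>The strict inequality leaves room to enlarge every coefficient a little, so that the union of
  \<open>K\<close> martingale bounds applies.\<close>

lemma maxform_bounded_concentration:
  fixes w :: "nat \<Rightarrow> nat \<Rightarrow> nat \<Rightarrow> real"
  assumes q: "bmeas q" "finite_range K q" "(\<integral>y. q y \<partial>S) = 0" and th: "(\<Sum>j<K. dep q j) < \<theta>"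
    and w: "\<And>n k i. \<bar>w n k i\<bar> \<le> 1"
  shows "(\<lambda>n. measure S {y. sqrt (41/10 * real n * ln n) * \<theta> < maxform {..<4*n} n (w n) q y}) \<longlonglongrightarrow> 0"
proof -
  define \<epsilon> where "\<epsilon> = (\<theta> - (\<Sum>j<K. dep q j)) / (real K + 1)"
  define d where "d j = dep q j + \<epsilon>" for j
  have e: "\<epsilon> > 0" using th by (simp add: \<epsilon>_def add_nonneg_pos)
  have sd: "(\<Sum>j<K. d j) \<le> \<theta>"
  proof -
    have "real K * \<epsilon> \<le> (real K + 1) * \<epsilon>" using e by (intro mult_right_mono) auto
    also have "\<dots> = \<theta> - (\<Sum>j<K. dep q j)" by (simp add: \<epsilon>_def)
    finally show ?thesis by (simp add: d_def sum.distrib)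
  qed
  let ?x = "\<lambda>n. sqrt (41/10 * real n * ln n)"
  let ?E = "\<lambda>n j. {y. ?x n * d j \<le> maxform {..<4*n} n (w n) (mpart q j) y}"
  have "measure S {y. ?x n * \<theta> < maxform {..<4*n} n (w n) q y} \<le> (\<Sum>j<K. measure S (?E n j))" if n: "n \<ge> 1" for n
  proof -
    have A: "finite {..<4*n}" "{..<4*n} \<noteq> {}" using n by (auto simp: lessThan_empty_iff bot_nat_def)
    have sE: "?E n j \<in> sets S" for j
      by (rule sets_level[OF bmeasD[OF bmeas_maxform[OF A bmeas_mpart[OF q(1)]]]])
    then have sE': "{y. shift j y \<in> ?E n j} \<in> sets S" for j
      using measurable_sets[OF measurable_shift[of j], of "?E n j"] by (simp add: vimage_def)
    have "{y. ?x n * \<theta> < maxform {..<4*n} n (w n) q y} \<subseteq> (\<Union>j<K. {y. shift j y \<in> ?E n j})"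
    proof
      fix y assume "y \<in> {y. ?x n * \<theta> < maxform {..<4*n} n (w n) q y}"
      then have y: "?x n * \<theta> < maxform {..<4*n} n (w n) q y" by simp
      show "y \<in> (\<Union>j<K. {y. shift j y \<in> ?E n j})"
      proof (rule ccontr)
        assume "y \<notin> (\<Union>j<K. {y. shift j y \<in> ?E n j})"
        then have small: "maxform {..<4*n} n (w n) (mpart q j) (shift j y) \<le> ?x n * d j" if "j < K" for j
          using that by (metis (mono_tags, lifting) UN_iff lessThan_iff linear mem_Collect_eq)
        have "q = (\<lambda>y. \<Sum>j<K. mpart q j (shift j y))"
          using martingale_decomposition[OF q] by blast
        then have "maxform {..<4*n} n (w n) q y \<le> (\<Sum>j<K. maxform {..<4*n} n (w n) (\<lambda>y. mpart q j (shift j y)) y)"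
          using maxform_sum[OF A, of n "w n" "\<lambda>j y. mpart q j (shift j y)" "{..<K}" y] by metis
        also have "\<dots> = (\<Sum>j<K. maxform {..<4*n} n (w n) (mpart q j) (shift j y))"
          by (intro sum.cong refl maxform_shift)
        also have "\<dots> \<le> (\<Sum>j<K. ?x n * d j)" using small by (intro sum_mono) auto
        also have "\<dots> \<le> ?x n * \<theta>" unfolding sum_distrib_left[symmetric] using sd n by (intro mult_left_mono) auto
        finally show False using y by simp
      qed
    qed
    then have "measure S {y. ?x n * \<theta> < maxform {..<4*n} n (w n) q y} \<le> measure S (\<Union>j<K. {y. shift j y \<in> ?E n j})"
      using sE' by (intro P.finite_measure_mono) auto
    also have "\<dots> \<le> (\<Sum>j<K. measure S {y. shift j y \<in> ?E n j})"
      using sE' by (intro measure_UNION_le) auto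
    also have "\<dots> = (\<Sum>j<K. measure S (?E n j))" by (intro sum.cong refl prob_shift sE)
    finally show ?thesis .
  qed
  then have "\<forall>\<^sub>F n in sequentially. measure S {y. ?x n * \<theta> < maxform {..<4*n} n (w n) q y} \<le> (\<Sum>j<K. measure S (?E n j))"
    unfolding eventually_sequentially by blast
  moreover have "(\<lambda>n. \<Sum>j<K. measure S (?E n j)) \<longlonglongrightarrow> (\<Sum>j<K. 0)"
  proof (rule tendsto_sum)
    fix j
    have "l2norm S (mpart q j) < d j" using l2norm_mpart_le[OF q(1), of j] e by (simp add: d_def)
    then show "(\<lambda>n. measure S (?E n j)) \<longlonglongrightarrow> 0"
      by (rule maxform_martingale_concentration[OF bmeas_mpart[OF q(1)] avg_mpart[OF q(1)] finite_range_mpart[OF q(2)] _ w])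
  qed
  then have "(\<lambda>n. \<Sum>j<K. measure S (?E n j)) \<longlonglongrightarrow> 0" by simp
  ultimately show ?thesis
    by (rule tendsto_sandwich[OF _ _ tendsto_const, rotated]) (auto simp: measure_nonneg)
qed

text \<open>The remainder \<open>g - q\<close> is controlled in expectation by Markov's inequality and costs
  \<open>1/10\<close>, the rounding in the coefficient sum a factor \<open>21/20\<close>: the
  constant rises from \<open>41/10\<close> to \<open>5\<close>.\<close>

lemma maxform_concentration:
  fixes w :: "nat \<Rightarrow> nat \<Rightarrow> nat \<Rightarrow> real" and g :: "(nat \<Rightarrow> 'b) \<Rightarrow> real"
  assumes m: "g \<in> borel_measurable S" and i: "integrable S (\<lambda>y. (g y)\<^sup>2)" and z: "(\<integral>y. g y \<partial>S) = 0"
    and sm: "summable (dep g)" and pos: "(\<Sum>j. dep g j) > 0"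
    and w: "\<And>n k i. \<bar>w n k i\<bar> \<le> 1"
  shows "(\<lambda>n. measure S {y. sqrt (5 * real n * ln n) * (\<Sum>j. dep g j) < maxform {..<4*n} n (w n) g y}) \<longlonglongrightarrow> 0"
proof (rule tendstoI)
  fix e :: real assume e: "e > 0"
  define \<Theta> where "\<Theta> = (\<Sum>j. dep g j)"
  have th: "\<Theta> > 0" using pos by (simp add: \<Theta>_def)
  \<comment> \<open>Markov's inequality at level \<open>s \<Theta> / 10\<close> then gives \<open>20 \<eta> / \<Theta> = e / 3\<close>\<close>
  define \<eta> where "\<eta> = e * \<Theta> / 60"
  have \<eta>: "\<eta> > 0" using e th by (simp add: \<eta>_def)
  obtain K q where q: "bmeas q" "finite_range K q" "(\<integral>y. q y \<partial>S) = 0" and dq: "\<forall>j. dep q j \<le> dep g j"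
    and R: "\<forall>(A::nat set) n w. finite A \<longrightarrow> A \<noteq> {} \<longrightarrow> (\<forall>k\<in>A. \<forall>i<n. \<bar>w k i\<bar> \<le> 1) \<longrightarrow>
         (\<integral>y. maxform A n w (\<lambda>y. g y - q y) y \<partial>S) \<le> \<eta> * sqrt (ln (2 * real (card A)) * n)"
    using exists_maximal_approximant[OF m i z sm \<eta>] by (elim exE conjE) (rule that)
  have mq: "(\<lambda>y. g y - q y) \<in> borel_measurable S" using m q by auto
  have iq: "integrable S (\<lambda>y. g y - q y)"
    using P.expectation_abs_le_l2norm(1)[OF m i] integrable_bmeas[OF q(1)] by auto
  have "(\<Sum>j<K. dep q j) \<le> (\<Sum>j<K. dep g j)" using dq by (intro sum_mono) simp
  also have "\<dots> \<le> \<Theta>" unfolding \<Theta>_def by (intro sum_le_suminf sm) auto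
  finally have "(\<Sum>j<K. dep q j) < 21/20 * \<Theta>" using th by simp
  from maxform_bounded_concentration[OF q(1-3) this w]
  have "(\<lambda>n. measure S {y. sqrt (41/10 * real n * ln n) * (21/20 * \<Theta>) < maxform {..<4*n} n (w n) q y}) \<longlonglongrightarrow> 0" .
  then have ev1: "\<forall>\<^sub>F n in sequentially. dist (measure S {y. sqrt (41/10 * real n * ln n) * (21/20 * \<Theta>) < maxform {..<4*n} n (w n) q y}) 0 < e / 2"
    using e by (intro tendstoD) auto
  have ev2: "\<forall>\<^sub>F n in sequentially. ln (8 * real n) \<le> 4 * ln (real n)" by real_asymp
  have const: "sqrt (41/10) * (21/20) + 1/10 \<le> sqrt (5::real)"
  proof -
    have a: "sqrt (41/10) \<le> (203/100::real)" by (rule real_le_lsqrt) (auto simp: power2_eq_square)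
    have b: "2235/1000 \<le> sqrt (5::real)" by (rule real_le_rsqrt) (auto simp: power2_eq_square)
    from a b show ?thesis by simp
  qed
  have "\<forall>\<^sub>F n in sequentially. n \<ge> (2::nat)" by (rule eventually_ge_at_top)
  with ev1 ev2 show "\<forall>\<^sub>F n in sequentially. dist (measure S {y. sqrt (5 * real n * ln n) * (\<Sum>j. dep g j) < maxform {..<4*n} n (w n) g y}) 0 < e"
  proof eventually_elim
    case (elim n)
    define s where "s = sqrt (real n * ln n)"
    have ln: "ln (real n) > 0" using elim by simp
    have s: "s > 0" using ln elim by (simp add: s_def)
    have A: "finite {..<4*n}" "{..<4*n} \<noteq> {}" using elim by (auto simp: lessThan_empty_iff bot_nat_def)
    have sq: "sqrt (c * real n * ln n) = sqrt c * s" for c by (simp add: s_def real_sqrt_mult mult.assoc)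
    let ?E = "{y. sqrt (41/10 * real n * ln n) * (21/20 * \<Theta>) < maxform {..<4*n} n (w n) q y}"
    let ?F = "{y. s * \<Theta> / 10 \<le> maxform {..<4*n} n (w n) (\<lambda>y. g y - q y) y}"
    have "{y. sqrt (5 * real n * ln n) * \<Theta> < maxform {..<4*n} n (w n) g y} \<subseteq> ?E \<union> ?F"
    proof (intro subsetI, rule ccontr)
      fix y assume y: "y \<in> {y. sqrt (5 * real n * ln n) * \<Theta> < maxform {..<4*n} n (w n) g y}" and n: "y \<notin> ?E \<union> ?F"
      from n have "\<not> sqrt (41/10 * real n * ln n) * (21/20 * \<Theta>) < maxform {..<4*n} n (w n) q y"
        and "\<not> s * \<Theta> / 10 \<le> maxform {..<4*n} n (w n) (\<lambda>y. g y - q y) y" by blast+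
      then have "maxform {..<4*n} n (w n) q y \<le> sqrt (41/10) * s * (21/20 * \<Theta>)"
        "maxform {..<4*n} n (w n) (\<lambda>y. g y - q y) y \<le> s * \<Theta> / 10" unfolding sq by linarith+
      moreover from y have "sqrt 5 * (s * \<Theta>) < maxform {..<4*n} n (w n) g y"
        unfolding sq by (simp add: mult.assoc)
      moreover have "maxform {..<4*n} n (w n) g y \<le> maxform {..<4*n} n (w n) q y + maxform {..<4*n} n (w n) (\<lambda>y. g y - q y) y"
        by (intro maxform_triangle A) simp
      moreover have "sqrt (41/10) * s * (21/20 * \<Theta>) + s * \<Theta> / 10 = (sqrt (41/10) * (21/20) + 1/10) * (s * \<Theta>)"
        by (simp add: algebra_simps)
      moreover have "(sqrt (41/10) * (21/20) + 1/10) * (s * \<Theta>) \<le> sqrt 5 * (s * \<Theta>)" using s th by (intro mult_right_mono const) auto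
      ultimately show False by linarith
    qed
    then have "measure S {y. sqrt (5 * real n * ln n) * \<Theta> < maxform {..<4*n} n (w n) g y} \<le> measure S ?E + measure S ?F"
      using borel_measurable_maxform[OF A(1) bmeasD[OF q(1)], of n "w n"] borel_measurable_maxform[OF A(1) mq, of n "w n"]
      by (intro prob_cover_le sets_level) auto
    also have "measure S ?F \<le> (\<integral>y. maxform {..<4*n} n (w n) (\<lambda>y. g y - q y) y \<partial>S) / (s * \<Theta> / 10)"
      by (rule markov[OF integrable_maxform(1)[OF A iq] maxform_nonneg[OF A]]) (use s th in simp)
    also have "\<dots> \<le> (\<eta> * (2 * s)) / (s * \<Theta> / 10)"
    proof (rule divide_right_mono)
      have "(\<integral>y. maxform {..<4*n} n (w n) (\<lambda>y. g y - q y) y \<partial>S) \<le> \<eta> * sqrt (ln (2 * real (card {..<4*n})) * n)"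
        using R[rule_format, OF A, of n "w n"] w by simp
      also have "sqrt (ln (2 * real (card {..<4*n})) * n) \<le> sqrt (4 * ln n * n)"
        using elim by (intro real_sqrt_le_mono mult_right_mono) auto
      also have "sqrt (4 * ln n * n) = 2 * s" by (simp add: s_def real_sqrt_mult mult.commute)
      finally show "(\<integral>y. maxform {..<4*n} n (w n) (\<lambda>y. g y - q y) y \<partial>S) \<le> \<eta> * (2 * s)"
        using \<eta> by (simp add: mult_left_mono)
      show "0 \<le> s * \<Theta> / 10" using s th by simp
    qed
    also have "\<dots> = e / 3" using s th by (simp add: \<eta>_def field_simps)
    finally show ?case using elim(1) e by (simp add: \<Theta>_def dist_real_def)
  qed
qed

end

section \<open>Exponential moments of trigonometric sums over independent blocks\<close>

lemma sum_cos_roots_of_unity: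
  fixes j :: int
  assumes "n > 0" "\<not> int n dvd j"
  shows "(\<Sum>i<n. cos (2 * pi * of_int j * real i / real n)) = 0"
proof -
  define z where "z = cis (2 * pi * of_int j / real n)"
  have zn: "z ^ n = 1"
  proof -
    have "z ^ n = cis (2 * pi * of_int j)" unfolding z_def Complex.DeMoivre using assms(1) by simp
    then show ?thesis by (simp only: complex_eq_iff cis.sel cos_int_2pin sin_int_2pin one_complex.sel)
  qed
  have z1: "z \<noteq> 1"
  proof
    assume "z = 1"
    then have "cos (2 * pi * of_int j / real n) = 1" by (simp add: z_def complex_eq_iff)
    then obtain k :: int where "2 * pi * of_int j / real n = of_int k * 2 * pi" using cos_one_2pi_int by auto
    then have "2 * pi * of_int j = 2 * pi * (real n * of_int k)" using assms(1) by (simp add: field_simps)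
    then have "of_int j = real n * of_int k" by simp
    then have "j = int n * k" by (metis of_int_eq_iff of_int_mult of_int_of_nat_eq)
    then show False using assms(2) by simp
  qed
  have "(\<Sum>i<n. z ^ i) = 0" using geometric_sum[OF z1, of n] zn by simp
  then have "(\<Sum>i<n. Re (z ^ i)) = 0" by (simp flip: Re_sum)
  moreover have "Re (z ^ i) = cos (2 * pi * of_int j * real i / real n)" for i
    unfolding z_def Complex.DeMoivre by (simp add: mult.commute)
  ultimately show ?thesis by simp
qed

lemma sum_cos_squares:
  assumes k: "1 \<le> k" "2 * k < n"
  shows "(\<Sum>i<n. (cos (2 * pi * real k * real i / real n))\<^sup>2) = real n / 2"
proof -
  have "\<not> int n dvd 2 * int k" using k by (intro zdvd_not_zless) auto
  then have 0: "(\<Sum>i<n. cos (2 * pi * of_int (2 * int k) * real i / real n)) = 0"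
    using k by (intro sum_cos_roots_of_unity) auto
  have "(cos (2 * pi * real k * real i / real n))\<^sup>2 = 1/2 + 1/2 * cos (2 * pi * of_int (2 * int k) * real i / real n)" for i
    using cos_double_cos[of "2 * pi * real k * real i / real n"] by (simp add: field_simps)
  then show ?thesis using 0 by (simp only: sum.distrib sum_distrib_left[symmetric]) simp
qed

lemma sum_cos_cross:
  assumes k: "1 \<le> k" "2 * k < n" and l: "1 \<le> l" "2 * l < n" and "k \<noteq> l"
  shows "(\<Sum>i<n. cos (2 * pi * real k * real i / real n) * cos (2 * pi * real l * real i / real n)) = 0"
proof -
  have "\<not> int n dvd int k + int l" using k l by (intro zdvd_not_zless) auto
  then have 1: "(\<Sum>i<n. cos (2 * pi * of_int (int k + int l) * real i / real n)) = 0"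
    using k by (intro sum_cos_roots_of_unity) auto
  have "\<not> int n dvd \<bar>int k - int l\<bar>" using k l \<open>k \<noteq> l\<close> by (intro zdvd_not_zless) auto
  then have "\<not> int n dvd int k - int l" by simp
  then have 2: "(\<Sum>i<n. cos (2 * pi * of_int (int k - int l) * real i / real n)) = 0"
    using k by (intro sum_cos_roots_of_unity) auto
  have "cos (2 * pi * real k * real i / real n) * cos (2 * pi * real l * real i / real n)
    = 1/2 * cos (2 * pi * of_int (int k - int l) * real i / real n) + 1/2 * cos (2 * pi * of_int (int k + int l) * real i / real n)" for i
  proof -
    have "2 * pi * real k * real i / real n - 2 * pi * real l * real i / real n = 2 * pi * of_int (int k - int l) * real i / real n"
      by (simp add: diff_divide_distrib[symmetric] algebra_simps)
    moreover have "2 * pi * real k * real i / real n + 2 * pi * real l * real i / real n = 2 * pi * of_int (int k + int l) * real i / real n"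
      by (simp add: add_divide_distrib[symmetric] algebra_simps)
    ultimately show ?thesis unfolding cos_times_cos by simp
  qed
  then show ?thesis using 1 2 by (simp only: sum.distrib sum_distrib_left[symmetric])
qed

lemma exp_cubic_bound:
  fixes x :: real
  assumes "\<bar>x\<bar> \<le> 1"
  shows "\<bar>exp x - (1 + x + x\<^sup>2 / 2)\<bar> \<le> \<bar>x\<bar> ^ 3"
proof -
  obtain t where t: "\<bar>t\<bar> \<le> \<bar>x\<bar>" "exp x = (\<Sum>m<3. x ^ m / fact m) + exp t / fact 3 * x ^ 3"
    using Maclaurin_exp_le[of x 3] by blast
  have "exp t \<le> exp 1" using t assms by simp
  then have "exp t \<le> 6" using exp_le by linarith
  have "exp x - (1 + x + x\<^sup>2 / 2) = exp t / 6 * x ^ 3"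
    unfolding t(2) by (simp add: eval_nat_numeral)
  then have "\<bar>exp x - (1 + x + x\<^sup>2 / 2)\<bar> = \<bar>exp t / 6 * x ^ 3\<bar>" by (rule arg_cong)
  also have "\<dots> = exp t / 6 * \<bar>x\<bar> ^ 3" by (simp add: abs_mult power_abs)
  also have "\<dots> \<le> 1 * \<bar>x\<bar> ^ 3" using \<open>exp t \<le> 6\<close> by (intro mult_right_mono) auto
  finally show ?thesis by simp
qed

text \<open>A second order lower bound for \<open>1 + u\<close> that has the form of an exponential; it
  converts additive bounds for Laplace transforms into multiplicative ones.\<close>

lemma exp_le_one_plus:
  fixes u :: real
  assumes "\<bar>u\<bar> \<le> 1 / 2"
  shows "exp (u - 2 * u\<^sup>2) \<le> 1 + u"
proof -
  have "\<bar>ln (1 + u) - u\<bar> \<le> 2 * u\<^sup>2" by (rule abs_ln_one_plus_x_minus_x_bound[OF assms])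
  then have "u - 2 * u\<^sup>2 \<le> ln (1 + u)" by linarith
  then have "exp (u - 2 * u\<^sup>2) \<le> exp (ln (1 + u))" by simp
  also have "\<dots> = 1 + u" using assms by simp
  finally show ?thesis .
qed

context innovation_space
begin

text \<open>The values of \<open>Y\<close> on windows of length \<open>P\<close> that start at multiples of
  \<open>P\<close> are independent.\<close>

lemma integral_exp_block_sum:
  assumes Y: "bmeas Y" "finite_range P Y"
  shows "(\<integral>y. exp (\<Sum>i<n. c i * Y (shift (i * P) y)) \<partial>S) = (\<Prod>i<n. \<integral>y. exp (c i * Y y) \<partial>S)"
proof (induction n arbitrary: c)
  case (Suc n)
  define G where "G y = exp (\<Sum>i<n. c (Suc i) * Y (shift (i * P) y))" for y
  have bG: "bmeas G" unfolding G_def by (intro bmeas_intros Y)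
  have bE: "bmeas (\<lambda>y. exp (c 0 * Y y))" by (intro bmeas_intros Y)
  have fE: "finite_range P (\<lambda>y. exp (c 0 * Y y))"
    by (rule finite_range_funop[OF Y(2) Y(2), of "\<lambda>a b. exp (c 0 * a)"])
  have "exp (\<Sum>i<Suc n. c i * Y (shift (i * P) y)) = exp (c 0 * Y y) * G (shift P y)" for y
    unfolding sum.lessThan_Suc_shift G_def by (simp add: exp_add)
  then have "(\<integral>y. exp (\<Sum>i<Suc n. c i * Y (shift (i * P) y)) \<partial>S) = (\<integral>y. exp (c 0 * Y y) * G (shift P y) \<partial>S)"
    by presburger
  also have "\<dots> = (\<integral>y. exp (c 0 * Y y) \<partial>S) * (\<integral>y. G y \<partial>S)"
    by (rule integral_mult_indep[OF bE fE bG])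
  also have "(\<integral>y. G y \<partial>S) = (\<Prod>i<n. \<integral>y. exp (c (Suc i) * Y y) \<partial>S)"
    unfolding G_def by (rule Suc.IH)
  finally show ?case by (simp only: prod.lessThan_Suc_shift)
qed simp

text \<open>Third order expansion of the exponential at a centred bounded variable: up to a cubic error the
  Laplace transform is Gaussian.\<close>

lemma mgf_bounds:
  assumes Y: "bmeas Y" "(\<integral>y. Y y \<partial>S) = 0" and B: "\<And>y. \<bar>Y y\<bar> \<le> B" "B > 0" and s: "\<bar>s\<bar> * B \<le> 1 / 2"
  defines "v \<equiv> (\<integral>y. (Y y)\<^sup>2 \<partial>S)"
  shows "(\<integral>y. exp (s * Y y) \<partial>S) \<le> exp (s\<^sup>2 * v / 2 + 6 * B ^ 3 * \<bar>s\<bar> ^ 3)"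
    and "exp (s\<^sup>2 * v / 2 - 6 * B ^ 3 * \<bar>s\<bar> ^ 3) \<le> (\<integral>y. exp (s * Y y) \<partial>S)"
proof -
  define r where "r = (\<bar>s\<bar> * B) ^ 3"
  have r: "0 \<le> r" "r = B ^ 3 * \<bar>s\<bar> ^ 3" using B by (auto simp: r_def power_mult_distrib)
  define \<phi> where "\<phi> = (\<integral>y. exp (s * Y y) \<partial>S)"
  have sY: "\<bar>s * Y y\<bar> \<le> \<bar>s\<bar> * B" for y
    unfolding abs_mult by (rule mult_left_mono[OF B(1)]) simp
  have E: "\<bar>exp (s * Y y) - (1 + s * Y y + (s * Y y)\<^sup>2 / 2)\<bar> \<le> r" for y
  proof -
    have "\<bar>exp (s * Y y) - (1 + s * Y y + (s * Y y)\<^sup>2 / 2)\<bar> \<le> \<bar>s * Y y\<bar> ^ 3"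
      using sY[of y] s by (intro exp_cubic_bound) simp
    also have "\<dots> \<le> r" unfolding r_def by (intro power_mono sY) simp
    finally show ?thesis .
  qed
  have I: "(\<integral>y. 1 + s * Y y + (s * Y y)\<^sup>2 / 2 + c \<partial>S) = 1 + s\<^sup>2 * v / 2 + c" for c
    using integrable_bmeas[OF Y(1)] integrable_bmeas[OF bmeas_power[OF Y(1)], of 2] Y(2)
    by (simp add: v_def power_mult_distrib)
  have "\<phi> \<le> (\<integral>y. 1 + s * Y y + (s * Y y)\<^sup>2 / 2 + r \<partial>S)" unfolding \<phi>_def
  proof (rule integral_mono_bmeas)
    show "exp (s * Y y) \<le> 1 + s * Y y + (s * Y y)\<^sup>2 / 2 + r" for y using E[of y] by linarith
  qed (intro bmeas_intros Y)+
  then have up: "\<phi> \<le> 1 + s\<^sup>2 * v / 2 + r" unfolding I .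
  have "(\<integral>y. 1 + s * Y y + (s * Y y)\<^sup>2 / 2 + (- r) \<partial>S) \<le> \<phi>" unfolding \<phi>_def
  proof (rule integral_mono_bmeas)
    show "1 + s * Y y + (s * Y y)\<^sup>2 / 2 + (- r) \<le> exp (s * Y y)" for y using E[of y] by linarith
  qed (intro bmeas_intros Y)+
  then have lo: "1 + (s\<^sup>2 * v / 2 - r) \<le> \<phi>" unfolding I by simp
  have "\<phi> \<le> exp (s\<^sup>2 * v / 2 + r)" using up exp_ge_add_one_self[of "s\<^sup>2 * v / 2 + r"] by linarith
  also have "\<dots> \<le> exp (s\<^sup>2 * v / 2 + 6 * B ^ 3 * \<bar>s\<bar> ^ 3)" using r by simp
  finally show "(\<integral>y. exp (s * Y y) \<partial>S) \<le> exp (s\<^sup>2 * v / 2 + 6 * B ^ 3 * \<bar>s\<bar> ^ 3)" unfolding \<phi>_def .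
  define x where "x = \<bar>s\<bar> * B"
  have x: "0 \<le> x" "x \<le> 1/2" using s B by (auto simp: x_def)
  have v: "0 \<le> v" "v \<le> B\<^sup>2"
  proof -
    show "0 \<le> v" by (simp add: v_def)
    have "v \<le> (\<integral>y. B\<^sup>2 \<partial>S)" unfolding v_def
    proof (rule integral_mono_bmeas)
      show "(Y y)\<^sup>2 \<le> B\<^sup>2" for y using power_mono[OF B(1)[of y] abs_ge_zero, of 2] by simp
    qed (intro bmeas_intros Y)+
    then show "v \<le> B\<^sup>2" by simp
  qed
  define u where "u = s\<^sup>2 * v / 2 - r"
  have sv: "0 \<le> s\<^sup>2 * v" "s\<^sup>2 * v \<le> x\<^sup>2"
    using v mult_left_mono[OF v(2), of "s\<^sup>2"] by (auto simp: x_def power_mult_distrib)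
  have rx: "r = x ^ 3" by (simp add: r_def x_def)
  have x3: "x ^ 3 \<le> x\<^sup>2 / 2" using x mult_right_mono[of x "1/2" "x\<^sup>2"] by (simp add: power3_eq_cube power2_eq_square)
  have ux: "\<bar>u\<bar> \<le> x\<^sup>2 / 2" using sv rx x3 r(1) unfolding u_def by linarith
  have x2: "x\<^sup>2 \<le> 1/4" using power_mono[OF x(2) x(1), of 2] by (simp add: power2_eq_square)
  have "u\<^sup>2 \<le> (x\<^sup>2 / 2)\<^sup>2" using ux by (metis abs_ge_zero power2_abs power_mono)
  also have "(x\<^sup>2 / 2)\<^sup>2 = x ^ 3 * (x / 4)" by (simp add: power2_eq_square power3_eq_cube)
  also have "\<dots> \<le> x ^ 3 * 1" using x by (intro mult_left_mono) auto
  finally have u2: "u\<^sup>2 \<le> r" by (simp add: rx)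
  have "exp (s\<^sup>2 * v / 2 - 6 * B ^ 3 * \<bar>s\<bar> ^ 3) \<le> exp (u - 2 * u\<^sup>2)"
    using u2 r by (simp add: u_def)
  also have "\<dots> \<le> 1 + u" by (rule exp_le_one_plus) (use ux x2 in linarith)
  also have "\<dots> \<le> \<phi>" using lo by (simp add: u_def)
  finally show "exp (s\<^sup>2 * v / 2 - 6 * B ^ 3 * \<bar>s\<bar> ^ 3) \<le> (\<integral>y. exp (s * Y y) \<partial>S)" unfolding \<phi>_def .
qed

lemma mgf_block_sum_bounds:
  assumes Y: "bmeas Y" "finite_range P Y" "(\<integral>y. Y y \<partial>S) = 0" and B: "\<And>y. \<bar>Y y\<bar> \<le> B" "B > 0" 
    and c: "\<And>i. i < n \<Longrightarrow> \<bar>c i\<bar> \<le> b" and b: "b * B \<le> 1 / 2" 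
  defines "v \<equiv> (\<integral>y. (Y y)\<^sup>2 \<partial>S)"
  shows "(\<integral>y. exp (\<Sum>i<n. c i * Y (shift (i * P) y)) \<partial>S) \<le> exp ((\<Sum>i<n. (c i)\<^sup>2) * v / 2 + real n * (6 * B ^ 3 * b ^ 3))"
    and "exp ((\<Sum>i<n. (c i)\<^sup>2) * v / 2 - real n * (6 * B ^ 3 * b ^ 3)) \<le> (\<integral>y. exp (\<Sum>i<n. c i * Y (shift (i * P) y)) \<partial>S)"
proof -
  have cB: "\<bar>c i\<bar> * B \<le> 1 / 2" if "i < n" for i
    using mult_right_mono[OF c[OF that], of B] B b by linarith
  have c3: "6 * B ^ 3 * \<bar>c i\<bar> ^ 3 \<le> 6 * B ^ 3 * b ^ 3" if "i < n" for i
    using c[OF that] B by (intro mult_left_mono power_mono) auto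
  have "(\<Prod>i<n. \<integral>y. exp (c i * Y y) \<partial>S) \<le> (\<Prod>i<n. exp ((c i)\<^sup>2 * v / 2 + 6 * B ^ 3 * b ^ 3))"
  proof (intro prod_mono conjI)
    fix i assume i: "i \<in> {..<n}"
    show "(\<integral>y. exp (c i * Y y) \<partial>S) \<le> exp ((c i)\<^sup>2 * v / 2 + 6 * B ^ 3 * b ^ 3)"
      using mgf_bounds(1)[OF Y(1,3) B cB[of i]] c3[of i] i unfolding v_def
      by (intro order_trans[OF mgf_bounds(1)[OF Y(1,3) B cB[of i]]]) auto
  qed (simp add: integral_nonneg_AE)
  also have "\<dots> = exp ((\<Sum>i<n. (c i)\<^sup>2) * v / 2 + real n * (6 * B ^ 3 * b ^ 3))"
    by (simp add: exp_sum[symmetric] sum.distrib sum_distrib_right sum_divide_distrib)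
  finally show "(\<integral>y. exp (\<Sum>i<n. c i * Y (shift (i * P) y)) \<partial>S) \<le> exp ((\<Sum>i<n. (c i)\<^sup>2) * v / 2 + real n * (6 * B ^ 3 * b ^ 3))"
    unfolding integral_exp_block_sum[OF Y(1,2)] .
  have "exp ((\<Sum>i<n. (c i)\<^sup>2) * v / 2 - real n * (6 * B ^ 3 * b ^ 3)) = (\<Prod>i<n. exp ((c i)\<^sup>2 * v / 2 - 6 * B ^ 3 * b ^ 3))"
    by (simp add: exp_sum[symmetric] sum_subtractf sum_distrib_right sum_divide_distrib)
  also have "\<dots> \<le> (\<Prod>i<n. \<integral>y. exp (c i * Y y) \<partial>S)"
  proof (intro prod_mono conjI)
    fix i assume i: "i \<in> {..<n}"
    show "exp ((c i)\<^sup>2 * v / 2 - 6 * B ^ 3 * b ^ 3) \<le> (\<integral>y. exp (c i * Y y) \<partial>S)"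
      using c3[of i] i unfolding v_def
      by (intro order_trans[OF _ mgf_bounds(2)[OF Y(1,3) B cB[of i]]]) auto
  qed simp
  finally show "exp ((\<Sum>i<n. (c i)\<^sup>2) * v / 2 - real n * (6 * B ^ 3 * b ^ 3)) \<le> (\<integral>y. exp (\<Sum>i<n. c i * Y (shift (i * P) y)) \<partial>S)"
    unfolding integral_exp_block_sum[OF Y(1,2)] .
qed

text \<open>Chebyshev's inequality at half the mean.\<close>

lemma second_moment_method:
  assumes Z: "bmeas Z" and a: "0 < a" "a \<le> (\<integral>y. Z y \<partial>S)" and b: "(\<integral>y. (Z y)\<^sup>2 \<partial>S) \<le> b"
  shows "measure S {y. Z y \<le> a / 2} \<le> 4 * (b / a\<^sup>2 - 1)"
proof -
  define m where "m = (\<integral>y. Z y \<partial>S)"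
  have m: "m > 0" "a \<le> m" using a by (auto simp: m_def)
  have bZ: "bmeas (\<lambda>y. (Z y - m)\<^sup>2)" by (intro bmeas_intros Z)
  have "{y. Z y \<le> a / 2} \<subseteq> {y. (m / 2)\<^sup>2 \<le> (Z y - m)\<^sup>2}"
  proof
    fix y assume "y \<in> {y. Z y \<le> a / 2}"
    then have "m / 2 \<le> m - Z y" using m by simp
    then have "(m / 2)\<^sup>2 \<le> (m - Z y)\<^sup>2" using m by (intro power_mono) auto
    then show "y \<in> {y. (m / 2)\<^sup>2 \<le> (Z y - m)\<^sup>2}" by (simp add: power2_commute)
  qed
  then have "measure S {y. Z y \<le> a / 2} \<le> measure S {y. (m / 2)\<^sup>2 \<le> (Z y - m)\<^sup>2}"
    by (intro P.finite_measure_mono sets_level bmeasD bZ)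
  also have "\<dots> \<le> (\<integral>y. (Z y - m)\<^sup>2 \<partial>S) / (m / 2)\<^sup>2"
    by (intro markov integrable_bmeas bZ) (use m in auto)
  also have "(\<integral>y. (Z y - m)\<^sup>2 \<partial>S) = (\<integral>y. (Z y)\<^sup>2 \<partial>S) - m\<^sup>2"
  proof -
    have "(\<integral>y. (Z y - m)\<^sup>2 \<partial>S) = (\<integral>y. (Z y)\<^sup>2 - (2 * m * Z y - m\<^sup>2) \<partial>S)"
      by (intro Bochner_Integration.integral_cong refl) (simp add: power2_eq_square algebra_simps)
    also have "\<dots> = (\<integral>y. (Z y)\<^sup>2 \<partial>S) - (2 * m * (\<integral>y. Z y \<partial>S) - m\<^sup>2)"
      using integrable_bmeas[OF Z] integrable_bmeas[OF bmeas_power[OF Z], of 2] by simp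
    finally show ?thesis by (simp add: m_def power2_eq_square)
  qed
  also have "((\<integral>y. (Z y)\<^sup>2 \<partial>S) - m\<^sup>2) / (m / 2)\<^sup>2 = 4 * ((\<integral>y. (Z y)\<^sup>2 \<partial>S) / m\<^sup>2 - 1)"
    using m by (simp add: field_simps power2_eq_square)
  also have "(\<integral>y. (Z y)\<^sup>2 \<partial>S) / m\<^sup>2 \<le> b / a\<^sup>2"
  proof (rule frac_le)
    show "0 \<le> b" by (rule order_trans[OF _ b]) simp
    show "a\<^sup>2 \<le> m\<^sup>2" using a m by (intro power_mono) auto
  qed (use a b in auto)
  finally show ?thesis by simp
qed

section \<open>Largest trigonometric sum of independent blocks\<close>

text \<open>The second moment method for the sum \<open>Z\<close> of the exponentials of \<open>l\<close>
  times the trigonometric sums. Up to errors \<open>\<epsilon>\<close> in the exponents, each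
  exponential has mean \<open>exp (l\<^sup>2 n v / 4) = N powr (1/4)\<close> and second moment
  \<open>N\<close>. Orthogonality of the cosines makes different exponentials nearly uncorrelated,
  and the \<open>N\<close> diagonal terms contribute \<open>N\<^sup>2\<close>, which is negligible
  against the squared mean \<open>N powr (5/2)\<close> of \<open>Z\<close>. If all sums were at
  most \<open>x\<close>, then \<open>Z\<close> would be below half its mean.\<close>

lemma block_max_second_moment:
  assumes Y: "bmeas Y" "finite_range P Y" "(\<integral>y. Y y \<partial>S) = 0" and B: "\<And>y. \<bar>Y y\<bar> \<le> B" "B > 0"
    and v: "v = (\<integral>y. (Y y)\<^sup>2 \<partial>S)" "v > 0"
    and N: "2 \<le> N" "2 * N < n" and l: "l = sqrt (ln N / (real n * v))" "4 * l * B \<le> 1"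
    and e: "48 * B ^ 3 * l ^ 3 * n \<le> \<epsilon>" and x: "l * x \<le> ln N / 4 - \<epsilon> - ln 2"
  shows "measure S {y. \<forall>k\<in>{1..N}. (\<Sum>i<n. cos (2 * pi * real k * real i / real n) * Y (shift (i * P) y)) \<le> x}
    \<le> 4 * (exp (3 * \<epsilon>) * (1 + exp (- ln N / 2)) - 1)"
proof -
  define c where "c k i = cos (2 * pi * real k * real i / real n)" for k i
  define M where "M k y = (\<Sum>i<n. c k i * Y (shift (i * P) y))" for k y
  \<comment> \<open>large sums dominate \<open>Z\<close>\<close>
  define Z where "Z y = (\<Sum>k\<in>{1..N}. exp (l * M k y))" for y
  define L where "L = ln (real N)"
  have L: "L > 0" "exp L = N" using N by (auto simp: L_def)
  have n: "n > 0" using N by simp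
  have l0: "l > 0" "l\<^sup>2 * (real n * v) = L" using L n v by (auto simp: l(1) L_def[symmetric])
  have lB: "(2 * l) * B \<le> 1/2" using l(2) by simp
  have ee: "real n * (6 * B ^ 3 * (2 * l) ^ 3) \<le> \<epsilon>" using e by (simp add: power_mult_distrib mult.commute mult.left_commute)
  have bM: "bmeas (M k)" for k unfolding M_def by (intro bmeas_intros Y)
  have bZ: "bmeas Z" unfolding Z_def by (intro bmeas_intros bM)
  have c1: "\<bar>c k i\<bar> \<le> 1" for k i unfolding c_def by (rule abs_cos_le_one)
  have cc: "(\<Sum>i<n. (c k i)\<^sup>2) = real n / 2" if "k \<in> {1..N}" for k
    unfolding c_def using that N by (intro sum_cos_squares) auto
  have ck: "(\<Sum>i<n. c k i * c j i) = 0" if "k \<in> {1..N}" "j \<in> {1..N}" "k \<noteq> j" for k j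
    unfolding c_def using that N by (intro sum_cos_cross) auto
  have lM: "l * M k y = (\<Sum>i<n. (l * c k i) * Y (shift (i * P) y))" for k y
    by (simp add: M_def sum_distrib_left mult.assoc)
  have lMM: "l * M k y + l * M j y = (\<Sum>i<n. (l * (c k i + c j i)) * Y (shift (i * P) y))" for k j y
    by (simp add: M_def sum_distrib_left sum.distrib algebra_simps)
  have mean: "exp (L / 4 - \<epsilon>) \<le> (\<integral>y. exp (l * M k y) \<partial>S)" if k: "k \<in> {1..N}" for k
  proof -
    have "(\<Sum>i<n. (l * c k i)\<^sup>2) = l\<^sup>2 * (\<Sum>i<n. (c k i)\<^sup>2)"
      by (simp add: power_mult_distrib sum_distrib_left)
    then have "(\<Sum>i<n. (l * c k i)\<^sup>2) * v / 2 = (l\<^sup>2 * (real n * v)) / 4"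
      unfolding cc[OF k] by simp
    then have "(\<Sum>i<n. (l * c k i)\<^sup>2) * v / 2 = L / 4" unfolding l0(2) .
    note s = this
    have "\<bar>l * c k i\<bar> \<le> 2 * l" for i
      using mult_left_mono[OF c1[of k i], of l] l0 by (simp add: abs_mult)
    from mgf_block_sum_bounds(2)[where n = n and c = "\<lambda>i. l * c k i" and b = "2 * l", OF Y B this lB]
    have "exp (L / 4 - real n * (6 * B ^ 3 * (2 * l) ^ 3)) \<le> (\<integral>y. exp (l * M k y) \<partial>S)"
      unfolding v(1)[symmetric] s lM[symmetric] .
    moreover have "exp (L / 4 - \<epsilon>) \<le> exp (L / 4 - real n * (6 * B ^ 3 * (2 * l) ^ 3))" using ee by simp
    ultimately show ?thesis by linarith
  qed
  have two: "(\<integral>y. exp (l * M k y) * exp (l * M j y) \<partial>S) \<le> exp ((if k = j then L else L / 2) + \<epsilon>)"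
    if k: "k \<in> {1..N}" "j \<in> {1..N}" for k j
  proof -
    have "(\<Sum>i<n. (c k i + c j i)\<^sup>2) = (\<Sum>i<n. (c k i)\<^sup>2) + (\<Sum>i<n. (c j i)\<^sup>2) + 2 * (\<Sum>i<n. c k i * c j i)"
      by (simp add: power2_sum sum.distrib sum_distrib_left mult.assoc)
    also have "\<dots> = (if k = j then 2 * real n else real n)"
      using cc[OF k(1)] cc[OF k(2)] ck[OF k] by (auto simp flip: power2_eq_square)
    finally have sq: "(\<Sum>i<n. (c k i + c j i)\<^sup>2) = (if k = j then 2 * real n else real n)" .
    have "(\<Sum>i<n. (l * (c k i + c j i))\<^sup>2) = l\<^sup>2 * (\<Sum>i<n. (c k i + c j i)\<^sup>2)"
      by (simp add: power_mult_distrib sum_distrib_left)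
    then have "(\<Sum>i<n. (l * (c k i + c j i))\<^sup>2) * v / 2 = (if k = j then l\<^sup>2 * (real n * v) else l\<^sup>2 * (real n * v) / 2)"
      unfolding sq by simp
    then have "(\<Sum>i<n. (l * (c k i + c j i))\<^sup>2) * v / 2 = (if k = j then L else L / 2)" unfolding l0(2) .
    note s = this
    have "\<bar>l * (c k i + c j i)\<bar> \<le> 2 * l" for i
    proof -
      have "\<bar>c k i + c j i\<bar> \<le> 2" using c1[of k i] c1[of j i] by linarith
      then show ?thesis using mult_left_mono[of "\<bar>c k i + c j i\<bar>" 2 l] l0 by (simp add: abs_mult)
    qed
    from mgf_block_sum_bounds(1)[where n = n and c = "\<lambda>i. l * (c k i + c j i)" and b = "2 * l", OF Y B this lB]
    have "(\<integral>y. exp (l * M k y + l * M j y) \<partial>S) \<le> exp ((if k = j then L else L / 2) + real n * (6 * B ^ 3 * (2 * l) ^ 3))"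
      unfolding v(1)[symmetric] s lMM[symmetric] .
    also have "\<dots> \<le> exp ((if k = j then L else L / 2) + \<epsilon>)" using ee by simp
    finally show ?thesis by (simp add: exp_add)
  qed
  define a where "a = real N * exp (L / 4 - \<epsilon>)"
  define b where "b = (real N)\<^sup>2 * exp (L / 2 + \<epsilon>) + real N * exp (L + \<epsilon>)"
  have a: "a > 0" using N by (simp add: a_def)
  have EZ: "a \<le> (\<integral>y. Z y \<partial>S)"
  proof -
    have "(\<integral>y. Z y \<partial>S) = (\<Sum>k\<in>{1..N}. \<integral>y. exp (l * M k y) \<partial>S)"
      unfolding Z_def by (intro Bochner_Integration.integral_sum integrable_bmeas bmeas_exp bmeas_cmult bM)
    also have "\<dots> \<ge> (\<Sum>k\<in>{1..N}. exp (L / 4 - \<epsilon>))" by (intro sum_mono mean)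
    finally show ?thesis by (simp add: a_def)
  qed
  have EZ2: "(\<integral>y. (Z y)\<^sup>2 \<partial>S) \<le> b"
  proof -
    have "(Z y)\<^sup>2 = (\<Sum>k\<in>{1..N}. \<Sum>j\<in>{1..N}. exp (l * M k y) * exp (l * M j y))" for y
      unfolding Z_def power2_eq_square sum_product ..
    then have "(\<integral>y. (Z y)\<^sup>2 \<partial>S) = (\<integral>y. (\<Sum>k\<in>{1..N}. \<Sum>j\<in>{1..N}. exp (l * M k y) * exp (l * M j y)) \<partial>S)" by simp
    also have "\<dots> = (\<Sum>k\<in>{1..N}. \<integral>y. (\<Sum>j\<in>{1..N}. exp (l * M k y) * exp (l * M j y)) \<partial>S)"
      by (intro Bochner_Integration.integral_sum integrable_bmeas bmeas_sum bmeas_mult bmeas_exp bmeas_cmult bM)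
    also have "\<dots> = (\<Sum>k\<in>{1..N}. \<Sum>j\<in>{1..N}. \<integral>y. exp (l * M k y) * exp (l * M j y) \<partial>S)"
      by (intro sum.cong refl Bochner_Integration.integral_sum integrable_bmeas bmeas_mult bmeas_exp bmeas_cmult bM)
    also have "\<dots> \<le> (\<Sum>k\<in>{1..N}. \<Sum>j\<in>{1..N}. exp ((if k = j then L else L / 2) + \<epsilon>))"
      by (intro sum_mono two)
    also have "\<dots> \<le> (\<Sum>k\<in>{1..N}. \<Sum>j\<in>{1..N}. exp (L / 2 + \<epsilon>) + (if j = k then exp (L + \<epsilon>) else 0))"
      by (intro sum_mono) auto
    also have "\<dots> = b"
      by (simp add: b_def sum.distrib power2_eq_square algebra_simps)
    finally show ?thesis .
  qed
  have "{y. \<forall>k\<in>{1..N}. M k y \<le> x} \<subseteq> {y. Z y \<le> a / 2}"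
  proof
    fix y assume y: "y \<in> {y. \<forall>k\<in>{1..N}. M k y \<le> x}"
    have "l * M k y \<le> L / 4 - \<epsilon> - ln 2" if "k \<in> {1..N}" for k
    proof -
      have "M k y \<le> x" using y that by blast
      then have "l * M k y \<le> l * x" using l0(1) by simp
      with x show ?thesis unfolding L_def by linarith
    qed
    then have "Z y \<le> (\<Sum>k\<in>{1..N}. exp (L / 4 - \<epsilon> - ln 2))" unfolding Z_def by (intro sum_mono) simp
    also have "\<dots> = a / 2" by (simp add: a_def exp_diff)
    finally show "y \<in> {y. Z y \<le> a / 2}" by simp
  qed
  moreover have "{y. Z y \<le> a / 2} = UNIV - {y. a / 2 < Z y}" by auto
  then have "{y. Z y \<le> a / 2} \<in> sets S" using sets_level(2)[OF bmeasD[OF bZ], of "a / 2"] by (simp add: sets.Diff)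
  ultimately have "measure S {y. \<forall>k\<in>{1..N}. M k y \<le> x} \<le> measure S {y. Z y \<le> a / 2}"
    by (rule P.finite_measure_mono)
  also have "\<dots> \<le> 4 * (b / a\<^sup>2 - 1)" by (rule second_moment_method[OF bZ a EZ EZ2])
  also have "b / a\<^sup>2 = exp (3 * \<epsilon>) * (1 + exp (- L / 2))"
  proof -
    have e2: "exp (L / 4 - \<epsilon>) * exp (L / 4 - \<epsilon>) = exp (L / 2 - 2 * \<epsilon>)"
      unfolding exp_add[symmetric] by (rule arg_cong[of _ _ exp]) simp
    have "a\<^sup>2 = (real N)\<^sup>2 * (exp (L / 4 - \<epsilon>) * exp (L / 4 - \<epsilon>))"
      by (simp only: a_def power2_eq_square ac_simps)
    then have "a\<^sup>2 = (real N)\<^sup>2 * exp (L / 2 - 2 * \<epsilon>)" unfolding e2 .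
    moreover have "exp (L / 2 - 2 * \<epsilon>) * exp (3 * \<epsilon>) = exp (L / 2 + \<epsilon>)"
      "real N * (exp (L / 2 - 2 * \<epsilon>) * exp (3 * \<epsilon>) * exp (- L / 2)) = exp (L + \<epsilon>)"
      unfolding L(2)[symmetric] exp_add[symmetric] by (simp_all add: algebra_simps)
    moreover have "N'\<^sup>2 * p * (r * (1 + t)) = N'\<^sup>2 * X + N' * Y" 
      if "p * r = X" "N' * (p * r * t) = Y" for N' p r t X Y :: real
      unfolding that[symmetric] by (simp add: power2_eq_square algebra_simps)
    ultimately have "a\<^sup>2 * (exp (3 * \<epsilon>) * (1 + exp (- L / 2))) = b"
      unfolding b_def by presburger
    then show ?thesis using a by (simp add: field_simps)
  qed
  finally show ?thesis unfolding M_def c_def L_def by simp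
qed

text \<open>With \<open>N\<close> near \<open>sqrt n\<close> the choice of \<open>l\<close> makes
  \<open>l\<close> of order \<open>sqrt (ln n / n)\<close>, so that the cubic errors vanish; the
  threshold is about \<open>(ln N) / (4 l)\<close>, and \<open>1/6\<close> is a convenient number
  below the limiting constant \<open>1 / (4 sqrt 2)\<close>.\<close>

lemma block_max_lower:
  assumes Y: "bmeas Y" "finite_range P Y" "(\<integral>y. Y y \<partial>S) = 0"
    and v: "v = (\<integral>y. (Y y)\<^sup>2 \<partial>S)" "v > 0"
  shows "(\<lambda>n. measure S {y. \<forall>k\<in>{1..nat \<lfloor>sqrt n\<rfloor>}. 
      (\<Sum>i<n. cos (2 * pi * real k * real i / real n) * Y (shift (i * P) y)) \<le> 1/6 * sqrt (real n * v * ln n)}) \<longlonglongrightarrow> 0"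
proof -
  obtain B where B: "B > 0" "\<And>y. \<bar>Y y\<bar> \<le> B" using Y(1) bmeas_bound by blast
  define E where "E n = 48 * B ^ 3 / sqrt v ^ 3 * (real n * sqrt (ln n / n) ^ 3)" for n :: nat
  have E0: "E \<longlonglongrightarrow> 0"
  proof -
    have "(\<lambda>n. real n * sqrt (ln n / n) ^ 3) \<longlonglongrightarrow> 0" by real_asymp
    then show ?thesis unfolding E_def by (rule tendsto_mult_right_zero)
  qed
  have ev1: "\<forall>\<^sub>F n in sequentially. E n < 1" using E0 by (rule order_tendstoD) simp
  have ev2: "\<forall>\<^sub>F n in sequentially. 4 * B / sqrt v * sqrt (ln (real n) / n) < 1"
  proof -
    have "(\<lambda>n. sqrt (ln (real n) / n)) \<longlonglongrightarrow> 0" by real_asymp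
    then have "(\<lambda>n. 4 * B / sqrt v * sqrt (ln (real n) / n)) \<longlonglongrightarrow> 0" by (rule tendsto_mult_right_zero)
    then show ?thesis by (rule order_tendstoD) simp
  qed
  have ev3: "\<forall>\<^sub>F n in sequentially. 49/100 * ln (real n) \<le> ln (sqrt (real n) - 1)" by real_asymp
  have ev4: "\<forall>\<^sub>F n in sequentially. 118/1000 * ln (real n) \<le> 49/100 * ln (real n) / 4 - 1 - ln 2" by real_asymp
  have ev5: "\<forall>\<^sub>F n in sequentially. n \<ge> (9::nat)" by (rule eventually_ge_at_top)
  let ?bad = "\<lambda>n. {y. \<forall>k\<in>{1..nat \<lfloor>sqrt n\<rfloor>}. 
      (\<Sum>i<n. cos (2 * pi * real k * real i / real n) * Y (shift (i * P) y)) \<le> 1/6 * sqrt (real n * v * ln n)}"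
  have "\<forall>\<^sub>F n in sequentially. measure S (?bad n) \<le> 4 * (exp (3 * E n) * (1 + exp (- (49/200) * ln n)) - 1)"
    using ev1 ev2 ev3 ev4 ev5
  proof eventually_elim
    case (elim n)
    define N where "N = nat \<lfloor>sqrt n\<rfloor>"
    define l where "l = sqrt (ln N / (real n * v))"
    have s3: "sqrt n \<ge> 3" using elim(5) by (intro real_le_rsqrt) simp
    have N1: "real N \<le> sqrt n" "sqrt n - 1 < real N" using s3 by (auto simp: N_def)
    have N2: "2 \<le> N" using N1 s3 by linarith
    have N3: "2 * N < n"
    proof -
      have "2 * real N \<le> 2 * sqrt n" using N1 by simp
      also have "\<dots> < sqrt n * sqrt n" by (rule mult_strict_right_mono) (use s3 in linarith)+
      finally show ?thesis by simp
    qed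
    have lnn: "ln (real n) > 0" using elim(5) by simp
    have lnN: "ln N \<le> 1/2 * ln n" "49/100 * ln n \<le> ln N"
    proof -
      have "ln N \<le> ln (sqrt n)" using N1 N2 elim(5) by (subst ln_le_cancel_iff) auto
      then show "ln N \<le> 1/2 * ln n" using elim(5) by (simp add: ln_sqrt)
      have "ln (sqrt n - 1) \<le> ln N" 
        by (subst ln_le_cancel_iff) (use N1 s3 in linarith)+
      then show "49/100 * ln n \<le> ln N" using elim(3) by linarith
    qed
    have ll: "l \<le> sqrt (ln n / n) / sqrt v"
    proof -
      have "ln N / (real n * v) \<le> ln n / (real n * v)" using lnN lnn v elim(5) by (intro divide_right_mono) auto
      then have "l \<le> sqrt (ln n / (real n * v))" unfolding l_def by simp
      also have "\<dots> = sqrt (ln n / n) / sqrt v" by (simp add: real_sqrt_divide real_sqrt_mult)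
      finally show ?thesis .
    qed
    have l0: "0 \<le> l" using N2 v by (simp add: l_def)
    have "measure S (?bad n) \<le> 4 * (exp (3 * E n) * (1 + exp (- ln N / 2)) - 1)"
      unfolding N_def[symmetric]
    proof (rule block_max_second_moment[OF Y B(2,1) v N2 N3 l_def])
      have "4 * l * B \<le> 4 * (sqrt (ln n / n) / sqrt v) * B" using ll B by (intro mult_right_mono mult_left_mono) auto
      also have "\<dots> = 4 * B / sqrt v * sqrt (ln n / n)" by simp
      finally show "4 * l * B \<le> 1" using elim(2) by linarith
      have "l ^ 3 \<le> (sqrt (ln n / n) / sqrt v) ^ 3" by (intro power_mono ll l0)
      then have "48 * B ^ 3 * l ^ 3 * n \<le> 48 * B ^ 3 * (sqrt (ln n / n) / sqrt v) ^ 3 * n"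
        using B by (intro mult_right_mono mult_left_mono) auto
      also have "\<dots> = E n" by (simp add: E_def power_divide)
      finally show "48 * B ^ 3 * l ^ 3 * n \<le> E n" .
      have "l * (1/6 * sqrt (real n * v * ln n)) = 1/6 * sqrt (ln N * ln n)"
      proof -
        have "l * sqrt (real n * v * ln n) = sqrt ((ln N / (real n * v)) * (real n * v * ln n))"
          unfolding l_def by (simp only: real_sqrt_mult)
        also have "(ln N / (real n * v)) * (real n * v * ln n) = ln N * ln n" using v elim(5) by simp
        finally show ?thesis by simp
      qed
      also have "\<dots> \<le> 1/6 * (708/1000 * ln n)"
      proof (intro mult_left_mono real_le_lsqrt)
        have "ln N * ln n \<le> 1/2 * ln n * ln n" using lnN lnn by (intro mult_right_mono) auto
        also have "\<dots> \<le> (708/1000)\<^sup>2 * (ln n * ln n)" using lnn by (simp add: power2_eq_square)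
        finally show "ln N * ln n \<le> (708/1000 * ln n)\<^sup>2" by (simp add: power2_eq_square)
      qed (use lnn in auto)
      also have "\<dots> \<le> ln N / 4 - E n - ln 2" using elim(1,4) lnN by linarith
      finally show "l * (1/6 * sqrt (real n * v * ln n)) \<le> ln N / 4 - E n - ln 2" .
    qed
    also have "\<dots> \<le> 4 * (exp (3 * E n) * (1 + exp (- (49/200) * ln n)) - 1)"
      using lnN by simp
    finally show ?case .
  qed
  moreover have "(\<lambda>n. 4 * (exp (3 * E n) * (1 + exp (- (49/200) * ln (real n))) - 1)) \<longlonglongrightarrow> 4 * (exp (3 * 0) * (1 + 0) - 1)"
  proof (intro tendsto_intros E0)
    show "(\<lambda>n. exp (- (49/200) * ln (real n))) \<longlonglongrightarrow> 0" by real_asymp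
  qed
  then have "(\<lambda>n. 4 * (exp (3 * E n) * (1 + exp (- (49/200) * ln (real n))) - 1)) \<longlonglongrightarrow> 0" by simp
  ultimately show ?thesis
    by (rule tendsto_sandwich[OF _ _ tendsto_const, rotated]) (auto simp: measure_nonneg)
qed

end

section \<open>Reduction to independent blocks\<close>

lemma summation_by_parts:
  fixes w a :: "nat \<Rightarrow> real"
  shows "(\<Sum>i<T. w i * (a (Suc i) - a i)) = w T * a T - w 0 * a 0 - (\<Sum>i<T. (w (Suc i) - w i) * a (Suc i))"
  by (induction T) (auto simp: algebra_simps)

text \<open>Abel summation moves a shift by one step from the sequence to the weights, which change by at
  most \<open>\<delta>\<close> per step.\<close>

lemma slowly_varying_shift_bound:
  fixes w a :: "nat \<Rightarrow> real"
  assumes a: "\<And>i. \<bar>a i\<bar> \<le> C" and w: "\<And>i. \<bar>w i\<bar> \<le> 1" "\<And>i. \<bar>w (Suc i) - w i\<bar> \<le> \<delta>"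
  shows "\<bar>(\<Sum>i<T. w i * a (i + j)) - (\<Sum>i<T. w i * a i)\<bar> \<le> real j * (C * (2 + real T * \<delta>))"
proof (induction j)
  case (Suc j)
  have C: "0 \<le> C" using a[of 0] abs_ge_zero[of "a 0"] by linarith
  have "(\<Sum>i<T. w i * a (i + Suc j)) - (\<Sum>i<T. w i * a (i + j)) = (\<Sum>i<T. w i * (a (Suc i + j) - a (i + j)))"
    by (simp add: sum_subtractf right_diff_distrib)
  also have "\<dots> = w T * a (T + j) - w 0 * a j - (\<Sum>i<T. (w (Suc i) - w i) * a (Suc i + j))"
    using summation_by_parts[of w "\<lambda>i. a (i + j)" T] by simp
  finally have eq: "(\<Sum>i<T. w i * a (i + Suc j)) - (\<Sum>i<T. w i * a (i + j)) = \<dots>" .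
  have 1: "\<bar>w T * a (T + j)\<bar> \<le> C" "\<bar>w 0 * a j\<bar> \<le> C"
    unfolding abs_mult using mult_mono[OF w(1) a] C by auto
  have "\<bar>\<Sum>i<T. (w (Suc i) - w i) * a (Suc i + j)\<bar> \<le> (\<Sum>i<T. \<delta> * C)"
  proof (rule order_trans[OF sum_abs], rule sum_mono)
    fix i
    show "\<bar>(w (Suc i) - w i) * a (Suc i + j)\<bar> \<le> \<delta> * C"
      unfolding abs_mult by (rule mult_mono[OF w(2) a order_trans[OF abs_ge_zero w(2)] abs_ge_zero])
  qed
  then have 2: "\<bar>\<Sum>i<T. (w (Suc i) - w i) * a (Suc i + j)\<bar> \<le> C * (real T * \<delta>)" by (simp add: mult.commute mult.left_commute)
  have "C * (2 + real T * \<delta>) = C + C + C * (real T * \<delta>)" by (simp add: algebra_simps)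
  then have "\<bar>(\<Sum>i<T. w i * a (i + Suc j)) - (\<Sum>i<T. w i * a (i + j))\<bar> \<le> C * (2 + real T * \<delta>)"
    unfolding eq using 1 2 by linarith
  moreover have "real (Suc j) * (C * (2 + real T * \<delta>)) = real j * (C * (2 + real T * \<delta>)) + C * (2 + real T * \<delta>)"
    by (simp add: algebra_simps)
  ultimately show ?case using Suc by linarith
qed simp

text \<open>Time is cut into \<open>n\<close> blocks of length \<open>P\<close>. In each block the first
  \<open>L\<close> terms keep the weight of the starting point of the block, the remaining terms
  form the gaps, and an incomplete last block is dropped.\<close>

lemma block_decomposition_error:
  fixes w a :: "nat \<Rightarrow> real"
  assumes a: "\<And>i. \<bar>a i\<bar> \<le> C" and w: "\<And>i. \<bar>w i\<bar> \<le> 1" "\<And>i. \<bar>w (Suc i) - w i\<bar> \<le> \<delta>"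
    and L: "L \<le> P" and T: "n * P \<le> T" "T \<le> n * P + P"
  shows "\<bar>(\<Sum>i<T. w i * a i) - (\<Sum>b<n. w (b * P) * (\<Sum>u<L. a (u + b * P))) 
      - (\<Sum>i<n * P. (w i * of_bool (L \<le> i mod P)) * a i)\<bar> \<le> real P * C + real (n * P) * (real P * \<delta> * C)"
proof -
  have C: "0 \<le> C" using a[of 0] abs_ge_zero[of "a 0"] by linarith
  have d: "0 \<le> \<delta>" using w(2)[of 0] abs_ge_zero[of "w (Suc 0) - w 0"] by linarith
  have lip: "\<bar>w (i + u) - w i\<bar> \<le> real u * \<delta>" for i u
  proof (induction u)
    case (Suc u)
    have "\<bar>w (i + Suc u) - w i\<bar> \<le> \<bar>w (Suc (i + u)) - w (i + u)\<bar> + \<bar>w (i + u) - w i\<bar>" by simp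
    then show ?case using Suc w(2)[of "i + u"] by (simp add: algebra_simps)
  qed simp
  have blocks: "(\<Sum>i<n * P. f i) = (\<Sum>b<n. \<Sum>u<P. f (u + b * P))" for f :: "nat \<Rightarrow> real"
  proof -
    have "sum f {b * P..<b * P + P} = (\<Sum>u<P. f (u + b * P))" for b
      using sum.shift_bounds_nat_ivl[of f 0 "b * P" P] by (simp add: atLeast0LessThan add.commute)
    then show ?thesis using sum.nat_group[of f P n] by simp
  qed
  have "(\<Sum>i<T. w i * a i) = (\<Sum>i<n * P. w i * a i) + (\<Sum>i\<in>{n * P..<T}. w i * a i)"
    using T(1) by (metis atLeast0LessThan sum.atLeastLessThan_concat zero_le)
  moreover have "(\<Sum>i<n * P. w i * a i) - (\<Sum>i<n * P. (w i * of_bool (L \<le> i mod P)) * a i) = (\<Sum>i<n * P. w i * of_bool (i mod P < L) * a i)"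
    unfolding sum_subtractf[symmetric] by (intro sum.cong) (auto simp: not_le)
  moreover have "(\<Sum>i<n * P. w i * of_bool (i mod P < L) * a i) = (\<Sum>b<n. \<Sum>u<L. w (u + b * P) * a (u + b * P))"
  proof -
    have "(\<Sum>u<P. w (u + b * P) * of_bool ((u + b * P) mod P < L) * a (u + b * P)) = (\<Sum>u<L. w (u + b * P) * a (u + b * P))" for b
    proof -
      have "(\<Sum>u<P. w (u + b * P) * of_bool ((u + b * P) mod P < L) * a (u + b * P)) 
        = (\<Sum>u<P. if u < L then w (u + b * P) * a (u + b * P) else 0)" by (intro sum.cong) auto
      also have "\<dots> = (\<Sum>u\<in>{..<P} \<inter> {u. u < L}. w (u + b * P) * a (u + b * P))" by (simp add: sum.If_cases)
      also have "{..<P} \<inter> {u. u < L} = {..<L}" using L by auto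
      finally show ?thesis .
    qed
    then show ?thesis unfolding blocks by simp
  qed
  ultimately have eq: "(\<Sum>i<T. w i * a i) - (\<Sum>b<n. w (b * P) * (\<Sum>u<L. a (u + b * P))) 
      - (\<Sum>i<n * P. (w i * of_bool (L \<le> i mod P)) * a i)
    = (\<Sum>i\<in>{n * P..<T}. w i * a i) + (\<Sum>b<n. \<Sum>u<L. (w (u + b * P) - w (b * P)) * a (u + b * P))"
    by (simp add: left_diff_distrib sum_subtractf sum_distrib_left)
  have wa: "\<bar>w i * a i\<bar> \<le> C" for i unfolding abs_mult using mult_mono[OF w(1) a, of i i] C by auto
  have "\<bar>\<Sum>i\<in>{n * P..<T}. w i * a i\<bar> \<le> (\<Sum>i\<in>{n * P..<T}. C)"
    by (rule order_trans[OF sum_abs]) (intro sum_mono wa)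
  also have "\<dots> = real (T - n * P) * C" by simp
  also have "\<dots> \<le> real P * C" using T(2) C by (intro mult_right_mono) auto
  finally have e1: "\<bar>\<Sum>i\<in>{n * P..<T}. w i * a i\<bar> \<le> real P * C" .
  have "\<bar>\<Sum>b<n. \<Sum>u<L. (w (u + b * P) - w (b * P)) * a (u + b * P)\<bar> \<le> (\<Sum>b<n. \<Sum>u<L. real P * \<delta> * C)"
  proof (rule order_trans[OF sum_abs], rule sum_mono, rule order_trans[OF sum_abs], rule sum_mono)
    fix b u assume "u \<in> {..<L}"
    then have "real u * \<delta> \<le> real P * \<delta>" using L d by (intro mult_right_mono) auto
    then have "\<bar>w (u + b * P) - w (b * P)\<bar> \<le> real P * \<delta>" using lip[of "b * P" u] by (simp add: add.commute)
    then show "\<bar>(w (u + b * P) - w (b * P)) * a (u + b * P)\<bar> \<le> real P * \<delta> * C"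
      unfolding abs_mult using a[of "u + b * P"] by (intro mult_mono) (use d in auto)
  qed
  also have "\<dots> = real (n * L) * (real P * \<delta> * C)" by simp
  also have "\<dots> \<le> real (n * P) * (real P * \<delta> * C)"
  proof (rule mult_right_mono)
    show "real (n * L) \<le> real (n * P)" using L by (simp only: of_nat_le_iff mult_le_mono2)
  qed (use C d in simp)
  finally have e2: "\<bar>\<Sum>b<n. \<Sum>u<L. (w (u + b * P) - w (b * P)) * a (u + b * P)\<bar> \<le> \<dots>" .
  show ?thesis unfolding eq using e1 e2 by linarith
qed

context innovation_space
begin

text \<open>Collecting all projections at one time gives a martingale difference with the same sums up to
  boundary terms.\<close>

definition mdiff :: "((nat \<Rightarrow> 'b) \<Rightarrow> real) \<Rightarrow> nat \<Rightarrow> (nat \<Rightarrow> 'b) \<Rightarrow> real" where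
  "mdiff q K y = (\<Sum>j<K. mpart q j y)"

lemma bmeas_mdiff: "bmeas q \<Longrightarrow> bmeas (mdiff q K)"
  unfolding mdiff_def by (intro bmeas_sum bmeas_mpart)

lemma avg_mdiff: "bmeas q \<Longrightarrow> avg (mdiff q K) = (\<lambda>_. 0)"
  unfolding mdiff_def by (subst avg_sum) (simp_all add: bmeas_mpart avg_mpart)

lemma finite_range_mdiff:
  fixes q :: "(nat \<Rightarrow> 'b) \<Rightarrow> real"
  assumes "finite_range K q" shows "finite_range (Suc K) (mdiff q K)"
  unfolding finite_range_def mdiff_def
proof (intro allI impI sum.cong refl)
  fix y z :: "nat \<Rightarrow> 'b" and j assume "\<forall>i<Suc K. y i = z i"
  then show "mpart q j y = mpart q j z"
    using finite_range_mpart[OF assms, of j] unfolding finite_range_def by blast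
qed

text \<open>In the martingale decomposition the \<open>j\<close>-th projection appears with a delay of
  \<open>j\<close> steps; slowly varying weights do not notice the delay.\<close>

lemma martingale_approximation:
  assumes q: "bmeas q" "finite_range K q" "(\<integral>y. q y \<partial>S) = 0"
  obtains C where "C \<ge> 0" 
    "\<And>T w \<delta> y. (\<And>i. \<bar>w i\<bar> \<le> 1) \<Longrightarrow> (\<And>i. \<bar>w (Suc i) - w i\<bar> \<le> \<delta>) \<Longrightarrow> 
      \<bar>(\<Sum>i<T. w i * q (shift i y)) - (\<Sum>i<T. w i * mdiff q K (shift i y))\<bar> \<le> C * (2 + real T * \<delta>)"
proof -
  have "\<forall>j. \<exists>B>0. \<forall>y. \<bar>mpart q j y\<bar> \<le> B"
  proof
    fix j
    obtain B where "B > 0" "\<And>y. \<bar>mpart q j y\<bar> \<le> B" using bmeas_bound[OF bmeas_mpart[OF q(1), of j]] by blast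
    then show "\<exists>B>0. \<forall>y. \<bar>mpart q j y\<bar> \<le> B" by blast
  qed
  from choice[OF this] obtain B where B: "\<And>j. B j > (0::real)" "\<And>j y. \<bar>mpart q j y\<bar> \<le> B j" by blast
  define C where "C = (\<Sum>j<K. real j * B j)"
  have "\<bar>(\<Sum>i<T. w i * q (shift i y)) - (\<Sum>i<T. w i * mdiff q K (shift i y))\<bar> \<le> C * (2 + real T * \<delta>)"
    if w: "\<And>i. \<bar>w i\<bar> \<le> 1" "\<And>i. \<bar>w (Suc i) - w i\<bar> \<le> \<delta>" for T w \<delta> y
  proof -
    define h where "h j i = mpart q j (shift i y)" for j i
    have "(\<Sum>i<T. w i * q (shift i y)) = (\<Sum>i<T. w i * (\<Sum>j<K. mpart q j (shift j (shift i y))))"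
      by (intro sum.cong refl arg_cong2[where f = "(*)"] martingale_decomposition q)
    also have "\<dots> = (\<Sum>j<K. \<Sum>i<T. w i * h j (i + j))"
      unfolding sum_distrib_left h_def by (subst sum.swap) simp
    finally have 1: "(\<Sum>i<T. w i * q (shift i y)) = \<dots>" .
    have 2: "(\<Sum>i<T. w i * mdiff q K (shift i y)) = (\<Sum>j<K. \<Sum>i<T. w i * h j i)"
      unfolding mdiff_def sum_distrib_left h_def by (rule sum.swap)
    have "\<bar>(\<Sum>i<T. w i * h j (i + j)) - (\<Sum>i<T. w i * h j i)\<bar> \<le> real j * (B j * (2 + real T * \<delta>))" for j
      by (rule slowly_varying_shift_bound[where w = w and \<delta> = \<delta> and a = "h j" for j, OF _ w]) (simp add: h_def B)
    then have "(\<Sum>j<K. \<bar>(\<Sum>i<T. w i * h j (i + j)) - (\<Sum>i<T. w i * h j i)\<bar>) \<le> (\<Sum>j<K. real j * (B j * (2 + real T * \<delta>)))"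
      by (intro sum_mono)
    also have "\<dots> = C * (2 + real T * \<delta>)" by (simp add: C_def sum_distrib_right mult.assoc)
    finally have 3: "(\<Sum>j<K. \<bar>(\<Sum>i<T. w i * h j (i + j)) - (\<Sum>i<T. w i * h j i)\<bar>) \<le> C * (2 + real T * \<delta>)" .
    have "(\<Sum>i<T. w i * q (shift i y)) - (\<Sum>i<T. w i * mdiff q K (shift i y))
        = (\<Sum>j<K. (\<Sum>i<T. w i * h j (i + j)) - (\<Sum>i<T. w i * h j i))"
      by (simp only: 1 2 sum_subtractf)
    then show ?thesis using order_trans[OF sum_abs 3] by simp
  qed
  moreover have "C \<ge> 0" unfolding C_def by (intro sum_nonneg mult_nonneg_nonneg) (use less_imp_le[OF B(1)] in auto)
  ultimately show ?thesis using that by blast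
qed

end

text \<open>The elementary asymptotics behind the choice of block lengths: losing one hundredth of every
  block costs at most one tenth of \<open>T ln T\<close>, and errors of order \<open>sqrt
  T\<close> are negligible.\<close>

lemma block_asymptotics:
  assumes P: "0 < P" and L: "99/100 * real P \<le> real L" and v: "(v::real) > 0"
  shows "\<forall>\<^sub>F T in sequentially. T \<ge> 3 \<and> T div P > 0 \<and> nat \<lfloor>sqrt (real (T div P))\<rfloor> \<ge> 1 \<and> 2 * nat \<lfloor>sqrt (real (T div P))\<rfloor> \<le> T
    \<and> 9/10 * (real T * ln T) \<le> real (T div P) * real L * ln (real (T div P))
    \<and> C * (1 + sqrt T) \<le> v * sqrt (real T * ln T)"
proof -
  define p where "p = real P"
  have p: "p > 0" using P by (simp add: p_def)
  have 1: "\<forall>\<^sub>F T in sequentially. 9/10 * (real T * ln T) \<le> 99/100 * ((real T - p) * ln ((real T - p) / p))"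
    using p by real_asymp
  have "(\<lambda>T. (1 + sqrt (real T)) / sqrt (real T * ln T)) \<longlonglongrightarrow> 0" by real_asymp
  then have 2: "\<forall>\<^sub>F T in sequentially. (1 + sqrt (real T)) / sqrt (real T * ln T) < v / (\<bar>C\<bar> + 1)"
    by (rule order_tendstoD) (use v in simp)
  have 3: "\<forall>\<^sub>F T in sequentially. T \<ge> 4 * P + 4" by (rule eventually_ge_at_top)
  from 1 2 3 show ?thesis
  proof eventually_elim
    case (elim T)
    define n where "n = T div P"
    have np: "n * P \<le> T" "T < n * P + P" 
      unfolding n_def using dividend_less_div_times[OF P, of T] by (simp_all add: add.commute)
    have n4: "4 \<le> n"
    proof (rule ccontr)
      assume "\<not> 4 \<le> n" then have "n * P \<le> 3 * P" by simp
      then show False using np elim(3) by linarith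
    qed
    have nT: "n \<le> T" by (simp add: n_def)
    have sq: "1 \<le> sqrt (real n)" "sqrt (real n) \<le> real n / 2"
    proof -
      show "1 \<le> sqrt (real n)" using n4 by simp
      have "4 * real n \<le> real n * real n" using n4 by (intro mult_right_mono) auto
      then show "sqrt (real n) \<le> real n / 2" by (intro real_le_lsqrt) (auto simp: power2_eq_square)
    qed
    have N: "1 \<le> nat \<lfloor>sqrt (real n)\<rfloor>" using sq(1) by (simp add: le_nat_iff)
    have "2 * real (nat \<lfloor>sqrt (real n)\<rfloor>) \<le> 2 * sqrt (real n)" by simp
    also have "\<dots> \<le> real T" using sq(2) nT by simp
    finally have N2: "2 * nat \<lfloor>sqrt (real n)\<rfloor> \<le> T" by linarith
    have npr: "real n * p > real T - p" 
      using np(2) of_nat_less_iff[of T "n * P + P", where 'a = real] by (simp add: p_def)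
    have Tp: "real T - p \<ge> p" using elim(3) by (simp add: p_def)
    have "99/100 * ((real T - p) * ln ((real T - p) / p)) \<le> 99/100 * ((real n * p) * ln (real n))"
    proof (intro mult_left_mono mult_mono)
      show "ln ((real T - p) / p) \<le> ln (real n)" using npr Tp p n4 
        by (intro ln_mono) (auto simp: field_simps)
      show "0 \<le> ln ((real T - p) / p)" using Tp p by (intro ln_ge_zero) (simp add: field_simps)
    qed (use npr p Tp in auto)
    also have "\<dots> = real n * (99/100 * p) * ln (real n)" by simp
    also have "\<dots> \<le> real n * real L * ln (real n)"
      using L n4 by (intro mult_right_mono mult_left_mono) (auto simp: p_def)
    finally have A: "9/10 * (real T * ln T) \<le> real n * real L * ln (real n)" using elim(1) by linarith
    have T3: "T \<ge> 3" using elim(3) by simp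
    then have s: "sqrt (real T * ln T) > 0" by simp
    have "C * (1 + sqrt T) \<le> (\<bar>C\<bar> + 1) * (1 + sqrt T)" by (intro mult_right_mono) auto
    also have "\<dots> \<le> v * sqrt (real T * ln T)" using elim(2) s by (simp add: field_simps add_pos_nonneg)
    finally have B: "C * (1 + sqrt T) \<le> v * sqrt (real T * ln T)" .
    show ?case using A B N N2 T3 n4 unfolding n_def by auto
  qed
qed

context innovation_space
begin

lemma l2norm_le_bound:
  assumes "bmeas f" "\<And>y. \<bar>f y\<bar> \<le> C" "0 \<le> C" shows "l2norm S f \<le> C"
proof -
  have "(\<integral>y. (f y)\<^sup>2 \<partial>S) \<le> (\<integral>y. C\<^sup>2 \<partial>S)"
  proof (rule integral_mono_bmeas)
    show "(f y)\<^sup>2 \<le> C\<^sup>2" for y using power_mono[OF assms(2)[of y] abs_ge_zero, of 2] by simp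
  qed (intro bmeas_intros assms)+
  then show ?thesis unfolding l2norm_def using assms(3) by (intro real_le_lsqrt) simp_all
qed

text \<open>In the limit, \<open>sqrt n\<close> times the norm of \<open>D\<close> is the norm of the sum of
  \<open>n\<close> orthogonal differences.\<close>

lemma martingale_variance_ge:
  fixes g :: "(nat \<Rightarrow> 'b) \<Rightarrow> real"
  assumes m: "g \<in> borel_measurable S" and i: "integrable S (\<lambda>y. (g y)\<^sup>2)"
    and lim: "(\<lambda>n. l2norm S (\<lambda>y. \<Sum>i<n. g (shift i y)) / sqrt n) \<longlonglongrightarrow> r"
    and q: "bmeas q" and D: "bmeas D" "avg D = (\<lambda>_. 0)"
    and C: "C \<ge> 0" "\<And>T y. \<bar>(\<Sum>i<T. q (shift i y)) - (\<Sum>i<T. D (shift i y))\<bar> \<le> C"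
    and gq: "\<And>n. l2norm S (\<lambda>y. \<Sum>i<n. g (shift i y) - q (shift i y)) \<le> \<eta> * sqrt n"
  shows "r \<le> \<eta> + l2norm S D"
proof -
  have "l2norm S (\<lambda>y. \<Sum>i<n. g (shift i y)) / sqrt n \<le> \<eta> + l2norm S D + C / sqrt n" if n: "n > 0" for n
  proof -
    define F1 where "F1 y = (\<Sum>i<n. g (shift i y) - q (shift i y))" for y
    define F2 where "F2 y = (\<Sum>i<n. q (shift i y)) - (\<Sum>i<n. D (shift i y))" for y
    define F3 where "F3 y = (\<Sum>i<n. D (shift i y))" for y
    have b: "bmeas F2" "bmeas F3" unfolding F2_def F3_def by (intro bmeas_intros q D)+
    have mq: "(\<lambda>y. g y - q y) \<in> borel_measurable S" using m q by auto
    have iq: "integrable S (\<lambda>y. (g y - q y)\<^sup>2)"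
      by (intro integrable_square_diff m i bmeasD integrable_bmeas bmeas_power q)
    have m1: "F1 \<in> borel_measurable S"
      unfolding F1_def using measurable_compose[OF measurable_shift mq] by (intro borel_measurable_sum) simp
    have i1: "integrable S (\<lambda>y. (F1 y)\<^sup>2)" unfolding F1_def using l2norm_sum_shift(1)[OF mq iq, of n] by simp
    have b23: "bmeas (\<lambda>y. F2 y + F3 y)" by (intro bmeas_add b)
    have "l2norm S (\<lambda>y. \<Sum>i<n. g (shift i y)) = l2norm S (\<lambda>y. F1 y + (F2 y + F3 y))"
      by (simp add: F1_def F2_def F3_def sum_subtractf)
    also have "\<dots> \<le> l2norm S F1 + l2norm S (\<lambda>y. F2 y + F3 y)"
      by (rule l2norm_triangle[OF m1 bmeasD[OF b23] i1 integrable_bmeas[OF bmeas_power[OF b23]]])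
    finally have 1: "l2norm S (\<lambda>y. \<Sum>i<n. g (shift i y)) \<le> l2norm S F1 + l2norm S (\<lambda>y. F2 y + F3 y)" .
    have 2: "l2norm S (\<lambda>y. F2 y + F3 y) \<le> l2norm S F2 + l2norm S F3"
      by (rule l2norm_triangle[OF bmeasD[OF b(1)] bmeasD[OF b(2)] integrable_bmeas[OF bmeas_power[OF b(1)]] integrable_bmeas[OF bmeas_power[OF b(2)]]])
    have 3: "l2norm S F1 \<le> \<eta> * sqrt n" using gq[of n] unfolding F1_def .
    have 4: "l2norm S F2 \<le> C" using C by (intro l2norm_le_bound b) (simp_all add: F2_def)
    have 5: "l2norm S F3 = sqrt n * l2norm S D"
      using l2norm_martingale_sum[OF D, of "\<lambda>_. 1" n] unfolding l2norm_def[of S F3] F3_def by (simp add: real_sqrt_mult)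
    have "l2norm S (\<lambda>y. \<Sum>i<n. g (shift i y)) \<le> (\<eta> + l2norm S D) * sqrt n + C"
      using 1 2 3 4 5 by (simp add: algebra_simps)
    then have "l2norm S (\<lambda>y. \<Sum>i<n. g (shift i y)) / sqrt n \<le> ((\<eta> + l2norm S D) * sqrt n + C) / sqrt n"
      by (rule divide_right_mono) simp
    then show ?thesis using n by (simp add: add_divide_distrib)
  qed
  then have ev: "\<forall>\<^sub>F n in sequentially. l2norm S (\<lambda>y. \<Sum>i<n. g (shift i y)) / sqrt n \<le> \<eta> + l2norm S D + C / sqrt n"
    by (rule eventually_mono[OF eventually_gt_at_top[of 0]])
  have "(\<lambda>n. C / sqrt (real n)) \<longlonglongrightarrow> 0" by real_asymp
  from tendsto_add[OF tendsto_const this, of "\<eta> + l2norm S D"]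
  have "(\<lambda>n. \<eta> + l2norm S D + C / sqrt (real n)) \<longlonglongrightarrow> \<eta> + l2norm S D" by simp
  from tendsto_le[OF _ this lim ev] show ?thesis by simp
qed

text \<open>The gaps carry only the fraction \<open>(P - L) / P\<close> of the variance.\<close>

lemma gap_bound:
  assumes D: "bmeas D" "avg D = (\<lambda>_. 0)" and L: "L \<le> P" "0 < P" and N: "1 \<le> N" and w: "\<And>k i. \<bar>w k i\<bar> \<le> 1"
    and c: "c > 0"
  shows "measure S {y. c \<le> maxform {1..N} (n * P) (\<lambda>k i. w k i * of_bool (L \<le> i mod P)) D y}
    \<le> 2 * sqrt (ln (2 * real N) * (real n * real (P - L))) * l2norm S D / c"
proof -
  have A: "finite {1..N}" "{1..N} \<noteq> {}" using N by auto
  have cnt: "(\<Sum>i<n * P. (of_bool (L \<le> i mod P) :: real)\<^sup>2) = real n * real (P - L)"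
  proof -
    have "(\<Sum>i\<in>{b * P..<b * P + P}. (of_bool (L \<le> i mod P) :: real)\<^sup>2) = real (P - L)" for b
    proof -
      have "(\<Sum>i\<in>{b * P..<b * P + P}. (of_bool (L \<le> i mod P) :: real)\<^sup>2) = (\<Sum>u<P. (of_bool (L \<le> (u + b * P) mod P) :: real)\<^sup>2)"
        using sum.shift_bounds_nat_ivl[of "\<lambda>i. (of_bool (L \<le> i mod P) :: real)\<^sup>2" 0 "b * P" P] by (simp add: atLeast0LessThan add.commute)
      also have "\<dots> = (\<Sum>u<P. if L \<le> u then 1 else 0)" by (intro sum.cong) auto
      also have "\<dots> = real (card ({..<P} \<inter> {u. L \<le> u}))" by (simp add: sum.If_cases)
      also have "{..<P} \<inter> {u. L \<le> u} = {L..<P}" by auto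
      finally show ?thesis by simp
    qed
    then show ?thesis using sum.nat_group[of "\<lambda>i. (of_bool (L \<le> i mod P) :: real)\<^sup>2" P n] by simp
  qed
  let ?w = "\<lambda>k i. w k i * of_bool (L \<le> i mod P)"
  have "measure S {y. c \<le> maxform {1..N} (n * P) ?w D y} \<le> (\<integral>y. maxform {1..N} (n * P) ?w D y \<partial>S) / c"
    by (rule markov[OF integrable_bmeas[OF bmeas_maxform[OF A D(1)]] maxform_nonneg[OF A] c])
  also have "(\<integral>y. maxform {1..N} (n * P) ?w D y \<partial>S) \<le> 2 * sqrt (ln (2 * real (card {1..N})) * (\<Sum>i<n * P. (of_bool (L \<le> i mod P))\<^sup>2)) * l2norm S D"
    by (rule expectation_maxform_martingale[OF A D]) (use w in \<open>auto simp: abs_mult\<close>)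
  finally show ?thesis using c unfolding cnt by (simp add: divide_right_mono)
qed

text \<open>The cosine with frequency \<open>\<theta> k\<close> takes at the start of block \<open>b\<close>
  the value of the Fourier vector of the block index; all other contributions are listed on the
  right side.\<close>

lemma maxform_lower_pointwise:
  fixes D q g :: "(nat \<Rightarrow> 'b) \<Rightarrow> real"
  assumes k: "k \<in> {1..N}" and nP: "n * P \<le> T" "T \<le> n * P + P" "n > 0" "P > 0" "L \<le> P"
    and CD: "\<And>y. \<bar>D y\<bar> \<le> CD"
    and Cq: "\<And>T w \<delta> y. (\<And>i. \<bar>w i\<bar> \<le> 1) \<Longrightarrow> (\<And>i. \<bar>w (Suc i) - w i\<bar> \<le> \<delta>) \<Longrightarrow> 
      \<bar>(\<Sum>i<T. w i * q (shift i y)) - (\<Sum>i<T. w i * D (shift i y))\<bar> \<le> Cq * (2 + real T * \<delta>)"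
  defines "\<theta> \<equiv> (\<lambda>k. 2 * pi * real k / real (n * P))"
  defines "w \<equiv> (\<lambda>k i. cos (\<theta> k * real i))"
  shows "(\<Sum>b<n. cos (2 * pi * real k * real b / real n) * (\<Sum>u<L. D (shift (u + b * P) y)))
    \<le> maxform {1..N} T w g y + maxform {1..N} T w (\<lambda>y. g y - q y) y
      + maxform {1..N} (n * P) (\<lambda>k i. w k i * of_bool (L \<le> i mod P)) D y
      + (Cq * (2 + real T * \<theta> k) + (real P * CD + real (n * P) * (real P * \<theta> k * CD)))"
proof -
  have A: "finite {1..N}" by simp
  have t0: "0 \<le> \<theta> k" by (simp add: \<theta>_def)
  have w1: "\<bar>w k i\<bar> \<le> 1" for i by (simp add: w_def)
  have w2: "\<bar>w k (Suc i) - w k i\<bar> \<le> \<theta> k" for i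
  proof -
    have "\<bar>cos x - cos z\<bar> \<le> \<bar>x - z\<bar>" for x z :: real
    proof -
      have "\<bar>cos x - cos z\<bar> = 2 * \<bar>sin ((x + z) / 2)\<bar> * \<bar>sin ((z - x) / 2)\<bar>"
        unfolding cos_diff_cos by (simp add: abs_mult)
      also have "\<dots> \<le> 2 * 1 * \<bar>(z - x) / 2\<bar>"
        by (intro mult_mono abs_sin_x_le_abs_x) auto
      finally show ?thesis by simp
    qed
    from this[of "\<theta> k * real (Suc i)" "\<theta> k * real i"] show ?thesis
      using t0 by (simp add: w_def algebra_simps)
  qed
  have wb: "w k (b * P) = cos (2 * pi * real k * real b / real n)" for b
    using nP by (simp add: w_def \<theta>_def field_simps)
  let ?B = "\<Sum>b<n. cos (2 * pi * real k * real b / real n) * (\<Sum>u<L. D (shift (u + b * P) y))"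
  let ?G = "\<Sum>i<n * P. (w k i * of_bool (L \<le> i mod P)) * D (shift i y)"
  have e1: "\<bar>(\<Sum>i<T. w k i * D (shift i y)) - ?B - ?G\<bar> \<le> real P * CD + real (n * P) * (real P * \<theta> k * CD)"
    using block_decomposition_error[where w = "w k" and a = "\<lambda>i. D (shift i y)" and C = CD and \<delta> = "\<theta> k", OF CD w1 w2 nP(5,1,2)]
    unfolding wb .
  have e2: "\<bar>(\<Sum>i<T. w k i * q (shift i y)) - (\<Sum>i<T. w k i * D (shift i y))\<bar> \<le> Cq * (2 + real T * \<theta> k)"
    by (rule Cq[of "w k" "\<theta> k" y T, OF w1 w2])
  have e3: "(\<Sum>i<T. w k i * g (shift i y)) = (\<Sum>i<T. w k i * q (shift i y)) + (\<Sum>i<T. w k i * (g (shift i y) - q (shift i y)))"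
    unfolding sum.distrib[symmetric] by (intro sum.cong refl) (simp add: algebra_simps)
  have g: "\<bar>\<Sum>i<T. w k i * g (shift i y)\<bar> \<le> maxform {1..N} T w g y"
    by (rule maxform_ge[OF A k])
  have r: "\<bar>\<Sum>i<T. w k i * (g (shift i y) - q (shift i y))\<bar> \<le> maxform {1..N} T w (\<lambda>y. g y - q y) y"
    by (rule maxform_ge[OF A k, where f = "\<lambda>y. g y - q y"])
  have G: "\<bar>?G\<bar> \<le> maxform {1..N} (n * P) (\<lambda>k i. w k i * of_bool (L \<le> i mod P)) D y"
    by (rule maxform_ge[OF A k, where w = "\<lambda>k i. w k i * of_bool (L \<le> i mod P)"])
  show ?thesis using e1 e2 e3 g r G by linarith
qed

text \<open>Let \<open>s = sqrt (T ln T)\<close>. Apart from three unlikely events the block sums reach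
  \<open>0.158 \<sigma> s\<close>, where \<open>\<sigma> \<ge> 0.9 r\<close> is the norm of the
  martingale difference, while gaps, remainder and boundary terms take away at most \<open>(0.005
  + 0.003) \<sigma> s + 0.005 r s\<close>. What is left exceeds \<open>0.12 r s\<close>.\<close>

lemma maxform_lower_bound:
  fixes g :: "(nat \<Rightarrow> 'b) \<Rightarrow> real"
  assumes m: "g \<in> borel_measurable S" and i: "integrable S (\<lambda>y. (g y)\<^sup>2)" and z: "(\<integral>y. g y \<partial>S) = 0"
    and sm: "summable (dep g)"
    and lim: "(\<lambda>n. l2norm S (\<lambda>y. \<Sum>i<n. g (shift i y)) / sqrt n) \<longlonglongrightarrow> r" and r: "r > 0"
    and e: "e > (0::real)"
  shows "\<exists>N \<theta>. \<forall>\<^sub>F T in sequentially. (1::nat) \<le> N T \<and> 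
    measure S {y. maxform {1..N T} T (\<lambda>k i. cos (\<theta> T k * real i)) g y < 3/25 * r * sqrt (real T * ln T)} \<le> e"
proof -
  \<comment> \<open>the first bound keeps the variance close to \<open>r\<^sup>2\<close>, the second makes the remainder event unlikely\<close>
  define \<eta> where "\<eta> = min (r / 10) (e * r / 600)"
  have \<eta>: "\<eta> > 0" "\<eta> \<le> r / 10" "\<eta> \<le> e * r / 600" using r e by (auto simp: \<eta>_def)
  obtain K q where q: "bmeas q" "finite_range K q" "(\<integral>y. q y \<partial>S) = 0" and dq: "\<forall>j. dep q j \<le> dep g j"
    and R: "\<forall>(A::nat set) n w. finite A \<longrightarrow> A \<noteq> {} \<longrightarrow> (\<forall>k\<in>A. \<forall>i<n. \<bar>w k i\<bar> \<le> 1) \<longrightarrow>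
         (\<integral>y. maxform A n w (\<lambda>y. g y - q y) y \<partial>S) \<le> \<eta> * sqrt (ln (2 * real (card A)) * n)"
    and R2: "\<forall>n. l2norm S (\<lambda>y. \<Sum>i<n. g (shift i y) - q (shift i y)) \<le> \<eta> * sqrt n"
    using exists_maximal_approximant[OF m i z sm \<eta>(1)] by (elim exE conjE) (rule that)
  have mq: "(\<lambda>y. g y - q y) \<in> borel_measurable S" using m q by auto
  have iq: "integrable S (\<lambda>y. g y - q y)"
    using P.expectation_abs_le_l2norm(1)[OF m i] integrable_bmeas[OF q(1)] by auto
  define D where "D = mdiff q K"
  have D: "bmeas D" "avg D = (\<lambda>_. 0)" and fD: "finite_range (Suc K) D"
    unfolding D_def by (rule bmeas_mdiff avg_mdiff finite_range_mdiff q)+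
  obtain CD where CD: "CD > 0" "\<And>y. \<bar>D y\<bar> \<le> CD" using bmeas_bound[OF D(1)] by blast
  obtain Cq where Cq0: "Cq \<ge> 0" and Cq: "\<And>T w \<delta> y. (\<And>i. \<bar>w i\<bar> \<le> 1) \<Longrightarrow> (\<And>i. \<bar>w (Suc i) - w i\<bar> \<le> \<delta>) \<Longrightarrow> 
      \<bar>(\<Sum>i<T. w i * q (shift i y)) - (\<Sum>i<T. w i * D (shift i y))\<bar> \<le> Cq * (2 + real T * \<delta>)"
    using martingale_approximation[OF q] unfolding D_def by blast
  define \<sigma> where "\<sigma> = l2norm S D"
  have "r \<le> \<eta> + \<sigma>" unfolding \<sigma>_def
  proof (rule martingale_variance_ge[OF m i lim q(1) D])
    show "\<bar>(\<Sum>i<T. q (shift i y)) - (\<Sum>i<T. D (shift i y))\<bar> \<le> 2 * Cq" for T y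
      using Cq[of "\<lambda>_. 1" 0 y T] by simp
  qed (use Cq0 R2 in auto)
  then have \<sigma>: "9/10 * r \<le> \<sigma>" "\<sigma> > 0" using \<eta> r by linarith+
  \<comment> \<open>the admitted fraction of time in gaps: Markov's inequality for the gaps gives \<open>400 sqrt \<kappa> \<le> e / 3\<close>\<close>
  define \<kappa> where "\<kappa> = min (1/100) ((e / 1200)\<^sup>2)"
  have \<kappa>: "\<kappa> > 0" "\<kappa> \<le> 1/100" "\<kappa> \<le> (e / 1200)\<^sup>2" using e by (auto simp: \<kappa>_def)
  define L where "L = nat \<lceil>real (K + 1) / \<kappa>\<rceil>"
  \<comment> \<open>the gap length \<open>K + 1\<close> is the range of \<open>D\<close>\<close>
  define P where "P = L + Suc K"
  have P: "P > 0" "L \<le> P" "P - L = Suc K" by (auto simp: P_def)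
  have "real (K + 1) / \<kappa> \<le> real L" unfolding L_def by (rule real_nat_ceiling_ge)
  then have "real (Suc K) \<le> \<kappa> * real L" using \<kappa>(1) by (simp add: field_simps)
  also have "\<dots> \<le> \<kappa> * real P" using \<kappa>(1) P(2) by simp
  finally have gapP: "real (Suc K) \<le> \<kappa> * real P" .
  also have "\<dots> \<le> 1/100 * real P" using \<kappa>(2) by (rule mult_right_mono) simp
  finally have LP: "99/100 * real P \<le> real L" unfolding P_def by simp
  have L0: "L > 0" using LP P(1) by (cases L) auto

  define Y where "Y y = (\<Sum>u<L. D (shift u y))" for y
  have Y: "bmeas Y" unfolding Y_def by (intro bmeas_intros D)
  have fY: "finite_range P Y" unfolding finite_range_def Y_def
  proof (intro allI impI sum.cong refl)
    fix y z :: "nat \<Rightarrow> 'b" and u assume yz: "\<forall>i<P. y i = z i" and "u \<in> {..<L}"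
    then have "\<forall>i<Suc K. shift u y i = shift u z i" by (auto simp: shift_def P_def)
    then show "D (shift u y) = D (shift u z)" using fD unfolding finite_range_def by blast
  qed
  have zY: "(\<integral>y. Y y \<partial>S) = 0"
  proof -
    have z: "(\<integral>y. D y \<partial>S) = 0" using integral_avg[OF D(1)] unfolding D(2) by simp
    have "(\<integral>y. Y y \<partial>S) = (\<Sum>u<L. \<integral>y. D (shift u y) \<partial>S)"
      unfolding Y_def by (intro Bochner_Integration.integral_sum integrable_bmeas bmeas_intros D)
    also have "\<dots> = 0" using integral_shift[OF bmeasD[OF D(1)]] z by simp
    finally show ?thesis .
  qed
  have vY: "real L * \<sigma>\<^sup>2 = (\<integral>y. (Y y)\<^sup>2 \<partial>S)"
    using l2norm_martingale_sum[OF D, of "\<lambda>_. 1" L] by (simp add: Y_def \<sigma>_def)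
  have vp: "real L * \<sigma>\<^sup>2 > 0" using L0 \<sigma> by simp

  define n where "n T = T div P" for T
  define N where "N T = nat \<lfloor>sqrt (real (n T))\<rfloor>" for T
  define \<theta> where "\<theta> T k = 2 * pi * real k / real (n T * P)" for T k
  define w where "w T k i = cos (\<theta> T k * real i)" for T k i
  define s where "s T = sqrt (real T * ln T)" for T :: nat
  define E1 where "E1 T = {y. \<forall>k\<in>{1..N T}. (\<Sum>b<n T. cos (2 * pi * real k * real b / real (n T)) * Y (shift (b * P) y))
     \<le> 1/6 * sqrt (real (n T) * (real L * \<sigma>\<^sup>2) * ln (n T))}" for T
  define E2 where "E2 T = {y. 1/200 * \<sigma> * s T \<le> maxform {1..N T} (n T * P) (\<lambda>k i. w T k i * of_bool (L \<le> i mod P)) D y}" for T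
  define E3 where "E3 T = {y. 1/200 * r * s T \<le> maxform {1..N T} T (w T) (\<lambda>y. g y - q y) y}" for T
  have nlim: "filterlim n sequentially sequentially"
    unfolding n_def[abs_def] filterlim_at_top
  proof
    fix Z :: nat
    show "\<forall>\<^sub>F T in sequentially. Z \<le> T div P"
      by (rule eventually_sequentiallyI[of "Z * P"]) (use P(1) in \<open>simp add: less_eq_div_iff_mult_less_eq\<close>)
  qed
  have "(\<lambda>T. measure S (E1 T)) \<longlonglongrightarrow> 0"
    using filterlim_compose[OF block_max_lower[OF Y fY zY vY vp] nlim] unfolding E1_def N_def .
  then have ev1: "\<forall>\<^sub>F T in sequentially. measure S (E1 T) < e / 3" by (rule order_tendstoD) (use e in simp)
  define C3 where "C3 = 2 * Cq + real P * CD + 4 * pi * Cq + 2 * pi * real P * CD"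
  have "\<forall>\<^sub>F T in sequentially. T \<ge> 3 \<and> n T > 0 \<and> N T \<ge> 1 \<and> 2 * N T \<le> T
    \<and> 9/10 * (real T * ln T) \<le> real (n T) * real L * ln (n T)
    \<and> C3 * (1 + sqrt T) \<le> (3/1000 * \<sigma>) * sqrt (real T * ln T)"
    unfolding n_def N_def by (rule block_asymptotics[OF P(1) LP]) (use \<sigma> in simp)
  with ev1 have "\<forall>\<^sub>F T in sequentially. 1 \<le> N T \<and> measure S {y. maxform {1..N T} T (w T) g y < 3/25 * r * s T} \<le> e"
  proof eventually_elim
    case (elim T)
    then have n0: "n T > 0" and N1: "1 \<le> N T" and N2: "2 * N T \<le> T" and T3: "T \<ge> 3" by auto
    have np: "n T * P \<le> T" "T \<le> n T * P + P" 
      unfolding n_def using P(1) less_imp_le[OF dividend_less_div_times[OF P(1), of T]] by (simp_all add: add.commute)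
    have T2: "T \<le> 2 * (n T * P)" 
    proof -
      have "1 * P \<le> n T * P" using n0 by (intro mult_le_mono1) simp
      then show ?thesis using np by linarith
    qed
    have ln: "0 < ln (real T)" using T3 by simp
    have sT: "s T > 0" using ln T3 by (simp add: s_def)
    have A: "finite {1..N T}" "{1..N T} \<noteq> {}" using N1 by auto
    have w: "\<bar>w T k i\<bar> \<le> 1" for k i by (simp add: w_def)
    have lnN: "ln (2 * real (N T)) \<le> ln (real T)" "0 \<le> ln (2 * real (N T))" using N1 N2 by auto
    have m2: "measure S (E2 T) \<le> e / 3"
    proof -
      have "measure S (E2 T) \<le> 2 * sqrt (ln (2 * real (N T)) * (real (n T) * real (P - L))) * \<sigma> / (1/200 * \<sigma> * s T)"
        unfolding E2_def \<sigma>_def[symmetric] unfolding \<sigma>_def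
        by (rule gap_bound[OF D P(2,1) N1 w]) (use \<sigma> sT in \<open>simp add: \<sigma>_def\<close>)
      also have "\<dots> = 400 * sqrt (ln (2 * real (N T)) * (real (n T) * real (P - L))) / s T" using \<sigma>(2) by simp
      also have "sqrt (ln (2 * real (N T)) * (real (n T) * real (P - L))) \<le> sqrt (ln T * ((e / 1200)\<^sup>2 * real T))"
      proof (rule real_sqrt_le_mono, rule mult_mono[OF lnN(1)])
        have "real (n T) * real (P - L) \<le> real (n T) * (\<kappa> * real P)" using gapP P(3) by (intro mult_left_mono) auto
        also have "\<dots> = \<kappa> * real (n T * P)" by simp
        also have "\<dots> \<le> (e / 1200)\<^sup>2 * real T" using \<kappa> np(1) 
          by (intro mult_mono) (simp_all only: of_nat_le_iff of_nat_0_le_iff zero_le_power2)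
        finally show "real (n T) * real (P - L) \<le> (e / 1200)\<^sup>2 * real T" .
      qed (use ln in auto)
      also have "sqrt (ln T * ((e / 1200)\<^sup>2 * real T)) = e / 1200 * s T"
        using e by (simp add: s_def real_sqrt_mult)
      finally show ?thesis using sT by (simp add: divide_right_mono field_simps)
    qed
    have m3: "measure S (E3 T) \<le> e / 3"
    proof -
      have "measure S (E3 T) \<le> (\<integral>y. maxform {1..N T} T (w T) (\<lambda>y. g y - q y) y \<partial>S) / (1/200 * r * s T)"
        unfolding E3_def by (rule markov[OF integrable_maxform(1)[OF A iq] maxform_nonneg[OF A]]) (use sT r in simp)
      also have "\<dots> \<le> (\<eta> * s T) / (1/200 * r * s T)"
      proof (rule divide_right_mono)
        have "(\<integral>y. maxform {1..N T} T (w T) (\<lambda>y. g y - q y) y \<partial>S) \<le> \<eta> * sqrt (ln (2 * real (card {1..N T})) * T)"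
          using R[rule_format, OF A, of T "w T"] w by simp
        also have "\<dots> \<le> \<eta> * sqrt (ln T * T)" 
          using \<eta>(1) lnN by (intro mult_left_mono real_sqrt_le_mono mult_right_mono) auto
        finally show "(\<integral>y. maxform {1..N T} T (w T) (\<lambda>y. g y - q y) y \<partial>S) \<le> \<eta> * s T" by (simp add: s_def mult.commute)
      qed (use sT r in simp)
      also have "\<dots> = 200 * \<eta> / r" using sT by simp
      also have "\<dots> \<le> e / 3" using \<eta>(3) r by (simp add: field_simps)
      finally show ?thesis .
    qed
    have s1: "E1 T \<in> sets S"
    proof -
      have "E1 T = space S - (\<Union>k\<in>{1..N T}. {y. 1/6 * sqrt (real (n T) * (real L * \<sigma>\<^sup>2) * ln (n T)) 
          < (\<Sum>b<n T. cos (2 * pi * real k * real b / real (n T)) * Y (shift (b * P) y))})"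
        unfolding E1_def by (auto simp: not_less)
      also have "\<dots> \<in> sets S"
        by (intro sets.compl_sets sets.finite_UN finite_atLeastAtMost sets_level bmeasD bmeas_intros Y)
      finally show ?thesis .
    qed
    have s23: "E2 T \<in> sets S" "E3 T \<in> sets S"
      unfolding E2_def E3_def by (intro sets_level borel_measurable_maxform A mq bmeasD[OF D(1)])+
    have "{y. maxform {1..N T} T (w T) g y < 3/25 * r * s T} \<subseteq> E1 T \<union> (E2 T \<union> E3 T)"
    proof (intro subsetI, rule ccontr)
      fix y assume y: "y \<in> {y. maxform {1..N T} T (w T) g y < 3/25 * r * s T}" and nb: "y \<notin> E1 T \<union> (E2 T \<union> E3 T)"
      from nb obtain k where k: "k \<in> {1..N T}" and 
        b: "1/6 * sqrt (real (n T) * (real L * \<sigma>\<^sup>2) * ln (n T)) < (\<Sum>b<n T. cos (2 * pi * real k * real b / real (n T)) * Y (shift (b * P) y))"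
        unfolding E1_def by (auto simp: not_le)
      from nb have g2: "maxform {1..N T} (n T * P) (\<lambda>k i. w T k i * of_bool (L \<le> i mod P)) D y < 1/200 * \<sigma> * s T"
        and g3: "maxform {1..N T} T (w T) (\<lambda>y. g y - q y) y < 1/200 * r * s T"
        unfolding E2_def E3_def by (auto simp: not_le)
      have "Y (shift (b * P) y) = (\<Sum>u<L. D (shift (u + b * P) y))" for b by (simp add: Y_def add.commute)
      then have main: "(\<Sum>b<n T. cos (2 * pi * real k * real b / real (n T)) * Y (shift (b * P) y))
         \<le> maxform {1..N T} T (w T) g y + maxform {1..N T} T (w T) (\<lambda>y. g y - q y) y
          + maxform {1..N T} (n T * P) (\<lambda>k i. w T k i * of_bool (L \<le> i mod P)) D y
          + (Cq * (2 + real T * \<theta> T k) + (real P * CD + real (n T * P) * (real P * \<theta> T k * CD)))"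
        using maxform_lower_pointwise[OF k np n0 P(1,2) CD(2) Cq, where g = g and y = y]
        unfolding \<theta>_def w_def by simp
      have "\<theta> T k * real (n T * P) = 2 * pi * real k" using n0 P(1) by (simp add: \<theta>_def)
      also have "\<dots> \<le> 2 * pi * sqrt T"
      proof -
        have "real k \<le> real (N T)" using k by simp
        also have "\<dots> \<le> sqrt (n T)" unfolding N_def by simp
        also have "\<dots> \<le> sqrt T" by (simp add: n_def)
        finally show ?thesis by simp
      qed
      finally have th: "\<theta> T k * real (n T * P) \<le> 2 * pi * sqrt T" .
      have t0: "\<theta> T k \<ge> 0" by (simp add: \<theta>_def)
      have "\<theta> T k * real T \<le> \<theta> T k * (2 * real (n T * P))" using t0 T2 by (intro mult_left_mono) (metis of_nat_le_iff of_nat_mult of_nat_numeral)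
      then have th2: "\<theta> T k * real T \<le> 4 * pi * sqrt T" using th by simp
      have "Cq * (2 + real T * \<theta> T k) + (real P * CD + real (n T * P) * (real P * \<theta> T k * CD))
         = 2 * Cq + Cq * (\<theta> T k * real T) + real P * CD + (real P * CD) * (\<theta> T k * real (n T * P))" by (simp add: algebra_simps)
      also have "\<dots> \<le> 2 * Cq + Cq * (4 * pi * sqrt T) + real P * CD + (real P * CD) * (2 * pi * sqrt T)"
        using Cq0 CD(1) by (intro add_mono mult_left_mono th th2) auto
      also have "\<dots> \<le> C3 * (1 + sqrt T)"
      proof -
        have "0 \<le> (2 * Cq + real P * CD) * sqrt T + (4 * pi * Cq + 2 * pi * real P * CD)"
          using Cq0 CD(1) by simp
        then show ?thesis unfolding C3_def by (simp add: algebra_simps)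
      qed
      also have "\<dots> \<le> 3/1000 * (\<sigma> * s T)" using elim by (simp add: s_def)
      finally have err: "Cq * (2 + real T * \<theta> T k) + (real P * CD + real (n T * P) * (real P * \<theta> T k * CD)) \<le> 3/1000 * (\<sigma> * s T)" .
      have "158/1000 * (\<sigma> * s T) \<le> 1/6 * sqrt (9/10) * (\<sigma> * s T)"
      proof (rule mult_right_mono)
        have "948/1000 \<le> sqrt (9/10::real)" by (rule real_le_rsqrt) (simp add: power2_eq_square)
        then show "158/1000 \<le> 1/6 * sqrt (9/10::real)" by simp
      qed (use \<sigma> sT in simp)
      also have "\<dots> = 1/6 * (sqrt (9/10 * (real T * ln T)) * \<sigma>)" by (simp only: s_def real_sqrt_mult mult_ac)
      also have "\<dots> \<le> 1/6 * (sqrt (real (n T) * real L * ln (n T)) * \<sigma>)"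
        using elim \<sigma> by (intro mult_left_mono mult_right_mono real_sqrt_le_mono) auto
      also have "\<dots> = 1/6 * sqrt (real (n T) * (real L * \<sigma>\<^sup>2) * ln (n T))" using \<sigma> by (simp add: real_sqrt_mult)
      finally have low: "158/1000 * (\<sigma> * s T) \<le> 1/6 * sqrt (real (n T) * (real L * \<sigma>\<^sup>2) * ln (n T))" .
      have rs: "9/10 * (r * s T) \<le> \<sigma> * s T" using mult_right_mono[OF \<sigma>(1), of "s T"] sT by simp
      have up: "maxform {1..N T} T (w T) g y < 3/25 * (r * s T)" using y by simp
      have "0 < r * s T" using r sT by simp
      then show False using main err low rs up b g2 g3 by linarith
    qed
    then have "measure S {y. maxform {1..N T} T (w T) g y < 3/25 * r * s T} \<le> measure S (E1 T) + measure S (E2 T \<union> E3 T)"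
      by (intro prob_cover_le s1 sets.Un s23)
    moreover have "measure S (E2 T \<union> E3 T) \<le> measure S (E2 T) + measure S (E3 T)" by (intro prob_cover_le s23 subset_refl)
    ultimately have "measure S {y. maxform {1..N T} T (w T) g y < 3/25 * r * s T} \<le> e" using m2 m3 elim(1) by linarith
    with N1 show ?case by (rule conjI)
  qed
  then show ?thesis unfolding w_def s_def by blast
qed

end

section \<open>Toeplitz matrices and periodograms\<close>

text \<open>At the \<open>2 T\<close> frequencies \<open>\<pi> k / T\<close> the lags below \<open>2
  T\<close> can be told apart. The usual \<open>T\<close> Fourier frequencies would identify the
  lag \<open>d\<close> with \<open>T - d\<close>.\<close>

lemma sum_cos_embedding:
  fixes m :: int
  assumes T: "T > 0" and m: "\<bar>m\<bar> < 2 * int T"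
  shows "(\<Sum>k<2*T. cos (pi * real k / real T * of_int m)) = (if m = 0 then 2 * real T else 0)"
proof (cases "m = 0")
  case False
  then have "\<not> int (2 * T) dvd m" using m by (auto dest: zdvd_imp_le[of _ "\<bar>m\<bar>", simplified])
  then have "(\<Sum>i<2*T. cos (2 * pi * of_int m * real i / real (2*T))) = 0"
    using T by (intro sum_cos_roots_of_unity) auto
  moreover have "(\<Sum>k<2*T. cos (pi * real k / real T * of_int m)) = (\<Sum>i<2*T. cos (2 * pi * of_int m * real i / real (2*T)))"
    by (intro sum.cong refl arg_cong[where f = cos]) (use T in \<open>simp add: field_simps\<close>)
  ultimately show ?thesis using False by presburger
qed simp

lemma sum_toeplitz_diagonals:
  fixes x G :: "nat \<Rightarrow> real"
  shows "(\<Sum>i<T. \<Sum>j<T. G (nat \<bar>int i - int j\<bar>) * x i * x j)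
    = (\<Sum>d<T. (if d = 0 then 1 else 2) * G d * (\<Sum>i<T - d. x i * x (i + d)))"
proof (induction T)
  case (Suc T)
  have L: "(\<Sum>i<Suc T. \<Sum>j<Suc T. G (nat \<bar>int i - int j\<bar>) * x i * x j)
    = (\<Sum>i<T. \<Sum>j<T. G (nat \<bar>int i - int j\<bar>) * x i * x j) + 2 * (\<Sum>i<T. G (T - i) * x i * x T) + G 0 * x T * x T"
  proof -
    have "nat \<bar>int T - int i\<bar> = T - i" "nat \<bar>int i - int T\<bar> = T - i" if "i < T" for i using that by auto
    then show ?thesis by (simp add: sum.distrib algebra_simps)
  qed
  have r: "(\<Sum>i<Suc T - d. x i * x (i + d)) = (\<Sum>i<T - d. x i * x (i + d)) + x (T - d) * x T" if "d \<le> T" for d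
    using that by (simp add: Suc_diff_le)
  have "(\<Sum>d<Suc T. (if d = 0 then 1 else 2) * G d * (\<Sum>i<Suc T - d. x i * x (i + d)))
    = (\<Sum>d<Suc T. (if d = 0 then 1 else 2) * G d * (\<Sum>i<T - d. x i * x (i + d)))
      + (\<Sum>d<Suc T. (if d = 0 then 1 else 2) * G d * (x (T - d) * x T))"
    unfolding sum.distrib[symmetric] by (intro sum.cong refl, subst r) (auto simp: algebra_simps)
  also have "(\<Sum>d<Suc T. (if d = 0 then 1 else 2) * G d * (\<Sum>i<T - d. x i * x (i + d))) 
    = (\<Sum>d<T. (if d = 0 then 1 else 2) * G d * (\<Sum>i<T - d. x i * x (i + d)))" by simp
  also have "(\<Sum>d<Suc T. (if d = 0 then 1 else 2) * G d * (x (T - d) * x T))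
    = G 0 * x T * x T + 2 * (\<Sum>d<T. G (Suc d) * (x (T - Suc d) * x T))"
    unfolding sum.lessThan_Suc_shift by (simp add: sum_distrib_left mult.assoc)
  also have "(\<Sum>d<T. G (Suc d) * (x (T - Suc d) * x T)) = (\<Sum>i<T. G (T - i) * x i * x T)"
    by (subst sum.nat_diff_reindex[symmetric]) (intro sum.cong refl, simp add: Suc_diff_Suc mult.assoc)
  finally show ?case using L Suc by simp
qed simp

text \<open>The kernel \<open>T - |i - j|\<close> is a sum of \<open>T\<close> pairs of rank one kernels,
  indicators of an initial segment and of its complement; for every pair \<open>a\<^sup>2 +
  b\<^sup>2 \<ge> (a + b)\<^sup>2 / 2\<close>.\<close>

lemma triangular_kernel:
  fixes z :: "nat \<Rightarrow> real"
  shows "real T / 2 * (\<Sum>i<T. z i)\<^sup>2 \<le> (\<Sum>i<T. \<Sum>j<T. real (T - nat \<bar>int i - int j\<bar>) * z i * z j)"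
proof -
  define a where "a k i = (of_bool (i < k) :: real)" for k i :: nat
  define b where "b k i = (of_bool (k \<le> i) :: real)" for k i :: nat
  have kernel: "real (T - nat \<bar>int i - int j\<bar>) = (\<Sum>k\<in>{1..T}. a k i * a k j + b k i * b k j)" if "i < T" "j < T" for i j
  proof -
    have "(\<Sum>k\<in>{1..T}. a k i * a k j) = (\<Sum>k\<in>{1..T}. if max i j < k then 1 else 0)"
      by (intro sum.cong) (auto simp: a_def)
    also have "\<dots> = real (card ({1..T} \<inter> {k. max i j < k}))" by (simp add: sum.If_cases)
    also have "{1..T} \<inter> {k. max i j < k} = {Suc (max i j)..T}" by auto
    finally have 1: "(\<Sum>k\<in>{1..T}. a k i * a k j) = real (T - max i j)" by simp
    have "(\<Sum>k\<in>{1..T}. b k i * b k j) = (\<Sum>k\<in>{1..T}. if k \<le> min i j then 1 else 0)"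
      by (intro sum.cong) (auto simp: b_def)
    also have "\<dots> = real (card ({1..T} \<inter> {k. k \<le> min i j}))" by (simp add: sum.If_cases)
    also have "{1..T} \<inter> {k. k \<le> min i j} = {1..min i j}" using that by auto
    finally have 2: "(\<Sum>k\<in>{1..T}. b k i * b k j) = real (min i j)" by simp
    have "T - nat \<bar>int i - int j\<bar> = (T - max i j) + min i j" using that by (auto simp: max_def min_def abs_if)
    then show ?thesis unfolding sum.distrib 1 2 by simp
  qed
  have "(\<Sum>i<T. \<Sum>j<T. real (T - nat \<bar>int i - int j\<bar>) * z i * z j)
    = (\<Sum>i<T. \<Sum>j<T. \<Sum>k\<in>{1..T}. (a k i * z i) * (a k j * z j) + (b k i * z i) * (b k j * z j))"
  proof (intro sum.cong refl)
    fix i j assume "i \<in> {..<T}" "j \<in> {..<T}"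
    then have "real (T - nat \<bar>int i - int j\<bar>) * z i * z j = (\<Sum>k\<in>{1..T}. (a k i * a k j + b k i * b k j) * z i * z j)"
      unfolding sum_distrib_right[symmetric] using kernel[of i j] by simp
    also have "\<dots> = (\<Sum>k\<in>{1..T}. (a k i * z i) * (a k j * z j) + (b k i * z i) * (b k j * z j))"
      by (intro sum.cong refl) (simp add: algebra_simps)
    finally show "real (T - nat \<bar>int i - int j\<bar>) * z i * z j = \<dots>" .
  qed
  also have "\<dots> = (\<Sum>i<T. \<Sum>k\<in>{1..T}. \<Sum>j<T. (a k i * z i) * (a k j * z j) + (b k i * z i) * (b k j * z j))"
    by (intro sum.cong refl sum.swap)
  also have "\<dots> = (\<Sum>k\<in>{1..T}. \<Sum>i<T. \<Sum>j<T. (a k i * z i) * (a k j * z j) + (b k i * z i) * (b k j * z j))"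
    by (rule sum.swap)
  also have "\<dots> = (\<Sum>k\<in>{1..T}. (\<Sum>i<T. a k i * z i)\<^sup>2 + (\<Sum>i<T. b k i * z i)\<^sup>2)"
    by (intro sum.cong refl) (simp add: power2_eq_square sum_product sum.distrib)
  also have "\<dots> \<ge> (\<Sum>k\<in>{1..T}. 1/2 * (\<Sum>i<T. z i)\<^sup>2)"
  proof (intro sum_mono)
    fix k
    have "(\<Sum>i<T. z i) = (\<Sum>i<T. a k i * z i) + (\<Sum>i<T. b k i * z i)"
      unfolding sum.distrib[symmetric] by (intro sum.cong) (auto simp: a_def b_def)
    then show "1/2 * (\<Sum>i<T. z i)\<^sup>2 \<le> (\<Sum>i<T. a k i * z i)\<^sup>2 + (\<Sum>i<T. b k i * z i)\<^sup>2"
      using sum_squares_bound[of "\<Sum>i<T. a k i * z i" "\<Sum>i<T. b k i * z i"] by (simp add: power2_sum)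
  qed
  finally show ?thesis by simp
qed

definition acov :: "nat \<Rightarrow> (nat \<Rightarrow> real) \<Rightarrow> nat \<Rightarrow> real" where
  "acov T x d = 1 / real T * (\<Sum>i<T - d. x i * x (i + d))"

definition toeplitz :: "nat \<Rightarrow> (nat \<Rightarrow> real) \<Rightarrow> real mat" where
  "toeplitz T x = Matrix.mat T T (\<lambda>(s, t). acov T x (nat \<bar>int s - int t\<bar>))"

text \<open>The bilinear form of the Toeplitz matrix, for vectors given as functions.\<close>

definition qform :: "nat \<Rightarrow> (nat \<Rightarrow> real) \<Rightarrow> (nat \<Rightarrow> real) \<Rightarrow> (nat \<Rightarrow> real) \<Rightarrow> real" where
  "qform T x v u = (\<Sum>s<T. \<Sum>t<T. acov T x (nat \<bar>int s - int t\<bar>) * v s * u t)"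

definition csum :: "nat \<Rightarrow> (nat \<Rightarrow> real) \<Rightarrow> real \<Rightarrow> real" where
  "csum T x \<theta> = (\<Sum>i<T. cos (\<theta> * real i) * x i)"

definition ssum :: "nat \<Rightarrow> (nat \<Rightarrow> real) \<Rightarrow> real \<Rightarrow> real" where
  "ssum T x \<theta> = (\<Sum>i<T. sin (\<theta> * real i) * x i)"

lemma csum_ssum:
  "csum T v \<theta> * csum T u \<theta> + ssum T v \<theta> * ssum T u \<theta> = (\<Sum>s<T. \<Sum>t<T. cos (\<theta> * of_int (int s - int t)) * v s * u t)"
  unfolding csum_def ssum_def sum_product sum.distrib[symmetric]
  by (intro sum.cong refl) (simp add: right_diff_distrib cos_diff algebra_simps)

lemma sum_periodogram_frequencies:
  assumes T: "T > 0"
  shows "(\<Sum>k<2*T. (csum T u (pi * real k / real T))\<^sup>2 + (ssum T u (pi * real k / real T))\<^sup>2) = 2 * real T * (\<Sum>s<T. (u s)\<^sup>2)"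
proof -
  let ?\<theta> = "\<lambda>k. pi * real k / real T"
  have "(\<Sum>k<2*T. (csum T u (?\<theta> k))\<^sup>2 + (ssum T u (?\<theta> k))\<^sup>2) = (\<Sum>k<2*T. \<Sum>s<T. \<Sum>t<T. cos (?\<theta> k * of_int (int s - int t)) * u s * u t)"
    by (simp only: power2_eq_square csum_ssum)
  also have "\<dots> = (\<Sum>s<T. \<Sum>k<2*T. \<Sum>t<T. cos (?\<theta> k * of_int (int s - int t)) * u s * u t)"
    by (rule sum.swap)
  also have "\<dots> = (\<Sum>s<T. \<Sum>t<T. \<Sum>k<2*T. cos (?\<theta> k * of_int (int s - int t)) * u s * u t)"
    by (intro sum.cong refl sum.swap)
  also have "\<dots> = (\<Sum>s<T. \<Sum>t<T. (if s = t then 2 * real T else 0) * u s * u t)"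
  proof (intro sum.cong refl)
    fix s t assume "s \<in> {..<T}" "t \<in> {..<T}"
    then have "(\<Sum>k<2*T. cos (?\<theta> k * of_int (int s - int t))) = (if int s - int t = 0 then 2 * real T else 0)"
      by (intro sum_cos_embedding[OF T]) auto
    also have "\<dots> = (if s = t then 2 * real T else 0)" by simp
    finally show "(\<Sum>k<2*T. cos (?\<theta> k * of_int (int s - int t)) * u s * u t) = (if s = t then 2 * real T else 0) * u s * u t"
      by (simp only: sum_distrib_right[symmetric])
  qed
  also have "\<dots> = (\<Sum>s<T. \<Sum>t<T. if t = s then 2 * real T * u s * u s else 0)"
    by (intro sum.cong refl) auto
  also have "\<dots> = 2 * real T * (\<Sum>s<T. (u s)\<^sup>2)"
    by (simp add: sum_distrib_left power2_eq_square mult.assoc)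
  finally show ?thesis .
qed

text \<open>Discrete Fourier inversion: the sample autocovariances are the Fourier coefficients of the
  periodogram.\<close>

lemma acov_fourier:
  assumes T: "T > 0" and d: "d < T"
  shows "acov T x d = 1 / (2 * real T) * (\<Sum>k<2*T. ((csum T x (pi * real k / real T))\<^sup>2 + (ssum T x (pi * real k / real T))\<^sup>2) / real T * cos (pi * real k / real T * real d))"
proof -
  let ?\<theta> = "\<lambda>k. pi * real k / real T"
  have "(\<Sum>k<2*T. ((csum T x (?\<theta> k))\<^sup>2 + (ssum T x (?\<theta> k))\<^sup>2) * cos (?\<theta> k * real d))
    = (\<Sum>k<2*T. \<Sum>s<T. \<Sum>t<T. cos (?\<theta> k * of_int (int s - int t)) * cos (?\<theta> k * real d) * (x s * x t))"
    by (simp only: power2_eq_square csum_ssum sum_distrib_right) (simp add: ac_simps)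
  also have "\<dots> = (\<Sum>s<T. \<Sum>k<2*T. \<Sum>t<T. cos (?\<theta> k * of_int (int s - int t)) * cos (?\<theta> k * real d) * (x s * x t))"
    by (rule sum.swap)
  also have "\<dots> = (\<Sum>s<T. \<Sum>t<T. \<Sum>k<2*T. cos (?\<theta> k * of_int (int s - int t)) * cos (?\<theta> k * real d) * (x s * x t))"
    by (intro sum.cong refl sum.swap)
  also have "\<dots> = (\<Sum>s<T. \<Sum>t<T. (real T * of_bool (t = s + d) + real T * of_bool (s = t + d)) * (x s * x t))"
  proof (intro sum.cong refl)
    fix s t assume st: "s \<in> {..<T}" "t \<in> {..<T}"
    have "cos (?\<theta> k * of_int (int s - int t)) * cos (?\<theta> k * real d)
      = 1/2 * cos (?\<theta> k * of_int (int s - int t - int d)) + 1/2 * cos (?\<theta> k * of_int (int s - int t + int d))" for k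
      unfolding cos_times_cos by (simp add: right_diff_distrib distrib_left)
    then have "(\<Sum>k<2*T. cos (?\<theta> k * of_int (int s - int t)) * cos (?\<theta> k * real d))
      = 1/2 * (\<Sum>k<2*T. cos (?\<theta> k * of_int (int s - int t - int d))) + 1/2 * (\<Sum>k<2*T. cos (?\<theta> k * of_int (int s - int t + int d)))"
      by (simp only: sum.distrib sum_distrib_left[symmetric])
    also have "\<dots> = 1/2 * (if int s - int t - int d = 0 then 2 * real T else 0) + 1/2 * (if int s - int t + int d = 0 then 2 * real T else 0)"
      using st d by (subst (1 2) sum_cos_embedding[OF T]) auto
    also have "\<dots> = real T * of_bool (t = s + d) + real T * of_bool (s = t + d)" by auto
    finally show "(\<Sum>k<2*T. cos (?\<theta> k * of_int (int s - int t)) * cos (?\<theta> k * real d) * (x s * x t)) 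
      = (real T * of_bool (t = s + d) + real T * of_bool (s = t + d)) * (x s * x t)"
      by (simp only: sum_distrib_right[symmetric])
  qed
  also have "\<dots> = (\<Sum>s<T. \<Sum>t<T. real T * of_bool (t = s + d) * (x s * x t)) + (\<Sum>s<T. \<Sum>t<T. real T * of_bool (s = t + d) * (x s * x t))"
    by (simp only: distrib_right sum.distrib)
  also have "(\<Sum>s<T. \<Sum>t<T. real T * of_bool (s = t + d) * (x s * x t)) = (\<Sum>s<T. \<Sum>t<T. real T * of_bool (t = s + d) * (x s * x t))"
    by (subst sum.swap) (simp add: mult.commute)
  also have "(\<Sum>s<T. \<Sum>t<T. real T * of_bool (t = s + d) * (x s * x t)) = real T * (\<Sum>i<T - d. x i * x (i + d))"
  proof -
    have "(\<Sum>t<T. real T * of_bool (t = s + d) * (x s * x t)) = (if s < T - d then real T * (x s * x (s + d)) else 0)" for s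
    proof -
      have "(\<Sum>t<T. real T * of_bool (t = s + d) * (x s * x t)) = (\<Sum>t<T. if t = s + d then real T * (x s * x (s + d)) else 0)"
        by (intro sum.cong) auto
      then show ?thesis by (simp add: less_diff_conv)
    qed
    then have "(\<Sum>s<T. \<Sum>t<T. real T * of_bool (t = s + d) * (x s * x t)) = (\<Sum>s<T. if s < T - d then real T * (x s * x (s + d)) else 0)" by simp
    also have "\<dots> = (\<Sum>s\<in>{..<T} \<inter> {s. s < T - d}. real T * (x s * x (s + d)))" by (simp add: sum.If_cases)
    also have "{..<T} \<inter> {s. s < T - d} = {..<T - d}" by auto
    finally show ?thesis by (simp add: sum_distrib_left)
  qed
  finally have "(\<Sum>k<2*T. ((csum T x (?\<theta> k))\<^sup>2 + (ssum T x (?\<theta> k))\<^sup>2) * cos (?\<theta> k * real d)) = 2 * real T * (\<Sum>i<T - d. x i * x (i + d))"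
    by simp
  then show ?thesis using T
    by (simp add: acov_def sum_divide_distrib[symmetric])
qed

lemma qform_fourier:
  assumes T: "T > 0"
  shows "qform T x v u = 1 / (2 * real T) * (\<Sum>k<2*T. ((csum T x (pi * real k / real T))\<^sup>2 + (ssum T x (pi * real k / real T))\<^sup>2) / real T *
     (csum T v (pi * real k / real T) * csum T u (pi * real k / real T) + ssum T v (pi * real k / real T) * ssum T u (pi * real k / real T)))"
proof -
  let ?\<theta> = "\<lambda>k. pi * real k / real T"
  define I where "I k = ((csum T x (?\<theta> k))\<^sup>2 + (ssum T x (?\<theta> k))\<^sup>2) / real T" for k
  have "acov T x (nat \<bar>int s - int t\<bar>) = 1 / (2 * real T) * (\<Sum>k<2*T. I k * cos (?\<theta> k * of_int (int s - int t)))" if "s < T" "t < T" for s t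
  proof -
    have "nat \<bar>int s - int t\<bar> < T" using that by auto
    moreover have "cos (?\<theta> k * real (nat \<bar>int s - int t\<bar>)) = cos (?\<theta> k * of_int (int s - int t))" for k
    proof (cases "s \<ge> t")
      case False
      then have "real (nat \<bar>int s - int t\<bar>) = - of_int (int s - int t)" by simp
      then show ?thesis by (metis cos_minus mult_minus_right)
    qed simp
    ultimately show ?thesis using acov_fourier[OF T, of "nat \<bar>int s - int t\<bar>" x] unfolding I_def by simp
  qed
  then have "qform T x v u = (\<Sum>s<T. \<Sum>t<T. (1 / (2 * real T) * (\<Sum>k<2*T. I k * cos (?\<theta> k * of_int (int s - int t)))) * v s * u t)"
    unfolding qform_def by (intro sum.cong refl) simp
  also have "\<dots> = (\<Sum>s<T. \<Sum>t<T. \<Sum>k<2*T. 1 / (2 * real T) * (I k * (cos (?\<theta> k * of_int (int s - int t)) * v s * u t)))"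
    by (intro sum.cong refl) (simp only: sum_distrib_left sum_distrib_right mult.assoc)
  also have "\<dots> = (\<Sum>s<T. \<Sum>k<2*T. \<Sum>t<T. 1 / (2 * real T) * (I k * (cos (?\<theta> k * of_int (int s - int t)) * v s * u t)))"
    by (intro sum.cong refl sum.swap)
  also have "\<dots> = (\<Sum>k<2*T. \<Sum>s<T. \<Sum>t<T. 1 / (2 * real T) * (I k * (cos (?\<theta> k * of_int (int s - int t)) * v s * u t)))"
    by (rule sum.swap)
  also have "\<dots> = 1 / (2 * real T) * (\<Sum>k<2*T. I k * (csum T v (?\<theta> k) * csum T u (?\<theta> k) + ssum T v (?\<theta> k) * ssum T u (?\<theta> k)))"
    by (simp only: csum_ssum sum_distrib_left)
  finally show ?thesis unfolding I_def .
qed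

lemma sum_squares_eucl_norm:
  assumes "u \<in> carrier_vec T" shows "(eucl_norm u)\<^sup>2 = (\<Sum>s<T. (u $ s)\<^sup>2)"
proof -
  have "0 \<le> (\<Sum>s<T. (u $ s)\<^sup>2)" by (intro sum_nonneg) auto
  then show ?thesis using assms by (simp add: eucl_norm_def L2_set_def)
qed

lemma eucl_norm_nonneg: "0 \<le> eucl_norm u"
  by (simp add: eucl_norm_def)

lemma toeplitz_mult_vec:
  assumes u: "u \<in> carrier_vec T"
  shows "toeplitz T x *\<^sub>v u \<in> carrier_vec T"
    and "s < T \<Longrightarrow> (toeplitz T x *\<^sub>v u) $ s = (\<Sum>t<T. acov T x (nat \<bar>int s - int t\<bar>) * u $ t)"
proof -
  show "toeplitz T x *\<^sub>v u \<in> carrier_vec T" 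
    by (rule carrier_vecI) (simp add: toeplitz_def)
  show "(toeplitz T x *\<^sub>v u) $ s = (\<Sum>t<T. acov T x (nat \<bar>int s - int t\<bar>) * u $ t)" if "s < T"
  proof -
    have "(toeplitz T x *\<^sub>v u) $ s = (\<Sum>t\<in>{0..<dim_vec u}. row (toeplitz T x) s $ t * u $ t)"
      using that by (simp add: toeplitz_def scalar_prod_def)
    also have "\<dots> = (\<Sum>t<T. acov T x (nat \<bar>int s - int t\<bar>) * u $ t)"
      using u that by (intro sum.cong) (auto simp: toeplitz_def)
    finally show ?thesis .
  qed
qed

lemma qform_toeplitz:
  assumes u: "u \<in> carrier_vec T"
  shows "(\<Sum>s<T. v s * (toeplitz T x *\<^sub>v u) $ s) = qform T x v (\<lambda>t. u $ t)"
  unfolding qform_def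
  by (intro sum.cong refl) (simp add: toeplitz_mult_vec(2)[OF u] sum_distrib_left ac_simps)

text \<open>The periodogram appears as a nonnegative multiplier in the frequency domain; Young's inequality
  with weight \<open>a\<close> and the Parseval identity give the bound.\<close>

lemma qform_le:
  assumes T: "T > 0" and M: "0 \<le> M" and a: "a > 0"
    and I: "\<And>k. k < 2*T \<Longrightarrow> (csum T x (pi * real k / real T))\<^sup>2 + (ssum T x (pi * real k / real T))\<^sup>2 \<le> real T * M"
  shows "qform T x v u \<le> M / 2 * (a * (\<Sum>s<T. (v s)\<^sup>2) + (\<Sum>s<T. (u s)\<^sup>2) / a)"
proof -
  let ?\<theta> = "\<lambda>k. pi * real k / real T"
  let ?I = "\<lambda>k. ((csum T x (?\<theta> k))\<^sup>2 + (ssum T x (?\<theta> k))\<^sup>2) / real T"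
  let ?e = "\<lambda>v k. (csum T v (?\<theta> k))\<^sup>2 + (ssum T v (?\<theta> k))\<^sup>2"
  have prod: "p * q \<le> 1/2 * (a * p\<^sup>2 + q\<^sup>2 / a)" for p q :: real
  proof -
    have "0 \<le> (a * p - q)\<^sup>2 / a" using a by simp
    also have "\<dots> = a * p\<^sup>2 + q\<^sup>2 / a - 2 * (p * q)" using a by (simp add: power2_eq_square field_simps)
    finally show ?thesis by simp
  qed
  have "(\<Sum>k<2*T. ?I k * (csum T v (?\<theta> k) * csum T u (?\<theta> k) + ssum T v (?\<theta> k) * ssum T u (?\<theta> k)))
    \<le> (\<Sum>k<2*T. M * (1/2 * (a * ?e v k + ?e u k / a)))"
  proof (rule sum_mono)
    fix k assume "k \<in> {..<2*T}"
    then have Ik: "?I k \<le> M" using I[of k] T by (simp add: field_simps)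
    have "csum T v (?\<theta> k) * csum T u (?\<theta> k) + ssum T v (?\<theta> k) * ssum T u (?\<theta> k) \<le> 1/2 * (a * ?e v k + ?e u k / a)"
      using prod[of "csum T v (?\<theta> k)" "csum T u (?\<theta> k)"] prod[of "ssum T v (?\<theta> k)" "ssum T u (?\<theta> k)"]
      by (simp add: distrib_left add_divide_distrib)
    then have "?I k * (csum T v (?\<theta> k) * csum T u (?\<theta> k) + ssum T v (?\<theta> k) * ssum T u (?\<theta> k)) \<le> ?I k * (1/2 * (a * ?e v k + ?e u k / a))"
      by (intro mult_left_mono) auto
    also have "\<dots> \<le> M * (1/2 * (a * ?e v k + ?e u k / a))"
      using Ik a by (intro mult_right_mono) auto
    finally show "?I k * (csum T v (?\<theta> k) * csum T u (?\<theta> k) + ssum T v (?\<theta> k) * ssum T u (?\<theta> k)) \<le> \<dots>" .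
  qed
  also have "\<dots> = M / 2 * (a * (\<Sum>k<2*T. ?e v k) + (\<Sum>k<2*T. ?e u k) / a)"
    unfolding sum_distrib_left sum_divide_distrib sum.distrib[symmetric] by (intro sum.cong refl) simp
  also have "\<dots> = 2 * real T * (M / 2 * (a * (\<Sum>s<T. (v s)\<^sup>2) + (\<Sum>s<T. (u s)\<^sup>2) / a))"
    unfolding sum_periodogram_frequencies[OF T] by (simp add: algebra_simps)
  finally have "1 / (2 * real T) * (\<Sum>k<2*T. ?I k * (csum T v (?\<theta> k) * csum T u (?\<theta> k) + ssum T v (?\<theta> k) * ssum T u (?\<theta> k)))
    \<le> 1 / (2 * real T) * (2 * real T * (M / 2 * (a * (\<Sum>s<T. (v s)\<^sup>2) + (\<Sum>s<T. (u s)\<^sup>2) / a)))"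
    by (rule mult_left_mono) simp
  also have "\<dots> = M / 2 * (a * (\<Sum>s<T. (v s)\<^sup>2) + (\<Sum>s<T. (u s)\<^sup>2) / a)" using T by simp
  finally show ?thesis unfolding qform_fourier[OF T] .
qed

text \<open>Testing with the image vector itself and balancing the weight in \<open>qform_le\<close>.\<close>

lemma eucl_norm_toeplitz_le:
  assumes T: "T > 0" and M: "0 \<le> M" and u: "u \<in> carrier_vec T"
    and I: "\<And>k. k < 2*T \<Longrightarrow> (csum T x (pi * real k / real T))\<^sup>2 + (ssum T x (pi * real k / real T))\<^sup>2 \<le> real T * M"
    and u1: "eucl_norm u = 1"
  shows "eucl_norm (toeplitz T x *\<^sub>v u) \<le> M"
proof (cases "eucl_norm (toeplitz T x *\<^sub>v u) = 0")
  case False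
  define v where "v = toeplitz T x *\<^sub>v u"
  define r where "r = eucl_norm v"
  have r: "r > 0" using False eucl_norm_nonneg[of v] unfolding r_def v_def by linarith
  have v: "v \<in> carrier_vec T" unfolding v_def by (rule toeplitz_mult_vec(1)[OF u])
  have "r\<^sup>2 = (\<Sum>s<T. v $ s * (toeplitz T x *\<^sub>v u) $ s)"
    unfolding r_def sum_squares_eucl_norm[OF v] by (simp add: v_def power2_eq_square)
  also have "\<dots> = qform T x (\<lambda>s. v $ s) (\<lambda>t. u $ t)" by (rule qform_toeplitz[OF u])
  also have "\<dots> \<le> M / 2 * (1 / r * (\<Sum>s<T. (v $ s)\<^sup>2) + (\<Sum>s<T. (u $ s)\<^sup>2) / (1 / r))"
    by (rule qform_le[OF T M _ I]) (use r in auto)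
  also have "\<dots> = M * r"
    unfolding sum_squares_eucl_norm[OF v, symmetric] sum_squares_eucl_norm[OF u, symmetric] u1 r_def[symmetric]
    using r by (simp add: power2_eq_square)
  finally show ?thesis using r by (simp add: power2_eq_square r_def v_def)
qed (use M in simp)

lemma unit_vector_exists: "T > 0 \<Longrightarrow> \<exists>u. u \<in> carrier_vec T \<and> eucl_norm u = 1"
  by (rule exI[of _ "unit_vec T 0"]) 
     (auto simp: eucl_norm_def L2_set_def unit_vec_def if_distrib[of "\<lambda>x. x\<^sup>2"] cong: if_cong)

lemma op_norm_toeplitz_le:
  assumes T: "T > 0" and M: "0 \<le> M"
    and I: "\<And>k. k < 2*T \<Longrightarrow> (csum T x (pi * real k / real T))\<^sup>2 + (ssum T x (pi * real k / real T))\<^sup>2 \<le> real T * M"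
  shows "op_norm (toeplitz T x) \<le> M"
proof -
  have d: "dim_col (toeplitz T x) = T" by (simp add: toeplitz_def)
  show ?thesis unfolding op_norm_def d
  proof (rule cSUP_least)
    show "{u \<in> carrier_vec T. eucl_norm u = 1} \<noteq> {}" using unit_vector_exists[OF T] by blast
    show "eucl_norm (toeplitz T x *\<^sub>v u) \<le> M" if "u \<in> {u \<in> carrier_vec T. eucl_norm u = 1}" for u
      using that by (intro eucl_norm_toeplitz_le[OF T M _ I]) auto
  qed
qed

lemma eucl_norm_le_op_norm_toeplitz:
  assumes T: "T > 0" and u: "u \<in> carrier_vec T" "eucl_norm u = 1"
  shows "eucl_norm (toeplitz T x *\<^sub>v u) \<le> op_norm (toeplitz T x)"
proof -
  define M where "M = (\<Sum>k<2*T. (csum T x (pi * real k / real T))\<^sup>2 + (ssum T x (pi * real k / real T))\<^sup>2)"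
  have M: "0 \<le> M" unfolding M_def by (intro sum_nonneg) auto
  have I: "(csum T x (pi * real k / real T))\<^sup>2 + (ssum T x (pi * real k / real T))\<^sup>2 \<le> real T * M" if "k < 2*T" for k
  proof -
    have "(csum T x (pi * real k / real T))\<^sup>2 + (ssum T x (pi * real k / real T))\<^sup>2 \<le> M"
      unfolding M_def using that by (intro member_le_sum[of k "{..<2*T}" "\<lambda>k. (csum T x (pi * real k / real T))\<^sup>2 + (ssum T x (pi * real k / real T))\<^sup>2"]) auto
    also have "M \<le> real T * M" using T M mult_right_mono[of 1 "real T" M] by simp
    finally show ?thesis .
  qed
  have d: "dim_col (toeplitz T x) = T" by (simp add: toeplitz_def)
  have "bdd_above ((\<lambda>u. eucl_norm (toeplitz T x *\<^sub>v u)) ` {u \<in> carrier_vec (dim_col (toeplitz T x)). eucl_norm u = 1})"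
    using eucl_norm_toeplitz_le[OF T M _ I] unfolding d by (intro bdd_aboveI[of _ M]) auto
  then show ?thesis unfolding op_norm_def using u d by (intro cSUP_upper) auto
qed

lemma qform_le_op_norm:
  assumes T: "T > 0"
  shows "qform T x z z \<le> op_norm (toeplitz T x) * (\<Sum>s<T. (z s)\<^sup>2)"
proof (cases "(\<Sum>s<T. (z s)\<^sup>2) = 0")
  case True
  then have "z s = 0" if "s < T" for s using that by (simp add: sum_nonneg_eq_0_iff)
  then show ?thesis using True by (simp add: qform_def)
next
  case False
  define c where "c = sqrt (\<Sum>s<T. (z s)\<^sup>2)"
  have s0: "0 \<le> (\<Sum>s<T. (z s)\<^sup>2)" by (intro sum_nonneg) auto
  then have c: "c > 0" "c\<^sup>2 = (\<Sum>s<T. (z s)\<^sup>2)" using False by (auto simp: c_def)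
  define u where "u = Matrix.vec T (\<lambda>s. z s / c)"
  have u: "u \<in> carrier_vec T" by (simp add: u_def)
  have "(eucl_norm u)\<^sup>2 = (\<Sum>s<T. (z s)\<^sup>2) / c\<^sup>2"
    unfolding sum_squares_eucl_norm[OF u] by (simp add: u_def power_divide sum_divide_distrib)
  then have u1: "eucl_norm u = 1" using c eucl_norm_nonneg[of u] False by (simp add: power2_eq_1_iff)
  define v where "v = toeplitz T x *\<^sub>v u"
  have v: "v \<in> carrier_vec T" unfolding v_def by (rule toeplitz_mult_vec(1)[OF u])
  have "qform T x z z = c\<^sup>2 * qform T x (\<lambda>t. u $ t) (\<lambda>t. u $ t)"
    unfolding qform_def sum_distrib_left using c(1) by (intro sum.cong refl) (simp add: u_def power2_eq_square)
  also have "qform T x (\<lambda>t. u $ t) (\<lambda>t. u $ t) = (\<Sum>s<T. u $ s * v $ s)"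
    unfolding v_def by (rule qform_toeplitz[OF u, symmetric])
  finally have eq: "qform T x z z = c\<^sup>2 * (\<Sum>s<T. u $ s * v $ s)" .
  have "(\<Sum>s<T. u $ s * v $ s) \<le> eucl_norm v"
  proof -
    have "(\<Sum>s<T. u $ s * v $ s) \<le> (\<Sum>s<T. \<bar>u $ s\<bar> * \<bar>v $ s\<bar>)"
      by (intro sum_mono) (metis abs_ge_self abs_mult)
    also have "\<dots> \<le> L2_set (\<lambda>s. u $ s) {..<T} * L2_set (\<lambda>s. v $ s) {..<T}"
      by (rule L2_set_mult_ineq)
    also have "\<dots> = eucl_norm u * eucl_norm v" using u v by (simp add: eucl_norm_def)
    finally show ?thesis by (simp add: u1)
  qed
  also have "eucl_norm v \<le> op_norm (toeplitz T x)"
    unfolding v_def by (rule eucl_norm_le_op_norm_toeplitz[OF T u u1])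
  finally have "c\<^sup>2 * (\<Sum>s<T. u $ s * v $ s) \<le> c\<^sup>2 * op_norm (toeplitz T x)"
    by (rule mult_left_mono) simp
  then show ?thesis unfolding eq c(2) by (simp add: mult.commute)
qed

text \<open>The test vectors \<open>cos (\<theta> i)\<close> and \<open>sin (\<theta> i)\<close> have total
  squared length \<open>T\<close>. Interchanging the roles of data and test vectors turns the sum
  of their two quadratic forms into the triangular kernel applied to the modulated data.\<close>

lemma op_norm_toeplitz_ge:
  assumes T: "T > 0"
  shows "(csum T x \<theta>)\<^sup>2 / (2 * real T) \<le> op_norm (toeplitz T x)"
proof -
  define c s where "c = (\<lambda>i. cos (\<theta> * real i))" and "s = (\<lambda>i. sin (\<theta> * real i))"
  define w where "w d = (if d = 0 then 1 else 2 :: real)" for d :: nat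
  have cos_abs: "cos (\<theta> * real (nat \<bar>int i - int j\<bar>)) = cos (\<theta> * of_int (int i - int j))" for i j
  proof (cases "i \<ge> j")
    case False
    then have "real (nat \<bar>int i - int j\<bar>) = - of_int (int i - int j)" by simp
    then show ?thesis by (metis cos_minus mult_minus_right)
  qed simp
  have cc: "c i * c j + s i * s j = cos (\<theta> * real (nat \<bar>int i - int j\<bar>))" for i j
    unfolding c_def s_def cos_abs by (simp add: right_diff_distrib cos_diff)
  have "qform T x c c + qform T x s s = (\<Sum>i<T. \<Sum>j<T. (\<lambda>d. acov T x d * cos (\<theta> * real d)) (nat \<bar>int i - int j\<bar>) * 1 * 1)"
    unfolding qform_def sum.distrib[symmetric] cc[symmetric] by (intro sum.cong refl) (simp add: algebra_simps)
  also have "\<dots> = (\<Sum>d<T. w d * (acov T x d * cos (\<theta> * real d)) * (\<Sum>i<T - d. 1 * 1))"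
    unfolding w_def by (rule sum_toeplitz_diagonals[of _ "\<lambda>_. 1"])
  also have "\<dots> = 1 / real T * (\<Sum>d<T. w d * (real (T - d) * cos (\<theta> * real d)) * (\<Sum>i<T - d. x i * x (i + d)))"
    by (subst sum_distrib_left) (intro sum.cong refl, simp add: acov_def)
  also have "(\<Sum>d<T. w d * (real (T - d) * cos (\<theta> * real d)) * (\<Sum>i<T - d. x i * x (i + d)))
    = (\<Sum>i<T. \<Sum>j<T. (\<lambda>d. real (T - d) * cos (\<theta> * real d)) (nat \<bar>int i - int j\<bar>) * x i * x j)"
    unfolding w_def by (rule sum_toeplitz_diagonals[symmetric])
  also have "\<dots> = (\<Sum>i<T. \<Sum>j<T. real (T - nat \<bar>int i - int j\<bar>) * (c i * x i) * (c j * x j)) + (\<Sum>i<T. \<Sum>j<T. real (T - nat \<bar>int i - int j\<bar>) * (s i * x i) * (s j * x j))"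
    unfolding sum.distrib[symmetric] cc[symmetric] by (intro sum.cong refl) (simp add: algebra_simps)
  finally have Q: "qform T x c c + qform T x s s = 1 / real T * \<dots>" .
  have "real T / 2 * (csum T x \<theta>)\<^sup>2 \<le> (\<Sum>i<T. \<Sum>j<T. real (T - nat \<bar>int i - int j\<bar>) * (c i * x i) * (c j * x j))"
    using triangular_kernel[of T "\<lambda>i. c i * x i"] by (simp add: csum_def c_def)
  moreover have "0 \<le> (\<Sum>i<T. \<Sum>j<T. real (T - nat \<bar>int i - int j\<bar>) * (s i * x i) * (s j * x j))"
    by (rule order_trans[OF _ triangular_kernel[of T "\<lambda>i. s i * x i"]]) simp
  ultimately have "1 / real T * (real T / 2 * (csum T x \<theta>)\<^sup>2) \<le> qform T x c c + qform T x s s"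
    unfolding Q by (intro mult_left_mono) auto
  also have "\<dots> \<le> op_norm (toeplitz T x) * (\<Sum>i<T. (c i)\<^sup>2) + op_norm (toeplitz T x) * (\<Sum>i<T. (s i)\<^sup>2)"
    by (intro add_mono qform_le_op_norm T)
  also have "\<dots> = op_norm (toeplitz T x) * (\<Sum>i<T. (c i)\<^sup>2 + (s i)\<^sup>2)"
    by (simp add: sum.distrib distrib_left)
  also have "(\<Sum>i<T. (c i)\<^sup>2 + (s i)\<^sup>2) = real T" by (simp add: c_def s_def)
  finally show ?thesis using T by (simp add: field_simps)
qed

section \<open>Long-run variance and spectral density\<close>

lemma cesaro_limit:
  fixes D :: "nat \<Rightarrow> real"
  assumes "D \<longlonglongrightarrow> L"
  shows "(\<lambda>n. (\<Sum>m<n. D m) / real n) \<longlonglongrightarrow> L"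
proof (rule LIMSEQ_I)
  fix e :: real assume e: "e > 0"
  then obtain N where N: "\<And>m. m \<ge> N \<Longrightarrow> \<bar>D m - L\<bar> < e / 2"
    using LIMSEQ_D[OF assms, of "e / 2"] by auto
  define B where "B = (\<Sum>m<N. \<bar>D m - L\<bar>)"
  have "(\<lambda>n. B / real n) \<longlonglongrightarrow> 0" by real_asymp
  then obtain N' where N': "\<And>n. n \<ge> N' \<Longrightarrow> \<bar>B / real n\<bar> < e / 2"
    using LIMSEQ_D[of "\<lambda>n. B / real n" 0 "e / 2"] e by auto
  have "norm ((\<Sum>m<n. D m) / real n - L) < e" if n: "n \<ge> max 1 (max N N')" for n
  proof -
    have n0: "real n > 0" using n by simp
    have "(\<Sum>m<n. D m) / real n - L = (\<Sum>m<n. D m - L) / real n"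
      using n0 by (simp add: sum_subtractf field_simps)
    then have "norm ((\<Sum>m<n. D m) / real n - L) \<le> (\<Sum>m<n. \<bar>D m - L\<bar>) / real n"
      using n0 by (simp add: sum_abs divide_right_mono)
    also have "(\<Sum>m<n. \<bar>D m - L\<bar>) = B + (\<Sum>m\<in>{N..<n}. \<bar>D m - L\<bar>)"
      using n unfolding B_def lessThan_atLeast0 by (subst sum.atLeastLessThan_concat) auto
    also have "(\<Sum>m\<in>{N..<n}. \<bar>D m - L\<bar>) \<le> (\<Sum>m\<in>{N..<n}. e / 2)"
      using N by (intro sum_mono) (simp add: less_imp_le)
    also have "\<dots> \<le> real n * (e / 2)" using e by simp
    finally have "norm ((\<Sum>m<n. D m) / real n - L) \<le> (B + real n * (e / 2)) / real n"
      using n0 by (simp add: divide_right_mono)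
    also have "\<dots> = B / real n + e / 2" using n0 by (simp add: add_divide_distrib)
    also have "\<dots> < e"
    proof -
      have "\<bar>B / real n\<bar> < e / 2" by (rule N') (use n in simp)
      then show ?thesis by linarith
    qed
    finally show ?thesis .
  qed
  then show "\<exists>no. \<forall>n\<ge>no. norm ((\<Sum>m<n. D m) / real n - L) < e" by blast
qed

text \<open>The double sum grows from \<open>n\<close> to \<open>n + 1\<close> by the symmetric partial sum
  of order \<open>n\<close>, so the limit is a Cesaro mean.\<close>

lemma fejer_limit:
  fixes d :: "int \<Rightarrow> real"
  assumes "(d has_sum L) UNIV"
  shows "(\<lambda>n. (\<Sum>s<n. \<Sum>t<n. d (int s - int t)) / real n) \<longlonglongrightarrow> L"
proof -
  define D where "D m = (\<Sum>k\<in>{- int m..int m}. d k)" for m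
  have "filterlim (\<lambda>m. {- int m..int m}) (finite_subsets_at_top UNIV) sequentially"
    unfolding filterlim_finite_subsets_at_top
  proof (intro allI impI)
    fix X :: "int set" assume "finite X \<and> X \<subseteq> UNIV"
    then have f: "finite X" by simp
    define B where "B = nat (Max (insert 0 (abs ` X)))"
    have le: "\<bar>x\<bar> \<le> int B" if "x \<in> X" for x
    proof -
      have "\<bar>x\<bar> \<le> Max (insert 0 (abs ` X))" using f that by (intro Max_ge) auto
      then show ?thesis unfolding B_def by linarith
    qed
    have "X \<subseteq> {- int m..int m}" if "m \<ge> B" for m
    proof
      fix x assume "x \<in> X" from le[OF this] that show "x \<in> {- int m..int m}" by auto
    qed
    then show "\<forall>\<^sub>F m in sequentially. finite {- int m..int m} \<and> X \<subseteq> {- int m..int m} \<and> {- int m..int m} \<subseteq> UNIV"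
      by (intro eventually_sequentiallyI[of B]) auto
  qed
  with assms have "D \<longlonglongrightarrow> L" unfolding has_sum_def D_def by (rule filterlim_compose)
  from cesaro_limit[OF this] have "(\<lambda>n. (\<Sum>m<n. D m) / real n) \<longlonglongrightarrow> L" .
  moreover have "(\<Sum>s<n. \<Sum>t<n. d (int s - int t)) = (\<Sum>m<n. D m)" for n
  proof (induction n)
    case (Suc n)
    have "(\<Sum>s<Suc n. \<Sum>t<Suc n. d (int s - int t)) 
      = (\<Sum>s<n. \<Sum>t<n. d (int s - int t)) + ((\<Sum>s<n. d (int s - int n)) + (\<Sum>t<Suc n. d (int n - int t)))"
      by (simp add: sum.distrib)
    also have "(\<Sum>s<n. d (int s - int n)) = (\<Sum>k\<in>{- int n..-1}. d k)"
      by (rule sum.reindex_bij_witness[of _ "\<lambda>k. nat (k + int n)" "\<lambda>s. int s - int n"]) auto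
    also have "(\<Sum>t<Suc n. d (int n - int t)) = (\<Sum>k\<in>{0..int n}. d k)"
      by (rule sum.reindex_bij_witness[of _ "\<lambda>k. nat (int n - k)" "\<lambda>t. int n - int t"]) auto
    also have "(\<Sum>k\<in>{- int n..-1}. d k) + (\<Sum>k\<in>{0..int n}. d k) = D n"
    proof -
      have "{- int n..int n} = {- int n..-1} \<union> {0..int n}" by auto
      then show ?thesis unfolding D_def by (simp add: sum.union_disjoint)
    qed
    finally show ?case using Suc.IH by simp
  qed simp
  ultimately show ?thesis by simp
qed

lemma integrable_product_of_squares:
  fixes f h :: "'a \<Rightarrow> real"
  assumes "f \<in> borel_measurable N" "h \<in> borel_measurable N" "integrable N (\<lambda>y. (f y)\<^sup>2)" "integrable N (\<lambda>y. (h y)\<^sup>2)"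
  shows "integrable N (\<lambda>y. f y * h y)"
proof -
  have "integrable N (\<lambda>y. ((f y + h y)\<^sup>2 - (f y)\<^sup>2 - (h y)\<^sup>2) / 2)"
    using integrable_square_add[OF assms] assms by (intro integrable_divide Bochner_Integration.integrable_diff) auto
  then show ?thesis by (simp add: power2_sum)
qed

context innovation_space
begin

definition cov :: "((nat \<Rightarrow> 'b) \<Rightarrow> real) \<Rightarrow> nat \<Rightarrow> real" where
  "cov g k = (\<integral>y. g y * g (shift k y) \<partial>S)"

text \<open>By stationarity the covariance of two observations depends on their lag alone.\<close>

lemma integral_square_linear_form:
  fixes g :: "(nat \<Rightarrow> 'b) \<Rightarrow> real"
  assumes m [measurable]: "g \<in> borel_measurable S" and i: "integrable S (\<lambda>y. (g y)\<^sup>2)"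
  shows "(\<integral>y. (\<Sum>i<n. a i * g (shift i y))\<^sup>2 \<partial>S) = (\<Sum>s<n. \<Sum>t<n. a s * a t * cov g (nat \<bar>int s - int t\<bar>))"
    and "integrable S (\<lambda>y. (\<Sum>i<n. a i * g (shift i y))\<^sup>2)"
proof -
  have ms: "(\<lambda>y. g (shift s y)) \<in> borel_measurable S" for s by (rule measurable_compose[OF measurable_shift m])
  have int: "integrable S (\<lambda>y. g (shift s y) * g (shift t y))" for s t
    by (rule integrable_product_of_squares[OF ms ms integrable_shift[OF i] integrable_shift[OF i]])
  have le: "(\<integral>y. g (shift s y) * g (shift t y) \<partial>S) = cov g (t - s)" if "s \<le> t" for s t
  proof -
    have "(\<lambda>y. g y * g (shift (t - s) y)) \<in> borel_measurable S" using m ms by (intro borel_measurable_times)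
    from integral_shift[OF this, of s] show ?thesis using that by (simp add: cov_def)
  qed
  have c: "(\<integral>y. g (shift s y) * g (shift t y) \<partial>S) = cov g (nat \<bar>int s - int t\<bar>)" for s t
  proof (cases "s \<le> t")
    case True
    then have "nat \<bar>int s - int t\<bar> = t - s" by simp
    then show ?thesis using le[OF True] by (simp only:)
  next
    case False
    then have "nat \<bar>int s - int t\<bar> = s - t" by simp
    then show ?thesis using le[of t s] False by (simp only: mult.commute)
  qed
  have eq: "(\<Sum>i<n. a i * g (shift i y))\<^sup>2 = (\<Sum>s<n. \<Sum>t<n. a s * a t * (g (shift s y) * g (shift t y)))" for y
    unfolding power2_eq_square sum_product by (simp add: mult_ac)
  show "integrable S (\<lambda>y. (\<Sum>i<n. a i * g (shift i y))\<^sup>2)"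
    unfolding eq by (intro Bochner_Integration.integrable_sum integrable_mult_right int)
  show "(\<integral>y. (\<Sum>i<n. a i * g (shift i y))\<^sup>2 \<partial>S) = (\<Sum>s<n. \<Sum>t<n. a s * a t * cov g (nat \<bar>int s - int t\<bar>))"
  proof -
    have 1: "integrable S (\<lambda>y. a s * a t * (g (shift s y) * g (shift t y)))" for s t by (intro integrable_mult_right int)
    then have 2: "integrable S (\<lambda>y. \<Sum>t<n. a s * a t * (g (shift s y) * g (shift t y)))" for s by simp
    show ?thesis unfolding eq Bochner_Integration.integral_sum[OF 2] Bochner_Integration.integral_sum[OF 1]
      by (simp only: Bochner_Integration.integral_mult_right_zero c)
  qed
qed

text \<open>The Fejer means are expected periodograms. Without summability the value of the sum is
  \<open>0\<close>.\<close>

lemma fourier_series_nonneg: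
  fixes g :: "(nat \<Rightarrow> 'b) \<Rightarrow> real"
  assumes m: "g \<in> borel_measurable S" and i: "integrable S (\<lambda>y. (g y)\<^sup>2)"
  shows "0 \<le> (\<Sum>\<^sub>\<infinity>k::int. cov g (nat \<bar>k\<bar>) * cos (of_int k * \<theta>))"
proof (cases "(\<lambda>k::int. cov g (nat \<bar>k\<bar>) * cos (of_int k * \<theta>)) summable_on UNIV")
  case True
  define d where "d k = cov g (nat \<bar>k\<bar>) * cos (of_int k * \<theta>)" for k :: int
  have "(\<lambda>n. (\<Sum>s<n. \<Sum>t<n. d (int s - int t)) / real n) \<longlonglongrightarrow> (\<Sum>\<^sub>\<infinity>k::int. d k)"
    by (rule fejer_limit) (use True in \<open>simp add: d_def has_sum_infsum\<close>)
  moreover have "0 \<le> (\<Sum>s<n. \<Sum>t<n. d (int s - int t)) / real n" for n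
  proof -
    have cosd: "cos (of_int (int s - int t) * \<theta>) = cos (\<theta> * real s) * cos (\<theta> * real t) + sin (\<theta> * real s) * sin (\<theta> * real t)" for s t
      by (simp add: cos_diff[symmetric] algebra_simps)
    have "(\<Sum>s<n. \<Sum>t<n. d (int s - int t)) = (\<integral>y. (\<Sum>i<n. cos (\<theta> * real i) * g (shift i y))\<^sup>2 \<partial>S)
       + (\<integral>y. (\<Sum>i<n. sin (\<theta> * real i) * g (shift i y))\<^sup>2 \<partial>S)"
      unfolding integral_square_linear_form(1)[OF m i] d_def cosd sum.distrib[symmetric]
      by (intro sum.cong refl) (simp add: algebra_simps)
    also have "\<dots> \<ge> 0" by simp
    finally show ?thesis by simp
  qed
  ultimately have "0 \<le> (\<Sum>\<^sub>\<infinity>k::int. d k)" by (intro LIMSEQ_le_const[where a = 0]) auto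
  then show ?thesis by (simp add: d_def)
qed (simp add: infsum_not_exists)

text \<open>A positive sum is a genuine sum, because an unordered sum that does not exist has the value
  \<open>0\<close>.\<close>

lemma long_run_variance:
  fixes g :: "(nat \<Rightarrow> 'b) \<Rightarrow> real"
  assumes m: "g \<in> borel_measurable S" and i: "integrable S (\<lambda>y. (g y)\<^sup>2)"
    and V: "V = (\<Sum>\<^sub>\<infinity>k::int. cov g (nat \<bar>k\<bar>))" "V > 0"
  shows "(\<lambda>n. l2norm S (\<lambda>y. \<Sum>i<n. g (shift i y)) / sqrt n) \<longlonglongrightarrow> sqrt V"
proof -
  have "(\<lambda>k::int. cov g (nat \<bar>k\<bar>)) summable_on UNIV"
    using V by (metis infsum_not_exists less_irrefl)
  then have "((\<lambda>k::int. cov g (nat \<bar>k\<bar>)) has_sum V) UNIV" using V by (simp add: has_sum_infsum)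
  from fejer_limit[OF this] 
  have "(\<lambda>n. (l2norm S (\<lambda>y. \<Sum>i<n. g (shift i y)))\<^sup>2 / real n) \<longlonglongrightarrow> V"
    using integral_square_linear_form(1)[OF m i, of "\<lambda>_. 1"] by (simp add: l2norm_square)
  from tendsto_real_sqrt[OF this] show ?thesis by (simp add: real_sqrt_divide l2norm_def)
qed

end

section \<open>From the underlying probability space to the product space\<close>

text \<open>Young's inequality for \<open>Z\<^sup>2\<close>, normalised by its mean, and the constant
  \<open>1\<close>.\<close>

lemma (in prob_space) lyapunov:
  assumes Z [measurable]: "Z \<in> borel_measurable M" and i: "integrable M (\<lambda>x. \<bar>Z x\<bar> powr p)" and p: "p > 2"
  shows "integrable M (\<lambda>x. (Z x)\<^sup>2)" and "l2norm M Z \<le> (\<integral>x. \<bar>Z x\<bar> powr p \<partial>M) powr (1 / p)"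
proof -
  define r where "r = p / 2"
  have r: "r > 1" using p by (simp add: r_def)
  define r' where "r' = r / (r - 1)"
  have r': "r' > 1" "1 / r + 1 / r' = 1" using r by (auto simp: r'_def field_simps)
  have young: "u \<le> u powr r / r + 1 / r'" if "u \<ge> 0" for u
    using Youngs_inequality[OF r r' that, of 1] by simp
  have pw: "(z\<^sup>2) powr r = \<bar>z\<bar> powr p" for z :: real
  proof -
    have "(z\<^sup>2) powr r = (\<bar>z\<bar> powr 2) powr r" by simp
    also have "\<dots> = \<bar>z\<bar> powr p" unfolding powr_powr by (simp add: r_def)
    finally show ?thesis .
  qed
  show i2: "integrable M (\<lambda>x. (Z x)\<^sup>2)"
  proof (rule Bochner_Integration.integrable_bound)
    show "integrable M (\<lambda>x. \<bar>Z x\<bar> powr p / r + 1 / r')" using i by simp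
    have "norm ((Z x)\<^sup>2) \<le> norm (\<bar>Z x\<bar> powr p / r + 1 / r')" for x
      using young[of "(Z x)\<^sup>2"] r r' unfolding pw by simp
    then show "AE x in M. norm ((Z x)\<^sup>2) \<le> norm (\<bar>Z x\<bar> powr p / r + 1 / r')" by simp
  qed simp
  define a where "a = (\<integral>x. (Z x)\<^sup>2 \<partial>M)"
  define b where "b = (\<integral>x. \<bar>Z x\<bar> powr p \<partial>M)"
  have b0: "b \<ge> 0" by (simp add: b_def)
  have "a \<le> b powr (1 / r)"
  proof (cases "a > 0")
    case True
    have "(\<integral>x. (Z x)\<^sup>2 / a \<partial>M) \<le> (\<integral>x. (\<bar>Z x\<bar> powr p / a powr r) / r + 1 / r' \<partial>M)"
    proof (rule integral_mono)
      fix x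
      have "((Z x)\<^sup>2 / a) powr r = \<bar>Z x\<bar> powr p / a powr r" using True by (simp add: powr_divide pw)
      then show "(Z x)\<^sup>2 / a \<le> (\<bar>Z x\<bar> powr p / a powr r) / r + 1 / r'"
        using young[of "(Z x)\<^sup>2 / a"] True by simp
    qed (use i i2 in simp_all)
    also have "\<dots> = (b / a powr r) / r + 1 / r'" using i by (simp add: b_def prob_space)
    finally have "1 \<le> (b / a powr r) / r + 1 / r'" using True by (simp add: a_def)
    then have "1 / r \<le> (b / a powr r) / r" using r'(2) by linarith
    with r have "1 \<le> b / a powr r" unfolding divide_le_cancel by simp
    then have "a powr r \<le> b" using True pos_le_divide_eq[of "a powr r" 1 b] by simp
    then have "(a powr r) powr (1 / r) \<le> b powr (1 / r)" using r by (intro powr_mono2) auto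
    then show ?thesis using True r by (simp add: powr_powr)
  qed (use order_trans[OF _ powr_ge_zero] in force)
  then have "sqrt a \<le> sqrt (b powr (1 / r))" by (rule real_sqrt_le_mono)
  also have "\<dots> = b powr (1 / p)" using b0 by (simp add: powr_half_sqrt[symmetric] powr_powr r_def)
  finally show "l2norm M Z \<le> (\<integral>x. \<bar>Z x\<bar> powr p \<partial>M) powr (1 / p)" by (simp add: l2norm_def a_def b_def)
qed

lemma integrable_powr_diff:
  fixes A B :: "'a \<Rightarrow> real"
  assumes [measurable]: "A \<in> borel_measurable N" "B \<in> borel_measurable N"
    and i: "integrable N (\<lambda>x. \<bar>A x\<bar> powr p)" "integrable N (\<lambda>x. \<bar>B x\<bar> powr p)" and p: "p > 0"
  shows "integrable N (\<lambda>x. \<bar>A x - B x\<bar> powr p)"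
proof (rule Bochner_Integration.integrable_bound)
  show "integrable N (\<lambda>x. 2 powr p * (\<bar>A x\<bar> powr p + \<bar>B x\<bar> powr p))" using i by simp
  have "\<bar>A x - B x\<bar> powr p \<le> 2 powr p * (\<bar>A x\<bar> powr p + \<bar>B x\<bar> powr p)" for x
  proof -
    have "\<bar>A x - B x\<bar> powr p \<le> (2 * max \<bar>A x\<bar> \<bar>B x\<bar>) powr p" using p by (intro powr_mono2) auto
    also have "\<dots> = 2 powr p * (max \<bar>A x\<bar> \<bar>B x\<bar>) powr p" by (simp add: powr_mult)
    also have "\<dots> \<le> 2 powr p * (\<bar>A x\<bar> powr p + \<bar>B x\<bar> powr p)" by (intro mult_left_mono) (auto simp: max_def)
    finally show ?thesis .
  qed
  then show "AE x in N. norm (\<bar>A x - B x\<bar> powr p) \<le> norm (2 powr p * (\<bar>A x\<bar> powr p + \<bar>B x\<bar> powr p))" by simp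
qed simp

text \<open>The innovations up to time \<open>t\<close>, most recent first.\<close>

definition past :: "(int \<Rightarrow> 'a \<Rightarrow> real) \<Rightarrow> int \<Rightarrow> 'a \<Rightarrow> nat \<Rightarrow> real" where
  "past e t \<omega> = (\<lambda>j. e (t - int j) \<omega>)"

lemma causal_process_past: "causal_process g e t \<omega> = g (past e t \<omega>)"
  by (simp add: causal_process_def past_def)

lemma causal_process_shift: "causal_process g e (t - int i) \<omega> = g (shift i (past e t \<omega>))"
  by (simp add: causal_process_def past_def shift_def algebra_simps)

text \<open>At time \<open>t\<close> the innovation of time \<open>0\<close> is the coordinate
  \<open>t\<close> of the past.\<close>

lemma causal_process_coupled: "causal_process g (e(0 := e' 0)) (int t) \<omega> = g ((past e (int t) \<omega>)(t := e' 0 \<omega>))"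
  unfolding causal_process_def past_def by (rule arg_cong[where f = g]) (auto simp: fun_eq_iff)

lemma innovation_space_real:
  assumes "prob_space \<mu>" "sets \<mu> = sets (borel :: real measure)"
  shows "innovation_space \<mu>"
proof -
  interpret M: prob_space \<mu> by fact
  have "product_prob_space (\<lambda>i::nat. \<mu>)" by (rule product_prob_spaceI) (rule assms)
  then show ?thesis using sets_eq_imp_space_eq[OF assms(2)]
    by (simp add: innovation_space_def innovation_space_axioms_def sequence_space_def)
qed

context prob_space
begin

lemma random_variable_coordinates:
  assumes "iid M e" shows "e t \<in> borel_measurable M"
  using assms by (simp add: iid_def indep_vars_def)

lemma past_measurable:
  assumes "iid M e" shows "past e t \<in> M \<rightarrow>\<^sub>M Pi\<^sub>M UNIV (\<lambda>_. borel)"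
  unfolding past_def[abs_def] by (rule measurable_PiM_single') (use random_variable_coordinates[OF assms] in auto)

text \<open>The law of an independent family is the product of its marginals, and relabelling the times
  injectively preserves it.\<close>

lemma distr_past:
  assumes iid: "iid M e" and \<mu>: "\<mu> = distr M borel (e 0)"
  shows "distr M (Pi\<^sub>M UNIV (\<lambda>_. borel)) (past e t) = Pi\<^sub>M UNIV (\<lambda>_. \<mu>)"
proof -
  note [measurable] = random_variable_coordinates[OF iid]
  have p\<mu>: "prob_space \<mu>" unfolding \<mu> by (rule prob_space_distr) simp
  have "distr M (Pi\<^sub>M UNIV (\<lambda>_. borel)) (\<lambda>\<omega>. \<lambda>i\<in>UNIV. e i \<omega>) = Pi\<^sub>M UNIV (\<lambda>i. distr M borel (e i))"
    using iid indep_vars_iff_distr_eq_PiM[where I = UNIV and M' = "\<lambda>_. borel" and X = e] by (simp add: iid_def)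
  also have "(\<lambda>i. distr M borel (e i)) = (\<lambda>_. \<mu>)" using iid by (auto simp: iid_def \<mu>)
  finally have 1: "distr M (Pi\<^sub>M UNIV (\<lambda>_. borel)) (\<lambda>\<omega> i. e i \<omega>) = Pi\<^sub>M (UNIV :: int set) (\<lambda>_. \<mu>)" by simp
  have sb: "sets (Pi\<^sub>M UNIV (\<lambda>_::nat. \<mu>)) = sets (Pi\<^sub>M UNIV (\<lambda>_. borel))"
    by (rule sets_PiM_cong) (simp_all add: \<mu>)
  have me: "(\<lambda>\<omega> i. e i \<omega>) \<in> M \<rightarrow>\<^sub>M Pi\<^sub>M UNIV (\<lambda>_. borel)" by (rule measurable_PiM_single') auto
  have mt: "(\<lambda>x n. x (t - int n)) \<in> Pi\<^sub>M UNIV (\<lambda>_. borel :: real measure) \<rightarrow>\<^sub>M Pi\<^sub>M UNIV (\<lambda>_. borel)"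
    by (rule measurable_PiM_single') auto
  have "distr M (Pi\<^sub>M UNIV (\<lambda>_. borel)) (past e t)
     = distr (distr M (Pi\<^sub>M UNIV (\<lambda>_. borel)) (\<lambda>\<omega> i. e i \<omega>)) (Pi\<^sub>M UNIV (\<lambda>_. borel)) (\<lambda>x n. x (t - int n))"
    by (subst distr_distr[OF mt me]) (simp add: comp_def past_def[abs_def])
  also have "\<dots> = distr (Pi\<^sub>M UNIV (\<lambda>_. \<mu>)) (Pi\<^sub>M UNIV (\<lambda>_. \<mu>)) (\<lambda>x. \<lambda>n\<in>UNIV. x (t - int n))"
    unfolding 1 by (rule distr_cong) (use sb in auto)
  also have "\<dots> = Pi\<^sub>M UNIV (\<lambda>_. \<mu>)"
    by (rule distr_PiM_reindex) (auto simp: p\<mu> inj_on_def)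
  finally show ?thesis .
qed

text \<open>Independence of the two whole sequences passes to the images under the reversed past and under
  evaluation at time \<open>0\<close>.\<close>

lemma distr_past_copy:
  assumes iid: "iid M e" and ic: "independent_copy M e e'" and \<mu>: "\<mu> = distr M borel (e 0)"
  shows "distr M (Pi\<^sub>M UNIV (\<lambda>_. borel) \<Otimes>\<^sub>M borel) (\<lambda>\<omega>. (past e t \<omega>, e' 0 \<omega>)) = Pi\<^sub>M UNIV (\<lambda>_. \<mu>) \<Otimes>\<^sub>M \<mu>"
    and "(\<lambda>\<omega>. (past e t \<omega>, e' 0 \<omega>)) \<in> M \<rightarrow>\<^sub>M Pi\<^sub>M UNIV (\<lambda>_. borel) \<Otimes>\<^sub>M borel"
proof -
  have iid': "iid M e'" and d': "distr M borel (e' 0) = \<mu>"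
    and iv: "indep_var (\<Pi>\<^sub>M t\<in>UNIV. borel) (\<lambda>\<omega> t. e t \<omega>) (\<Pi>\<^sub>M t\<in>UNIV. borel) (\<lambda>\<omega> t. e' t \<omega>)"
    using ic \<mu> by (auto simp: independent_copy_def)
  have mt: "(\<lambda>x n. x (t - int n)) \<in> Pi\<^sub>M UNIV (\<lambda>_. borel :: real measure) \<rightarrow>\<^sub>M Pi\<^sub>M UNIV (\<lambda>_. borel)"
    by (rule measurable_PiM_single') auto
  have m0: "(\<lambda>x. x 0) \<in> Pi\<^sub>M (UNIV :: int set) (\<lambda>_. borel :: real measure) \<rightarrow>\<^sub>M borel" by simp
  let ?e = "\<lambda>\<omega> t. e t \<omega>" and ?e' = "\<lambda>\<omega> t. e' t \<omega>" and ?B = "Pi\<^sub>M (UNIV :: int set) (\<lambda>_. borel :: real measure)"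
  have me: "?e \<in> M \<rightarrow>\<^sub>M ?B" "?e' \<in> M \<rightarrow>\<^sub>M ?B"
    using iv unfolding indep_var_distribution_eq by blast+
  have joint: "distr M ?B ?e \<Otimes>\<^sub>M distr M ?B ?e' = distr M (?B \<Otimes>\<^sub>M ?B) (\<lambda>\<omega>. (?e \<omega>, ?e' \<omega>))"
    using iv unfolding indep_var_distribution_eq by blast
  have 1: "distr (distr M ?B ?e) (Pi\<^sub>M UNIV (\<lambda>_. borel)) (\<lambda>x n. x (t - int n)) = distr M (Pi\<^sub>M UNIV (\<lambda>_. borel)) (past e t)"
    by (subst distr_distr[OF mt me(1)]) (simp add: comp_def past_def[abs_def])
  have 2: "distr (distr M ?B ?e') borel (\<lambda>x. x 0) = distr M borel (e' 0)"
    by (subst distr_distr[OF m0 me(2)]) (simp add: comp_def)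
  have sf: "sigma_finite_measure (distr M borel (e' 0))"
    by (intro prob_space_imp_sigma_finite prob_space_distr random_variable_coordinates[OF iid'])
  have mp: "(\<lambda>(x, z). (\<lambda>n. x (t - int n), z 0)) \<in> ?B \<Otimes>\<^sub>M ?B \<rightarrow>\<^sub>M Pi\<^sub>M UNIV (\<lambda>_. borel) \<Otimes>\<^sub>M borel"
    unfolding split_def
    by (intro measurable_Pair measurable_compose[OF measurable_fst mt] measurable_compose[OF measurable_snd m0])
  have "distr M (Pi\<^sub>M UNIV (\<lambda>_. borel)) (past e t) \<Otimes>\<^sub>M distr M borel (e' 0)
     = distr (distr M ?B ?e \<Otimes>\<^sub>M distr M ?B ?e') (Pi\<^sub>M UNIV (\<lambda>_. borel) \<Otimes>\<^sub>M borel) (\<lambda>(x, z). (\<lambda>n. x (t - int n), z 0))"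
    unfolding 1[symmetric] 2[symmetric]
    by (rule pair_measure_distr) (use mt m0 sf 2 in auto)
  also have "\<dots> = distr M (Pi\<^sub>M UNIV (\<lambda>_. borel) \<Otimes>\<^sub>M borel) (\<lambda>\<omega>. (past e t \<omega>, e' 0 \<omega>))"
    unfolding joint by (subst distr_distr[OF mp measurable_Pair[OF me]]) (simp add: comp_def past_def[abs_def])
  finally have "distr M (Pi\<^sub>M UNIV (\<lambda>_. borel)) (past e t) \<Otimes>\<^sub>M distr M borel (e' 0)
    = distr M (Pi\<^sub>M UNIV (\<lambda>_. borel) \<Otimes>\<^sub>M borel) (\<lambda>\<omega>. (past e t \<omega>, e' 0 \<omega>))" .
  then show "distr M (Pi\<^sub>M UNIV (\<lambda>_. borel) \<Otimes>\<^sub>M borel) (\<lambda>\<omega>. (past e t \<omega>, e' 0 \<omega>)) = Pi\<^sub>M UNIV (\<lambda>_. \<mu>) \<Otimes>\<^sub>M \<mu>"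
    by (simp only: distr_past[OF iid \<mu>] d')
  show "(\<lambda>\<omega>. (past e t \<omega>, e' 0 \<omega>)) \<in> M \<rightarrow>\<^sub>M Pi\<^sub>M UNIV (\<lambda>_. borel) \<Otimes>\<^sub>M borel"
    by (rule measurable_Pair[OF past_measurable[OF iid] random_variable_coordinates[OF iid']])
qed

lemma Lp_norm_two: "Lp_norm M 2 Z = l2norm M Z"
  by (simp add: Lp_norm_def l2norm_def powr_half_sqrt)

lemma dep_measure_two:
  assumes iid: "iid M e" and ic: "independent_copy M e e'" and \<mu>: "\<mu> = distr M borel (e 0)"
    and g: "g \<in> borel_measurable (Pi\<^sub>M UNIV (\<lambda>_. borel))"
  shows "dep_measure M g e e' 2 t = innovation_space.dep \<mu> g t"
proof -
  interpret I: innovation_space \<mu> 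
    by (rule innovation_space_real) (use random_variable_coordinates[OF iid, of 0] in \<open>auto simp: \<mu> intro: prob_space_distr\<close>)
  have gS: "g \<in> borel_measurable (Pi\<^sub>M UNIV (\<lambda>_::nat. \<mu>))" 
    using g measurable_cong_sets[OF sets_PiM_cong[of UNIV UNIV "\<lambda>_::nat. \<mu>" "\<lambda>_. borel"] refl] by (auto simp: \<mu>)
  have sb: "sets (Pi\<^sub>M UNIV (\<lambda>_::nat. borel) \<Otimes>\<^sub>M borel) = sets (Pi\<^sub>M UNIV (\<lambda>_::nat. \<mu>) \<Otimes>\<^sub>M \<mu>)"
    unfolding distr_past_copy(1)[OF iid ic \<mu>, of 0, symmetric] by simp
  have m: "(\<lambda>p. (g (fst p) - g ((fst p)(t := snd p)))\<^sup>2) \<in> borel_measurable (Pi\<^sub>M UNIV (\<lambda>_::nat. borel) \<Otimes>\<^sub>M borel)"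
    unfolding measurable_cong_sets[OF sb refl] using I.measurable_dep[OF gS, of t] by simp
  have "(\<integral>p. (g (fst p) - g ((fst p)(t := snd p)))\<^sup>2 \<partial>(Pi\<^sub>M UNIV (\<lambda>_. \<mu>) \<Otimes>\<^sub>M \<mu>)) 
      = (\<integral>\<omega>. (g (past e (int t) \<omega>) - g ((past e (int t) \<omega>)(t := e' 0 \<omega>)))\<^sup>2 \<partial>M)"
    unfolding distr_past_copy(1)[OF iid ic \<mu>, of "int t", symmetric]
    by (subst integral_distr[OF distr_past_copy(2)[OF iid ic \<mu>] m]) simp
  then show ?thesis
    unfolding dep_measure_def causal_process_coupled unfolding Lp_norm_two I.dep_def l2norm_def causal_process_past by simp
qed

text \<open>Lyapunov's inequality for the coupled difference, which has a finite moment of order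
  \<open>p\<close> because the coupled observation has the same law as the original one.\<close>

lemma dep_measure_mono:
  assumes iid: "iid M e" and ic: "independent_copy M e e'" 
    and g: "g \<in> borel_measurable (Pi\<^sub>M UNIV (\<lambda>_. borel))"
    and p: "p > 2" and X: "\<And>t. in_Lp M p (causal_process g e t)"
  shows "dep_measure M g e e' 2 t \<le> dep_measure M g e e' p t"
proof -
  define \<mu> where "\<mu> = distr M borel (e 0)"
  interpret I: innovation_space \<mu> 
    by (rule innovation_space_real) (use random_variable_coordinates[OF iid, of 0] in \<open>auto simp: \<mu>_def intro: prob_space_distr\<close>)
  have sP: "sets (Pi\<^sub>M UNIV (\<lambda>_::nat. \<mu>)) = sets (Pi\<^sub>M UNIV (\<lambda>_. borel))" by (rule sets_PiM_cong) (simp_all add: \<mu>_def)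
  have sb: "sets (Pi\<^sub>M UNIV (\<lambda>_::nat. borel) \<Otimes>\<^sub>M borel) = sets (Pi\<^sub>M UNIV (\<lambda>_::nat. \<mu>) \<Otimes>\<^sub>M \<mu>)"
    unfolding distr_past_copy(1)[OF iid ic \<mu>_def, of 0, symmetric] by simp
  let ?c = "\<lambda>\<omega>. (past e (int t) \<omega>)(t := e' 0 \<omega>)"
  have u: "(\<lambda>p. (fst p)(t := snd p)) \<in> Pi\<^sub>M UNIV (\<lambda>_::nat. borel :: real measure) \<Otimes>\<^sub>M borel \<rightarrow>\<^sub>M Pi\<^sub>M UNIV (\<lambda>_. borel)"
    using I.measurable_upd[of t] unfolding measurable_cong_sets[OF sb[symmetric] sP] .
  have mc: "?c \<in> M \<rightarrow>\<^sub>M Pi\<^sub>M UNIV (\<lambda>_. borel)"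
    using measurable_compose[OF distr_past_copy(2)[OF iid ic \<mu>_def, of "int t"] u] by (simp only: fst_conv snd_conv)
  have "distr M (Pi\<^sub>M UNIV (\<lambda>_. borel)) ?c = distr (Pi\<^sub>M UNIV (\<lambda>_. \<mu>) \<Otimes>\<^sub>M \<mu>) (Pi\<^sub>M UNIV (\<lambda>_. borel)) (\<lambda>p. (fst p)(t := snd p))"
    unfolding distr_past_copy(1)[OF iid ic \<mu>_def, of "int t", symmetric]
    by (subst distr_distr[OF u distr_past_copy(2)[OF iid ic \<mu>_def]]) (simp only: comp_def fst_conv snd_conv)
  also have "\<dots> = distr (Pi\<^sub>M UNIV (\<lambda>_. \<mu>) \<Otimes>\<^sub>M \<mu>) (Pi\<^sub>M UNIV (\<lambda>_. \<mu>)) (\<lambda>p. (fst p)(t := snd p))"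
    by (rule distr_cong) (use sP in auto)
  also have "\<dots> = Pi\<^sub>M UNIV (\<lambda>_. \<mu>)" by (rule I.distr_upd)
  finally have dc: "distr M (Pi\<^sub>M UNIV (\<lambda>_. borel)) ?c = distr M (Pi\<^sub>M UNIV (\<lambda>_. borel)) (past e (int t))"
    by (simp only: distr_past[OF iid \<mu>_def])
  have gp: "(\<lambda>y. \<bar>g y\<bar> powr p) \<in> borel_measurable (Pi\<^sub>M UNIV (\<lambda>_. borel))" using g by measurable
  have i1: "integrable M (\<lambda>\<omega>. \<bar>g (past e (int t) \<omega>)\<bar> powr p)"
    using X[of "int t"] by (simp add: in_Lp_def causal_process_past)
  then have "integrable (distr M (Pi\<^sub>M UNIV (\<lambda>_. borel)) (past e (int t))) (\<lambda>y. \<bar>g y\<bar> powr p)"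
    by (simp only: integrable_distr_eq[OF past_measurable[OF iid] gp])
  then have i2: "integrable M (\<lambda>\<omega>. \<bar>g (?c \<omega>)\<bar> powr p)"
    unfolding dc[symmetric] by (simp only: integrable_distr_eq[OF mc gp])
  have m: "(\<lambda>\<omega>. g (past e (int t) \<omega>)) \<in> borel_measurable M" "(\<lambda>\<omega>. g (?c \<omega>)) \<in> borel_measurable M"
    by (rule measurable_compose[OF past_measurable[OF iid] g] measurable_compose[OF mc g])+
  have "l2norm M (\<lambda>\<omega>. g (past e (int t) \<omega>) - g (?c \<omega>)) \<le> (\<integral>\<omega>. \<bar>g (past e (int t) \<omega>) - g (?c \<omega>)\<bar> powr p \<partial>M) powr (1 / p)"
    by (rule lyapunov(2)[OF borel_measurable_diff[OF m] integrable_powr_diff[OF m i1 i2] p]) (use p in simp)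
  then show ?thesis
    unfolding dep_measure_def causal_process_coupled unfolding Lp_norm_two causal_process_past by (simp add: Lp_norm_def)
qed

end

text \<open>The operator norm is a supremum of continuous functions of the data, so its sublevel sets are
  closed. Measurability matters because a nonmeasurable event would have measure \<open>0\<close>.\<close>

lemma borel_measurable_op_norm_toeplitz:
  "(\<lambda>x. op_norm (toeplitz T x)) \<in> borel_measurable (Pi\<^sub>M UNIV (\<lambda>_. borel))"
proof (cases "T = 0")
  case True
  then have "toeplitz T x = toeplitz T (\<lambda>_. 0)" for x by (auto simp: toeplitz_def)
  then have "(\<lambda>x. op_norm (toeplitz T x)) = (\<lambda>x. op_norm (toeplitz T (\<lambda>_. 0)))" by (intro ext arg_cong[where f = op_norm])
  then show ?thesis by simp
next
  case False
  let ?U = "{u \<in> carrier_vec T. eucl_norm u = 1}"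
  have cont: "continuous_on UNIV (\<lambda>x. eucl_norm (toeplitz T x *\<^sub>v u))" if "u \<in> carrier_vec T" for u
  proof -
    have "eucl_norm (toeplitz T x *\<^sub>v u) = sqrt (\<Sum>i<T. (\<Sum>j<T. acov T x (nat \<bar>int i - int j\<bar>) * u $ j)\<^sup>2)" for x
      using that unfolding eucl_norm_def L2_set_def
      by (auto simp: toeplitz_def scalar_prod_def atLeast0LessThan intro!: arg_cong[where f = sqrt] sum.cong)
    then show ?thesis unfolding acov_def by (simp only:) (intro continuous_intros continuous_on_product_coordinates)
  qed
  have "{x. op_norm (toeplitz T x) \<le> c} = (\<Inter>u\<in>?U. {x. eucl_norm (toeplitz T x *\<^sub>v u) \<le> c})" for c
  proof (intro equalityI subsetI INT_I CollectI)
    fix x u assume "x \<in> {x. op_norm (toeplitz T x) \<le> c}" "u \<in> ?U"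
    then show "eucl_norm (toeplitz T x *\<^sub>v u) \<le> c"
      using eucl_norm_le_op_norm_toeplitz[of T u x] False by simp
  next
    fix x assume x: "x \<in> (\<Inter>u\<in>?U. {x. eucl_norm (toeplitz T x *\<^sub>v u) \<le> c})"
    have "?U \<noteq> {}" using unit_vector_exists[of T] False by auto
    then show "op_norm (toeplitz T x) \<le> c"
      unfolding op_norm_def using x by (intro cSUP_least) (auto simp: toeplitz_def)
  qed
  then have "closed {x. op_norm (toeplitz T x) \<le> c}" for c
    using cont by (auto intro!: closed_INT closed_Collect_le continuous_on_const)
  then have "(\<lambda>x. op_norm (toeplitz T x)) \<in> borel_measurable borel"
    unfolding borel_measurable_iff_le by simp
  then show ?thesis using measurable_cong_sets[OF sets_PiM_equal_borel refl] by blast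
qed

section \<open>The operator norm of the sample covariance matrix\<close>

context innovation_space
begin

lemma op_norm_measurable:
  fixes g :: "(nat \<Rightarrow> 'b) \<Rightarrow> real"
  assumes g: "g \<in> borel_measurable S"
  shows "(\<lambda>y. op_norm (toeplitz T (\<lambda>i. g (shift i y)))) \<in> borel_measurable S"
proof -
  have "(\<lambda>y i. g (shift i y)) \<in> S \<rightarrow>\<^sub>M Pi\<^sub>M UNIV (\<lambda>_. borel)"
    by (rule measurable_PiM_single') (use measurable_compose[OF measurable_shift g] in auto)
  then show ?thesis by (rule measurable_compose[OF _ borel_measurable_op_norm_toeplitz])
qed

text \<open>The variance of the partial sums is at most \<open>n\<close> times the square of the sum of the
  dependence coefficients.\<close>

lemma long_run_variance_le:
  fixes g :: "(nat \<Rightarrow> 'b) \<Rightarrow> real"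
  assumes m: "g \<in> borel_measurable S" and i: "integrable S (\<lambda>y. (g y)\<^sup>2)" and z: "(\<integral>y. g y \<partial>S) = 0"
    and sm: "summable (dep g)"
    and V: "V = (\<Sum>\<^sub>\<infinity>k::int. cov g (nat \<bar>k\<bar>))" "V > 0"
  shows "sqrt V \<le> (\<Sum>j. dep g j)"
proof (rule LIMSEQ_le_const2[OF long_run_variance[OF m i V]], intro exI[of _ 1] allI impI)
  fix n :: nat assume "1 \<le> n"
  then show "l2norm S (\<lambda>y. \<Sum>i<n. g (shift i y)) / sqrt n \<le> (\<Sum>j. dep g j)"
    using l2norm_sum_stationary[OF m i z sm, of n] by (simp add: field_simps)
qed

text \<open>Indices below \<open>2 T\<close> stand for cosine sums and the other \<open>2 T\<close> for sine
  sums; the periodogram adds the squares of one sum of each kind.\<close>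

lemma op_norm_le_maxform:
  fixes g :: "(nat \<Rightarrow> 'b) \<Rightarrow> real"
  assumes T: "T \<ge> 1" and b: "0 \<le> b"
    and le: "maxform {..<4 * T} T (\<lambda>k i. if k < 2 * T then cos (pi * real k / real T * real i)
      else sin (pi * real (k - 2 * T) / real T * real i)) g y \<le> sqrt (real T * b)"
  shows "op_norm (toeplitz T (\<lambda>i. g (shift i y))) \<le> 2 * b"
proof (rule op_norm_toeplitz_le)
  fix k assume k: "k < 2 * T"
  let ?w = "\<lambda>k i. if k < 2 * T then cos (pi * real k / real T * real i) else sin (pi * real (k - 2 * T) / real T * real i)"
  have sq: "a\<^sup>2 \<le> real T * b" if "\<bar>a\<bar> \<le> sqrt (real T * b)" for a
    using power_mono[OF that abs_ge_zero, of 2] b by simp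
  have all: "\<bar>\<Sum>i<T. ?w k i * g (shift i y)\<bar> \<le> sqrt (real T * b)" if "k < 4 * T" for k
    by (rule order_trans[OF maxform_ge[of "{..<4 * T}" k] le]) (use that in auto)
  have "\<bar>csum T (\<lambda>i. g (shift i y)) (pi * real k / real T)\<bar> \<le> sqrt (real T * b)"
    using all[of k] k by (simp add: csum_def)
  moreover have "\<bar>ssum T (\<lambda>i. g (shift i y)) (pi * real k / real T)\<bar> \<le> sqrt (real T * b)"
    using all[of "k + 2 * T"] k by (simp add: ssum_def)
  ultimately show "(csum T (\<lambda>i. g (shift i y)) (pi * real k / real T))\<^sup>2 + (ssum T (\<lambda>i. g (shift i y)) (pi * real k / real T))\<^sup>2
    \<le> real T * (2 * b)"
    using add_mono[OF sq[of "csum T (\<lambda>i. g (shift i y)) (pi * real k / real T)"] sq[of "ssum T (\<lambda>i. g (shift i y)) (pi * real k / real T)"]]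
    by (simp add: mult_ac)
qed (use T b in auto)

lemma op_norm_ge_maxform:
  fixes g :: "(nat \<Rightarrow> 'b) \<Rightarrow> real" and N :: nat
  assumes T: "T \<ge> 1" and N: "1 \<le> N" and b: "0 \<le> b"
    and ge: "sqrt (real T * b) \<le> maxform {1..N} T (\<lambda>k i. cos (\<theta> k * real i)) g y"
  shows "b / 2 \<le> op_norm (toeplitz T (\<lambda>i. g (shift i y)))"
proof -
  have "\<not> (\<forall>k\<in>{1..N}. \<bar>\<Sum>i<T. cos (\<theta> k * real i) * g (shift i y)\<bar> < sqrt (real T * b))"
  proof
    assume "\<forall>k\<in>{1..N}. \<bar>\<Sum>i<T. cos (\<theta> k * real i) * g (shift i y)\<bar> < sqrt (real T * b)"
    then have "maxform {1..N} T (\<lambda>k i. cos (\<theta> k * real i)) g y < sqrt (real T * b)"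
      using N unfolding maxform_def by (subst Max_less_iff) auto
    with ge show False by simp
  qed
  then obtain k where "sqrt (real T * b) \<le> \<bar>csum T (\<lambda>i. g (shift i y)) (\<theta> k)\<bar>"
    by (auto simp: csum_def not_less)
  then have "(sqrt (real T * b))\<^sup>2 \<le> \<bar>csum T (\<lambda>i. g (shift i y)) (\<theta> k)\<bar>\<^sup>2" using b by (intro power_mono) auto
  then have "real T * b \<le> (csum T (\<lambda>i. g (shift i y)) (\<theta> k))\<^sup>2" using b by simp
  then have "b / 2 \<le> (csum T (\<lambda>i. g (shift i y)) (\<theta> k))\<^sup>2 / (2 * real T)" using T by (simp add: field_simps)
  also have "\<dots> \<le> op_norm (toeplitz T (\<lambda>i. g (shift i y)))" using T by (intro op_norm_toeplitz_ge) simp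
  finally show ?thesis .
qed

text \<open>The lower constant is \<open>(3/25)\<^sup>2 / 2 = 9/1250\<close>. The frequencies in the lower
  bound depend on the admitted probability of failure, so the limit is taken for each such
  probability separately.\<close>

lemma op_norm_bounds:
  fixes g :: "(nat \<Rightarrow> 'b) \<Rightarrow> real"
  assumes m: "g \<in> borel_measurable S" and i: "integrable S (\<lambda>y. (g y)\<^sup>2)" and z: "(\<integral>y. g y \<partial>S) = 0"
    and sm: "summable (dep g)"
    and V: "V = (\<Sum>\<^sub>\<infinity>k::int. cov g (nat \<bar>k\<bar>))" "V > 0"
  shows "(\<lambda>T. measure S {y. 9/1250 * V * ln (real T) \<le> op_norm (toeplitz T (\<lambda>i. g (shift i y))) \<and>
     op_norm (toeplitz T (\<lambda>i. g (shift i y))) \<le> 10 * (\<Sum>j. dep g j)\<^sup>2 * ln (real T)}) \<longlonglongrightarrow> 1"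
proof -
  define \<Theta> where "\<Theta> = (\<Sum>j. dep g j)"
  have pos: "\<Theta> > 0" using long_run_variance_le[OF m i z sm V] real_sqrt_gt_zero[OF V(2)] unfolding \<Theta>_def by linarith
  define w where "w T k i = (if k < 2 * T then cos (pi * real k / real T * real i)
      else sin (pi * real (k - 2 * T) / real T * real i))" for T k i :: nat
  define op where "op T y = op_norm (toeplitz T (\<lambda>i. g (shift i y)))" for T y
  define E where "E T = {y. 9/1250 * V * ln (real T) \<le> op T y \<and> op T y \<le> 10 * \<Theta>\<^sup>2 * ln (real T)}" for T :: nat
  define U where "U T = {y. sqrt (5 * real T * ln T) * \<Theta> < maxform {..<4 * T} T (w T) g y}" for T
  have mop: "op T \<in> borel_measurable S" for T using op_norm_measurable[OF m] unfolding op_def[abs_def] .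
  have sE: "E T \<in> sets S" for T
  proof -
    have "E T = {y. 9/1250 * V * ln (real T) \<le> op T y} \<inter> (space S - {y. 10 * \<Theta>\<^sup>2 * ln (real T) < op T y})"
      by (auto simp: E_def)
    then show ?thesis using mop by (simp only:) (intro sets.Int sets.compl_sets sets_level)
  qed
  have U: "(\<lambda>T. measure S (U T)) \<longlonglongrightarrow> 0"
    using maxform_concentration[OF m i z sm, of w] pos unfolding U_def \<Theta>_def by (simp add: w_def)
  have "(\<lambda>T. measure S (E T)) \<longlonglongrightarrow> 1"
  proof (rule tendstoI)
    fix e :: real assume e: "e > 0"
    have e3: "e / 3 > 0" using e by simp
    obtain N \<theta> where L: "\<forall>\<^sub>F T in sequentially. (1::nat) \<le> N T \<and> 
        measure S {y. maxform {1..N T} T (\<lambda>k i. cos (\<theta> T k * real i)) g y < 3/25 * sqrt V * sqrt (real T * ln T)} \<le> e / 3"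
      using maxform_lower_bound[OF m i z sm long_run_variance[OF m i V] real_sqrt_gt_zero[OF V(2)] e3] by (elim exE) (rule that)
    have "\<forall>\<^sub>F T in sequentially. measure S (U T) < e / 3" by (rule order_tendstoD(2)[OF U e3])
    with L eventually_ge_at_top[of "1::nat"] 
    show "\<forall>\<^sub>F T in sequentially. dist (measure S (E T)) 1 < e"
    proof eventually_elim
      case (elim T)
      define Lo where "Lo = {y. maxform {1..N T} T (\<lambda>k i. cos (\<theta> T k * real i)) g y < 3/25 * sqrt V * sqrt (real T * ln T)}"
      have lnT: "ln (real T) \<ge> 0" using elim by simp
      have cover: "UNIV \<subseteq> E T \<union> (U T \<union> Lo)"
      proof (intro subsetI, rule ccontr)
        fix y :: "nat \<Rightarrow> 'b" assume n: "y \<notin> E T \<union> (U T \<union> Lo)"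
        then have "maxform {..<4 * T} T (w T) g y \<le> sqrt (real T * (5 * \<Theta>\<^sup>2 * ln T))"
          using pos by (auto simp: U_def not_less real_sqrt_mult mult_ac)
        from op_norm_le_maxform[OF _ _ this[unfolded w_def[abs_def]]] elim lnT
        have up: "op T y \<le> 10 * \<Theta>\<^sup>2 * ln T" by (simp add: op_def)
        have "3/25 * sqrt V * sqrt (real T * ln T) = sqrt (real T * (9/625 * V * ln T))"
        proof -
          have "sqrt (9/625) = (3/25 :: real)" by (rule real_sqrt_unique) (auto simp: power2_eq_square)
          then show ?thesis unfolding real_sqrt_mult by simp
        qed
        then have "sqrt (real T * (9/625 * V * ln T)) \<le> maxform {1..N T} T (\<lambda>k i. cos (\<theta> T k * real i)) g y"
          using n by (auto simp: Lo_def not_less)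
        from op_norm_ge_maxform[OF _ _ _ this] elim lnT V(2)
        have "9/1250 * V * ln T \<le> op T y" by (simp add: op_def)
        with up n show False by (simp add: E_def)
      qed
      have A: "finite {..<4*T}" "finite {1..N T}" by auto
      have sU: "U T \<in> sets S" unfolding U_def by (intro sets_level borel_measurable_maxform A m)
      have sL: "Lo \<in> sets S"
      proof -
        have "Lo = space S - {y. 3/25 * sqrt V * sqrt (real T * ln T) \<le> maxform {1..N T} T (\<lambda>k i. cos (\<theta> T k * real i)) g y}"
          by (auto simp: Lo_def)
        then show ?thesis by (simp only:) (intro sets.compl_sets sets_level borel_measurable_maxform A m)
      qed
      have "1 \<le> measure S (E T) + measure S (U T \<union> Lo)"
        using prob_cover_le[OF sE sets.Un[OF sU sL] cover] by simp
      moreover have "measure S (U T \<union> Lo) \<le> measure S (U T) + measure S Lo" by (intro prob_cover_le sU sL subset_refl)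
      moreover have "measure S (E T) \<le> 1" by simp
      ultimately show ?case using elim e unfolding Lo_def by (simp add: dist_real_def)
    qed
  qed
  then show ?thesis unfolding E_def op_def \<Theta>_def .
qed

end

text \<open>Reading the observations backwards from time \<open>T\<close> does not change the sample
  autocovariances.\<close>

lemma sample_cov_mat_toeplitz:
  "sample_cov_mat (causal_process g e) T \<omega> = toeplitz T (\<lambda>i. g (shift i (past e (int T) \<omega>)))"
proof -
  define X where "X = causal_process g e"
  have x: "g (shift i (past e (int T) \<omega>)) = X (int T - int i) \<omega>" for i
    by (simp add: X_def causal_process_shift)
  have "sample_autocov X T \<omega> k = acov T (\<lambda>i. X (int T - int i) \<omega>) (nat \<bar>k\<bar>)" for k
    unfolding sample_autocov_def acov_def
  proof (rule arg_cong[where f = "(*) (1 / real T)"])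
    show "(\<Sum>t\<in>{\<bar>k\<bar> + 1..int T}. X (t - \<bar>k\<bar>) \<omega> * X t \<omega>)
       = (\<Sum>i<T - nat \<bar>k\<bar>. X (int T - int i) \<omega> * X (int T - int (i + nat \<bar>k\<bar>)) \<omega>)"
      by (rule sum.reindex_bij_witness[of _ "\<lambda>i. int T - int i" "\<lambda>t. nat (int T - t)"]) (auto simp: algebra_simps)
  qed
  then show ?thesis unfolding sample_cov_mat_def toeplitz_def x X_def by simp
qed

context prob_space
begin

lemma integral_past:
  fixes h :: "(nat \<Rightarrow> real) \<Rightarrow> real"
  assumes iid: "iid M e" and \<mu>: "\<mu> = distr M borel (e 0)" and h: "h \<in> borel_measurable (Pi\<^sub>M UNIV (\<lambda>_. borel))"
  shows "(\<integral>\<omega>. h (past e t \<omega>) \<partial>M) = (\<integral>y. h y \<partial>(Pi\<^sub>M UNIV (\<lambda>_. \<mu>)))"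
    and "integrable M (\<lambda>\<omega>. h (past e t \<omega>)) \<longleftrightarrow> integrable (Pi\<^sub>M UNIV (\<lambda>_. \<mu>)) h"
  unfolding distr_past[OF iid \<mu>, of t, symmetric]
  by (simp_all only: integral_distr[OF past_measurable[OF iid] h] integrable_distr_eq[OF past_measurable[OF iid] h])

lemma autocov_cov:
  assumes iid: "iid M e" and \<mu>: "\<mu> = distr M borel (e 0)" and g: "g \<in> borel_measurable (Pi\<^sub>M UNIV (\<lambda>_. borel))"
    and I: "innovation_space \<mu>"
  shows "autocov M (causal_process g e) k = innovation_space.cov \<mu> g (nat \<bar>k\<bar>)"
proof -
  interpret I: innovation_space \<mu> by (rule I)
  have sP: "sets (Pi\<^sub>M UNIV (\<lambda>_::nat. \<mu>)) = sets (Pi\<^sub>M UNIV (\<lambda>_. borel))" by (rule sets_PiM_cong) (simp_all add: \<mu>)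
  have sh: "shift n \<in> Pi\<^sub>M UNIV (\<lambda>_::nat. borel :: real measure) \<rightarrow>\<^sub>M Pi\<^sub>M UNIV (\<lambda>_. borel)" for n
    using I.measurable_shift[of n] unfolding measurable_cong_sets[OF sP sP] .
  have h: "(\<lambda>y. g y * g (shift n y)) \<in> borel_measurable (Pi\<^sub>M UNIV (\<lambda>_. borel))" for n
    using g measurable_compose[OF sh g] by (intro borel_measurable_times)
  have main: "(\<integral>\<omega>. causal_process g e t \<omega> * causal_process g e (t - int n) \<omega> \<partial>M) = I.cov g n" for t n
    unfolding causal_process_shift I.cov_def unfolding causal_process_past by (rule integral_past(1)[OF iid \<mu> h])
  show ?thesis
  proof (cases "k \<ge> 0")
    case True then show ?thesis using main[of k "nat k"] by (simp add: autocov_def mult.commute)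
  next
    case False then show ?thesis using main[of 0 "nat (- k)"] by (simp add: autocov_def)
  qed
qed

end

theorem theorem2:
  fixes M :: "'a measure"
    and e e' :: "int \<Rightarrow> 'a \<Rightarrow> real"
    and g :: "(nat \<Rightarrow> real) \<Rightarrow> real"
    and p :: real
  defines "X \<equiv> causal_process g e"
  defines "\<Theta> \<equiv> dep_tail M g e e'"
  defines "fmin \<equiv> (INF \<theta>. spectral_density M X \<theta>)"
  assumes "prob_space M"
    and "iid M e"
    and "independent_copy M e e'"
    and "g \<in> borel_measurable (\<Pi>\<^sub>M j\<in>UNIV. borel)"
    and "p > 2"
    and "\<And>t. in_Lp M p (X t)"
    and "\<And>t. (LINT \<omega>|M. X t \<omega>) = 0"
    and "summable (dep_measure M g e e' p)"
    and "\<Theta> p \<in> o(\<lambda>m. 1 / ln (real m))"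
    and "fmin > 0"
  shows "(\<lambda>T. measure M {\<omega> \<in> space M.
            pi * fmin\<^sup>2 * ln (real T) / (12 * (\<Theta> 2 0)\<^sup>2) \<le> op_norm (sample_cov_mat X T \<omega>) \<and>
            op_norm (sample_cov_mat X T \<omega>) \<le> 10 * (\<Theta> 2 0)\<^sup>2 * ln (real T)})
         \<longlonglongrightarrow> 1"
proof -
  note iid = assms(5) and copy = assms(6) and g = assms(7) and p = assms(8) and Lp = assms(9)[unfolded X_def]
  interpret prob_space M by fact
  define \<mu> where "\<mu> = distr M borel (e 0)"
  have I: "innovation_space \<mu>"
    by (rule innovation_space_real) (use random_variable_coordinates[OF iid, of 0] in \<open>auto simp: \<mu>_def intro: prob_space_distr\<close>)
  interpret I: innovation_space \<mu> by (rule I)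
  let ?S = "Pi\<^sub>M UNIV (\<lambda>_::nat. \<mu>)"
  have sP: "sets ?S = sets (Pi\<^sub>M UNIV (\<lambda>_. borel))" by (rule sets_PiM_cong) (simp_all add: \<mu>_def)
  have gS: "g \<in> borel_measurable ?S" unfolding measurable_cong_sets[OF sP refl] by (rule g)
  have g2: "(\<lambda>y. (g y)\<^sup>2) \<in> borel_measurable (Pi\<^sub>M UNIV (\<lambda>_. borel))" using g by measurable
  have i: "integrable ?S (\<lambda>y. (g y)\<^sup>2)"
    using lyapunov(1)[of "causal_process g e 0" p] Lp[of 0] p integral_past(2)[OF iid \<mu>_def g2, of 0]
    by (simp add: in_Lp_def causal_process_past)
  have z: "(\<integral>y. g y \<partial>?S) = 0"
    using assms(10)[of 0] integral_past(1)[OF iid \<mu>_def g, of 0] by (simp add: X_def causal_process_past)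
  have dep: "dep_measure M g e e' 2 = I.dep g" using dep_measure_two[OF iid copy \<mu>_def g] by (rule ext)
  have sm: "summable (I.dep g)"
  proof (rule summable_comparison_test'[OF assms(11)])
    show "norm (I.dep g t) \<le> dep_measure M g e e' p t" for t
      using dep_measure_mono[OF iid copy g p Lp, of t] unfolding dep by simp
  qed
  have \<Theta>: "\<Theta> 2 0 = (\<Sum>j. I.dep g j)" by (simp add: \<Theta>_def dep_tail_def dep)
  have sd: "spectral_density M X \<theta> = 1 / (2 * pi) * (\<Sum>\<^sub>\<infinity>k::int. I.cov g (nat \<bar>k\<bar>) * cos (of_int k * \<theta>))" for \<theta>
    unfolding spectral_density_def X_def autocov_cov[OF iid \<mu>_def g I] ..
  define V where "V = (\<Sum>\<^sub>\<infinity>k::int. I.cov g (nat \<bar>k\<bar>))"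
  have "0 \<le> spectral_density M X \<theta>" for \<theta> unfolding sd using I.fourier_series_nonneg[OF gS i] by simp
  then have "bdd_below (range (spectral_density M X))" by (intro bdd_belowI[of _ 0]) auto
  then have "fmin \<le> spectral_density M X 0" unfolding fmin_def by (rule cINF_lower) simp
  also have "\<dots> = V / (2 * pi)" by (simp add: sd V_def)
  finally have fV: "fmin \<le> V / (2 * pi)" .
  then have "0 < V / (2 * pi)" using assms(13) by linarith
  then have V0: "V > 0" by (simp add: zero_less_divide_iff)
  have VT: "V \<le> (\<Theta> 2 0)\<^sup>2"
  proof -
    have "(sqrt V)\<^sup>2 \<le> (\<Theta> 2 0)\<^sup>2" unfolding \<Theta> using V0
      by (intro power_mono I.long_run_variance_le[OF gS i z sm V_def]) auto
    then show ?thesis using V0 by simp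
  qed
  then have T0: "(\<Theta> 2 0)\<^sup>2 > 0" using V0 by linarith
  have const: "pi * fmin\<^sup>2 / (12 * (\<Theta> 2 0)\<^sup>2) \<le> 9/1250 * V"
  proof -
    have "fmin\<^sup>2 \<le> (V / (2 * pi))\<^sup>2" using fV assms(13) by (intro power_mono) auto
    then have "pi * fmin\<^sup>2 / (12 * (\<Theta> 2 0)\<^sup>2) \<le> pi * (V / (2 * pi))\<^sup>2 / (12 * V)"
      using VT V0 by (intro frac_le mult_left_mono) auto
    also have "\<dots> = V / (48 * pi)" using V0 by (simp add: power2_eq_square field_simps)
    also have "\<dots> \<le> V / (48 * 3)" using V0 pi_gt3 by (intro divide_left_mono) auto
    also have "\<dots> \<le> 9/1250 * V" using V0 by simp
    finally show ?thesis .
  qed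
  define op where "op T y = op_norm (toeplitz T (\<lambda>i. g (shift i y)))" for T y
  define E where "E T = {y. pi * fmin\<^sup>2 * ln (real T) / (12 * (\<Theta> 2 0)\<^sup>2) \<le> op T y \<and> op T y \<le> 10 * (\<Theta> 2 0)\<^sup>2 * ln (real T)}" for T
  have mop: "op T \<in> borel_measurable ?S" for T using I.op_norm_measurable[OF gS] unfolding op_def[abs_def] .
  have sE: "E T \<in> sets ?S" for T
  proof -
    have "E T = {y. pi * fmin\<^sup>2 * ln (real T) / (12 * (\<Theta> 2 0)\<^sup>2) \<le> op T y} \<inter> (space ?S - {y. 10 * (\<Theta> 2 0)\<^sup>2 * ln (real T) < op T y})"
      by (auto simp: E_def)
    then show ?thesis using mop by (simp only:) (intro sets.Int sets.compl_sets I.sets_level)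
  qed
  have "(\<lambda>T. measure ?S (E T)) \<longlonglongrightarrow> 1"
  proof (rule tendsto_sandwich[OF _ _ I.op_norm_bounds[OF gS i z sm V_def V0] tendsto_const])
    show "\<forall>\<^sub>F T in sequentially. measure ?S {y. 9/1250 * V * ln (real T) \<le> op_norm (toeplitz T (\<lambda>i. g (shift i y))) \<and>
      op_norm (toeplitz T (\<lambda>i. g (shift i y))) \<le> 10 * (\<Sum>j. I.dep g j)\<^sup>2 * ln (real T)} \<le> measure ?S (E T)"
    proof (rule eventually_mono[OF eventually_ge_at_top[of "1::nat"]])
      fix T :: nat assume "1 \<le> T"
      then have "ln (real T) \<ge> 0" by simp
      from mult_right_mono[OF const this]
      have c: "pi * fmin\<^sup>2 * ln (real T) / (12 * (\<Theta> 2 0)\<^sup>2) \<le> 9/1250 * V * ln (real T)" by simp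
      show "measure ?S {y. 9/1250 * V * ln (real T) \<le> op_norm (toeplitz T (\<lambda>i. g (shift i y))) \<and>
        op_norm (toeplitz T (\<lambda>i. g (shift i y))) \<le> 10 * (\<Sum>j. I.dep g j)\<^sup>2 * ln (real T)} \<le> measure ?S (E T)"
        unfolding \<Theta>[symmetric] E_def op_def
        by (intro I.P.finite_measure_mono sE[unfolded E_def op_def] subsetI) (use order_trans[OF c] in blast)
    qed
    show "\<forall>\<^sub>F T in sequentially. measure ?S (E T) \<le> 1" by simp
  qed
  moreover have "measure ?S (E T) = measure M {\<omega> \<in> space M.
            pi * fmin\<^sup>2 * ln (real T) / (12 * (\<Theta> 2 0)\<^sup>2) \<le> op_norm (sample_cov_mat X T \<omega>) \<and>
            op_norm (sample_cov_mat X T \<omega>) \<le> 10 * (\<Theta> 2 0)\<^sup>2 * ln (real T)}" for T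
  proof -
    have "measure ?S (E T) = measure M (past e (int T) -` E T \<inter> space M)"
      unfolding distr_past[OF iid \<mu>_def, of "int T", symmetric]
      by (rule measure_distr[OF past_measurable[OF iid]]) (use sE sP in simp)
    also have "past e (int T) -` E T \<inter> space M = {\<omega> \<in> space M.
            pi * fmin\<^sup>2 * ln (real T) / (12 * (\<Theta> 2 0)\<^sup>2) \<le> op_norm (sample_cov_mat X T \<omega>) \<and>
            op_norm (sample_cov_mat X T \<omega>) \<le> 10 * (\<Theta> 2 0)\<^sup>2 * ln (real T)}"
      by (auto simp: E_def op_def X_def sample_cov_mat_toeplitz)
    finally show ?thesis .
  qed
  ultimately show ?thesis by simp
qed

end
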